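(* Consider two boundary value problems of the form described in the context, with the same $\rho$ and the same coefficients $b_i,c_i$, but with potentials $\Omega(x)$ and $\tilde\Omega(x)$, and let $M(\lambda)$ and $\tilde M(\lambda)$ be their Weyl functions. If $M(\lambda)=\tilde M(\lambda)$, then $\Omega(x)=\tilde\Omega(x)$ (almost everywhere on $(0,\pi)$); i.e. the boundary value problem is uniquely determined by the Weyl function.
   Context: Let $0<a<\pi$, $\alpha>0$, $\alpha\neq1$, $\rho(x)=1$ for $0\le x\le a$ and $\rho(x)=\alpha$ for $a<x\le\pi$. Let $b_1,\dots,b_4,c_1,\dots,c_4$ be real numbers with $k_1:=b_1b_4-b_2b_3>0$ and $k_2:=c_1c_4-c_2c_3>0$. For real-valued $p,q\in L_2(0,\pi)$ put $$B=\begin{pmatrix}0&1\\ -1&0\end{pmatrix},\quad \Omega(x)=\begin{pmatrix}p(x)&q(x)\\ q(x)&-p(x)\end{pmatrix},\quad y(x)=\begin{pmatrix}y_1(x)\\ y_2(x)\end{pmatrix},$$ and consider the boundary value problem consisting of the system $By'+\Omega(x)y=\lambda\rho(x)y$, $0<x<\pi$ ($\lambda\in\mathbb{C}$ the spectral parameter), and the boundary conditions $$U_1(y):=b_1y_2(0)+b_2y_1(0)-\lambda(b_3y_2(0)+b_4y_1(0))=0,$$ $$U_2(y):=c_1y_2(\pi)+c_2y_1(\pi)+\lambda(c_3y_2(\pi)+c_4y_1(\pi))=0.$$ The Weyl solution $\Phi(x,\lambda)=(\Phi_1,\Phi_2)^T$ is the solution of the system satisfying $U_1(\Phi)=1$,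 $U_2(\Phi)=0$ (defined for $\lambda$ not an eigenvalue of the problem), and the Weyl function is the meromorphic function $$M(\lambda)=-\frac{b_4\Phi_1(0,\lambda)+b_3\Phi_2(0,\lambda)}{k_1}.$$ The second problem has potential $\tilde\Omega(x)=\begin{pmatrix}\tilde p(x)&\tilde q(x)\\ \tilde q(x)&-\tilde p(x)\end{pmatrix}$ with real-valued $\tilde p,\tilde q\in L_2(0,\pi)$; its Weyl function $\tilde M$ is defined in the same way. *)

theory Defs
  imports "HOL-Analysis.Analysis"
begin

definition L2_on :: "real set \<Rightarrow> (real \<Rightarrow> real) \<Rightarrow> bool" where
  "L2_on S f \<longleftrightarrow> f \<in> borel_measurable (lebesgue_on S) \<and> integrable (lebesgue_on S) (\<lambda>x. (f x)\<^sup>2)"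

text \<open>Absolute continuity on a compact interval (the usual epsilon-delta condition).
  A set \<open>D\<close> with \<open>D division_of \<Union>D\<close> is a finite family of nonoverlapping
  compact intervals \<open>K = {Inf K..Sup K}\<close>.\<close>

definition abs_continuous_on :: "real \<Rightarrow> real \<Rightarrow> (real \<Rightarrow> 'a::real_normed_vector) \<Rightarrow> bool" where
  "abs_continuous_on u v f \<longleftrightarrow>
     (\<forall>\<epsilon>>0. \<exists>\<delta>>0. \<forall>D. D division_of \<Union>D \<and> \<Union>D \<subseteq> {u..v} \<and> (\<Sum>K\<in>D. Sup K - Inf K) < \<delta>
        \<longrightarrow> (\<Sum>K\<in>D. norm (f (Sup K) - f (Inf K))) < \<epsilon>)"

definition rho :: "real \<Rightarrow> real \<Rightarrow> real \<Rightarrow> real" where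
  "rho a \<alpha> x = (if x \<le> a then 1 else \<alpha>)"

definition Bmat :: "complex^2^2" where
  "Bmat = vector [vector [0, 1], vector [-1, 0]]"

definition Omega :: "(real \<Rightarrow> real) \<Rightarrow> (real \<Rightarrow> real) \<Rightarrow> real \<Rightarrow> complex^2^2" where
  "Omega p q x =
     vector [vector [complex_of_real (p x), complex_of_real (q x)],
             vector [complex_of_real (q x), - complex_of_real (p x)]]"

text \<open>Since the potential is only square integrable, a solution of the system is an absolutely
  continuous function on \<open>[0, \<pi>]\<close> that satisfies it almost everywhere.\<close>

definition dirac_solution ::
  "real \<Rightarrow> real \<Rightarrow> (real \<Rightarrow> real) \<Rightarrow> (real \<Rightarrow> real) \<Rightarrow> complex \<Rightarrow> (real \<Rightarrow> complex^2) \<Rightarrow> bool" where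
  "dirac_solution a \<alpha> p q lam y \<longleftrightarrow>
     abs_continuous_on 0 pi y \<and>
     (AE x in lebesgue_on {0<..<pi}. \<exists>y'.
        (y has_vector_derivative y') (at x) \<and>
        Bmat *v y' + Omega p q x *v y x = (lam * complex_of_real (rho a \<alpha> x)) *s y x)"

text \<open>The coefficients \<open>b\<^sub>1, \<dots>, b\<^sub>4\<close> are the components \<open>b $ 1, \<dots>, b $ 4\<close>; likewise for \<open>c\<close>.\<close>

definition U1 :: "real^4 \<Rightarrow> complex \<Rightarrow> (real \<Rightarrow> complex^2) \<Rightarrow> complex" where
  "U1 b lam y = complex_of_real (b$1) * y 0 $ 2 + complex_of_real (b$2) * y 0 $ 1
     - lam * (complex_of_real (b$3) * y 0 $ 2 + complex_of_real (b$4) * y 0 $ 1)"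

definition U2 :: "real^4 \<Rightarrow> complex \<Rightarrow> (real \<Rightarrow> complex^2) \<Rightarrow> complex" where
  "U2 c lam y = complex_of_real (c$1) * y pi $ 2 + complex_of_real (c$2) * y pi $ 1
     + lam * (complex_of_real (c$3) * y pi $ 2 + complex_of_real (c$4) * y pi $ 1)"

definition bc_det :: "real^4 \<Rightarrow> real" where
  "bc_det b = b$1 * b$4 - b$2 * b$3"

definition is_eigenvalue ::
  "real \<Rightarrow> real \<Rightarrow> real^4 \<Rightarrow> real^4 \<Rightarrow> (real \<Rightarrow> real) \<Rightarrow> (real \<Rightarrow> real) \<Rightarrow> complex \<Rightarrow> bool" where
  "is_eigenvalue a \<alpha> b c p q lam \<longleftrightarrow>
     (\<exists>y. dirac_solution a \<alpha> p q lam y \<and> (\<exists>x\<in>{0..pi}. y x \<noteq> 0) \<and> U1 b lam y = 0 \<and> U2 c lam y = 0)"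

definition is_weyl_solution ::
  "real \<Rightarrow> real \<Rightarrow> real^4 \<Rightarrow> real^4 \<Rightarrow> (real \<Rightarrow> real) \<Rightarrow> (real \<Rightarrow> real) \<Rightarrow> complex
     \<Rightarrow> (real \<Rightarrow> complex^2) \<Rightarrow> bool" where
  "is_weyl_solution a \<alpha> b c p q lam \<Phi> \<longleftrightarrow>
     dirac_solution a \<alpha> p q lam \<Phi> \<and> U1 b lam \<Phi> = 1 \<and> U2 c lam \<Phi> = 0"

text \<open>When \<open>lam\<close> is not an eigenvalue, the Weyl solution is unique on \<open>[0, \<pi>]\<close>
  (though not as a function on the whole real line, hence \<open>SOME\<close> rather than \<open>THE\<close>).
  The value at an eigenvalue is meaningless.\<close>

definition weyl_solution ::
  "real \<Rightarrow> real \<Rightarrow> real^4 \<Rightarrow> real^4 \<Rightarrow> (real \<Rightarrow> real) \<Rightarrow> (real \<Rightarrow> real) \<Rightarrow> complex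
     \<Rightarrow> real \<Rightarrow> complex^2" where
  "weyl_solution a \<alpha> b c p q lam = (SOME \<Phi>. is_weyl_solution a \<alpha> b c p q lam \<Phi>)"

definition weyl_function ::
  "real \<Rightarrow> real \<Rightarrow> real^4 \<Rightarrow> real^4 \<Rightarrow> (real \<Rightarrow> real) \<Rightarrow> (real \<Rightarrow> real) \<Rightarrow> complex \<Rightarrow> complex" where
  "weyl_function a \<alpha> b c p q lam =
     - (complex_of_real (b$4) * weyl_solution a \<alpha> b c p q lam 0 $ 1
        + complex_of_real (b$3) * weyl_solution a \<alpha> b c p q lam 0 $ 2) / complex_of_real (bc_det b)"

text \<open>Equality of the two Weyl functions as meromorphic functions: they agree wherever
  both are defined, i.e. off the eigenvalues of the two problems.\<close>

definition same_weyl_function ::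
  "real \<Rightarrow> real \<Rightarrow> real^4 \<Rightarrow> real^4 \<Rightarrow> (real \<Rightarrow> real) \<Rightarrow> (real \<Rightarrow> real)
     \<Rightarrow> (real \<Rightarrow> real) \<Rightarrow> (real \<Rightarrow> real) \<Rightarrow> bool" where
  "same_weyl_function a \<alpha> b c p q pt qt \<longleftrightarrow>
     (\<forall>lam. \<not> is_eigenvalue a \<alpha> b c p q lam \<and> \<not> is_eigenvalue a \<alpha> b c pt qt lam \<longrightarrow>
        weyl_function a \<alpha> b c p q lam = weyl_function a \<alpha> b c pt qt lam)"

end

theory Submission
  imports Defs "HOL-Complex_Analysis.Cauchy_Integral_Formula"
begin

text \<open>
  In the coordinates \<open>f = y\<^sub>1 + \<i> y\<^sub>2\<close>, \<open>g = y\<^sub>1 - \<i> y\<^sub>2\<close> and with \<open>v = q - \<i> p\<close> the Dirac system becomes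
  \<open>f' = \<i> \<lambda> \<rho> f + v g\<close>, \<open>g' = - \<i> \<lambda> \<rho> g + cnj v f\<close>. Let \<open>Y\<close> and \<open>Y~\<close> be the fundamental matrices for the
  two potentials that are the identity at \<open>0\<close>. The proof studies \<open>P(x, \<lambda>) = Y Y~\<^sup>-\<^sup>1\<close>, which for
  fixed \<open>x\<close> is entire in \<open>\<lambda>\<close>, and shows that it is bounded, hence independent of \<open>\<lambda>\<close> by
  Liouville's theorem.

  The values \<open>M(\<lambda>)\<close> and \<open>U\<^sub>1(\<Phi>) = 1\<close> determine \<open>\<Phi>(0, \<lambda>)\<close>, because \<open>k\<^sub>1 \<noteq> 0\<close>. So equal Weyl functions
  give Weyl solutions with equal initial values, and \<open>P\<close> may be written with the Weyl solutions
  \<open>\<chi>\<close>, \<open>\<chi>~\<close> and the solutions \<open>\<phi>\<close>, \<open>\<phi>~\<close> starting at \<open>(0, 1)\<close> as columns. For \<open>Im \<lambda> > 0\<close> the energy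
  \<open>|g|\<^sup>2 - |f|\<^sup>2\<close> of a solution is nondecreasing. Therefore \<open>\<phi>\<close> satisfies \<open>|f| \<le> |g|\<close> throughout, while the
  sign of \<open>k\<^sub>2\<close> makes \<open>\<chi>\<close> satisfy \<open>|g| \<le> |f|\<close> at \<open>\<pi>\<close> and hence throughout. For large \<open>Im \<lambda>\<close> square
  integrability of \<open>v\<close> even gives \<open>2 |f| \<le> |g|\<close> for \<open>\<phi>\<close> (\<open>phi_contraction\<close>), and then the constant Wronskian
  of \<open>\<phi>\<close> and \<open>\<chi>\<close> bounds the product of their sizes (\<open>subordinate_bounds\<close>). As \<open>|\<phi>|\<close> is comparable to
  \<open>exp (Im \<lambda> \<integral>\<rho>)\<close> for either potential (\<open>phi2_bounds\<close>), the entries of \<open>P\<close>, which pair \<open>\<phi>\<close> with \<open>\<chi>~\<close>, are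
  bounded for large \<open>Im \<lambda>\<close>. Complex conjugation carries this to large \<open>- Im \<lambda>\<close>, and Gronwall's
  inequality covers the strip in between.

  Finally, \<open>P\<close> satisfies a linear differential equation in which \<open>\<lambda>\<close> occurs only in the terms
  \<open>2 \<i> \<lambda> \<rho> P\<^sub>1\<^sub>2\<close> and \<open>- 2 \<i> \<lambda> \<rho> P\<^sub>2\<^sub>1\<close> of the off-diagonal part. As \<open>P\<close> does not depend on \<open>\<lambda>\<close>, the off-diagonal entries vanish, so the diagonal
  is constant and equal to \<open>1\<close>, and what is left of the equation says \<open>v = v~\<close> almost everywhere
  (\<open>potentials_equal\<close>).

  The Weyl solutions exist for all \<open>\<lambda>\<close> in the open upper half plane, because no eigenvalue lies there: by
  \<open>k\<^sub>1 > 0\<close> and \<open>k\<^sub>2 > 0\<close> an eigenfunction has nonnegative energy at \<open>0\<close> and nonpositive energy at \<open>\<pi>\<close>, while the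
  energy of a nonzero solution strictly increases.
  Since the potentials are only square integrable, all of this rests on a calculus of absolutely
  continuous functions: one with almost everywhere nonnegative derivative is nondecreasing, and
  indefinite integrals are absolutely continuous and differentiable almost everywhere with the
  expected derivative.
\<close>

section \<open>Absolutely continuous functions\<close>

lemma AE_lebesgue_on_iff_negligible:
  assumes "S \<in> sets lebesgue"
  shows "(AE x in lebesgue_on S. P x) \<longleftrightarrow> negligible {x\<in>S. \<not> P x}"
proof -
  have "(AE x in lebesgue_on S. P x) \<longleftrightarrow> (AE x in lebesgue. x \<in> S \<longrightarrow> P x)"
    using assms by (intro AE_restrict_space_iff) auto
  also have "\<dots> \<longleftrightarrow> {x. \<not> (x \<in> S \<longrightarrow> P x)} \<in> null_sets lebesgue"
    by (subst completion.AE_iff_null_sets) auto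
  also have "{x. \<not> (x \<in> S \<longrightarrow> P x)} = {x\<in>S. \<not> P x}" by auto
  finally show ?thesis by (simp add: negligible_iff_null_sets)
qed

lemma AE_lebesgue_on_mem: "S \<in> sets lebesgue \<Longrightarrow> AE x in lebesgue_on S. x \<in> S"
  by (simp add: AE_lebesgue_on_iff_negligible)

lemma AE_lebesgue_on_nontrivial:
  assumes "a < (b::real)" "AE x in lebesgue_on {a<..<b}. P x"
  obtains x where "x \<in> {a<..<b}" "P x"
proof -
  have "\<not> negligible {a<..<b}"
    using assms(1) open_not_negligible[of "{a<..<b}"] by simp
  moreover have "negligible {x\<in>{a<..<b}. \<not> P x}"
    using assms(2) by (simp add: AE_lebesgue_on_iff_negligible)
  ultimately show ?thesis using that by (metis (mono_tags, lifting) mem_Collect_eq negligible_subset subsetI)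
qed

lemma division_of_real_interval:
  fixes D :: "real set set"
  assumes "D division_of S" "K \<in> D"
  shows "K = {Inf K..Sup K}" "Inf K \<le> Sup K" "Inf K \<in> K" "Sup K \<in> K" "K \<subseteq> S"
    "measure lebesgue K = Sup K - Inf K"
proof -
  obtain c d where "K = cbox c d" "K \<noteq> {}" "K \<subseteq> S"
    using division_ofD[OF assms(1)] assms(2) by metis
  then have "K = {c..d}" "c \<le> d" by auto
  then show "K = {Inf K..Sup K}" "Inf K \<le> Sup K" "Inf K \<in> K" "Sup K \<in> K" "K \<subseteq> S"
    "measure lebesgue K = Sup K - Inf K"
    using \<open>K \<subseteq> S\<close> by auto
qed

lemma division_length_eq_measure:
  fixes D :: "real set set"
  assumes "D division_of S"
  shows "(\<Sum>K\<in>D. Sup K - Inf K) = measure lebesgue S"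
  using content_division[OF assms] division_of_real_interval(6)[OF assms]
  by (metis (no_types, lifting) sum.cong)

text \<open>All closure properties below are instances: an increment of \<open>h\<close> that is controlled by increments of
  absolutely continuous functions inherits their smallness.\<close>

lemma abs_continuous_on_dominated:
  assumes f: "abs_continuous_on u v f" and g: "abs_continuous_on u v g"
    and le: "\<And>x y. x \<in> {u..v} \<Longrightarrow> y \<in> {u..v} \<Longrightarrow>
      norm (h x - h y) \<le> L * (norm (f x - f y) + norm (g x - g y))"
  shows "abs_continuous_on u v h"
  unfolding abs_continuous_on_def
proof (intro allI impI)
  fix \<epsilon> :: real assume "\<epsilon> > 0"
  define e where "e = \<epsilon> / (2 * (\<bar>L\<bar> + 1))"
  have "e > 0" using \<open>\<epsilon> > 0\<close> by (simp add: e_def)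
  obtain d1 where d1: "d1 > 0" "\<And>D. D division_of \<Union>D \<Longrightarrow> \<Union>D \<subseteq> {u..v} \<Longrightarrow>
      (\<Sum>K\<in>D. Sup K - Inf K) < d1 \<Longrightarrow> (\<Sum>K\<in>D. norm (f (Sup K) - f (Inf K))) < e"
    using f \<open>e > 0\<close> unfolding abs_continuous_on_def by meson
  obtain d2 where d2: "d2 > 0" "\<And>D. D division_of \<Union>D \<Longrightarrow> \<Union>D \<subseteq> {u..v} \<Longrightarrow>
      (\<Sum>K\<in>D. Sup K - Inf K) < d2 \<Longrightarrow> (\<Sum>K\<in>D. norm (g (Sup K) - g (Inf K))) < e"
    using g \<open>e > 0\<close> unfolding abs_continuous_on_def by meson
  show "\<exists>\<delta>>0. \<forall>D. D division_of \<Union>D \<and> \<Union>D \<subseteq> {u..v} \<and> (\<Sum>K\<in>D. Sup K - Inf K) < \<delta>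
      \<longrightarrow> (\<Sum>K\<in>D. norm (h (Sup K) - h (Inf K))) < \<epsilon>"
  proof (intro exI[of _ "min d1 d2"] conjI allI impI)
    show "min d1 d2 > 0" using d1 d2 by simp
    fix D :: "real set set"
    assume D: "D division_of \<Union>D \<and> \<Union>D \<subseteq> {u..v} \<and> (\<Sum>K\<in>D. Sup K - Inf K) < min d1 d2"
    have in_uv: "Sup K \<in> {u..v}" "Inf K \<in> {u..v}" if "K \<in> D" for K
      using division_of_real_interval(3,4)[of D "\<Union>D" K] D that by auto
    have "(\<Sum>K\<in>D. norm (h (Sup K) - h (Inf K)))
        \<le> (\<Sum>K\<in>D. (\<bar>L\<bar> + 1) * (norm (f (Sup K) - f (Inf K)) + norm (g (Sup K) - g (Inf K))))"
    proof (rule sum_mono)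
      fix K assume "K \<in> D"
      have "norm (h (Sup K) - h (Inf K)) \<le> L * (norm (f (Sup K) - f (Inf K)) + norm (g (Sup K) - g (Inf K)))"
        using le in_uv[OF \<open>K \<in> D\<close>] by blast
      also have "\<dots> \<le> (\<bar>L\<bar> + 1) * (norm (f (Sup K) - f (Inf K)) + norm (g (Sup K) - g (Inf K)))"
        by (intro mult_right_mono) auto
      finally show "norm (h (Sup K) - h (Inf K)) \<le> (\<bar>L\<bar> + 1) * (norm (f (Sup K) - f (Inf K)) + norm (g (Sup K) - g (Inf K)))" .
    qed
    also have "\<dots> = (\<bar>L\<bar> + 1) * ((\<Sum>K\<in>D. norm (f (Sup K) - f (Inf K))) + (\<Sum>K\<in>D. norm (g (Sup K) - g (Inf K))))"
      by (simp add: sum.distrib sum_distrib_left algebra_simps)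
    also have "\<dots> < (\<bar>L\<bar> + 1) * (e + e)"
      using d1(2)[of D] d2(2)[of D] D by (intro mult_strict_left_mono add_strict_mono) auto
    also have "\<dots> = \<epsilon>" unfolding e_def by (simp add: divide_simps)
    finally show "(\<Sum>K\<in>D. norm (h (Sup K) - h (Inf K))) < \<epsilon>" .
  qed
qed

lemma abs_continuous_on_lipschitz:
  assumes "abs_continuous_on u v f"
    and "\<And>x y. x \<in> {u..v} \<Longrightarrow> y \<in> {u..v} \<Longrightarrow> norm (h x - h y) \<le> L * norm (f x - f y)"
  shows "abs_continuous_on u v h"
  using assms(2) by (intro abs_continuous_on_dominated[OF assms(1) assms(1), where L = "L/2"]) auto

lemma abs_continuous_on_const: "abs_continuous_on u v (\<lambda>x. c)"
  unfolding abs_continuous_on_def by (auto intro: exI[of _ 1])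

lemma abs_continuous_on_add:
  assumes "abs_continuous_on u v f" "abs_continuous_on u v g"
  shows "abs_continuous_on u v (\<lambda>x. f x + g x)"
proof (rule abs_continuous_on_dominated[OF assms, where L=1])
  show "norm (f x + g x - (f y + g y)) \<le> 1 * (norm (f x - f y) + norm (g x - g y))" for x y
    using norm_triangle_ineq[of "f x - f y" "g x - g y"] by (simp add: algebra_simps)
qed

lemma abs_continuous_on_bounded_linear:
  assumes "bounded_linear h" "abs_continuous_on u v f"
  shows "abs_continuous_on u v (\<lambda>x. h (f x))"
proof -
  interpret bounded_linear h by fact
  obtain L where "\<And>x. norm (h x) \<le> norm x * L" using bounded by blast
  then show ?thesis
    by (intro abs_continuous_on_lipschitz[OF assms(2), where L=L]) (metis diff mult.commute)
qed

lemma abs_continuous_on_imp_continuous_on: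
  assumes "abs_continuous_on u v f"
  shows "continuous_on {u..v} f"
proof (rule continuous_on_iff[THEN iffD2], intro ballI allI impI)
  fix x e :: real assume "x \<in> {u..v}" "e > 0"
  obtain d where d: "d > 0" "\<And>D. D division_of \<Union>D \<Longrightarrow> \<Union>D \<subseteq> {u..v} \<Longrightarrow>
      (\<Sum>K\<in>D. Sup K - Inf K) < d \<Longrightarrow> (\<Sum>K\<in>D. norm (f (Sup K) - f (Inf K))) < e"
    using assms \<open>e > 0\<close> unfolding abs_continuous_on_def by meson
  have *: "dist (f y) (f x) < e" if "x \<in> {u..v}" "y \<in> {u..v}" "x \<le> y" "y - x < d" for x y
    using d(2)[of "{{x..y}}"] that division_of_self[of x y] by (auto simp: dist_norm)
  show "\<exists>d>0. \<forall>x'\<in>{u..v}. dist x' x < d \<longrightarrow> dist (f x') (f x) < e"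
  proof (intro exI[of _ d] conjI ballI impI)
    fix y assume "y \<in> {u..v}" "dist y x < d"
    then show "dist (f y) (f x) < e"
      using *[of x y] *[of y x] \<open>x \<in> {u..v}\<close> by (cases "x \<le> y") (auto simp: dist_real_def dist_commute)
  qed (use d in auto)
qed

lemma abs_continuous_on_mult:
  fixes f g :: "real \<Rightarrow> 'a::real_normed_algebra"
  assumes "abs_continuous_on u v f" "abs_continuous_on u v g"
  shows "abs_continuous_on u v (\<lambda>x. f x * g x)"
proof -
  have "bounded (f ` {u..v})" "bounded (g ` {u..v})"
    using assms by (auto intro!: compact_imp_bounded compact_continuous_image abs_continuous_on_imp_continuous_on)
  then obtain A B where A: "\<And>x. x \<in> {u..v} \<Longrightarrow> norm (f x) \<le> A" and B: "\<And>x. x \<in> {u..v} \<Longrightarrow> norm (g x) \<le> B"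
    unfolding bounded_iff by (metis imageI)
  show ?thesis
  proof (rule abs_continuous_on_dominated[OF assms, where L = "\<bar>A\<bar> + \<bar>B\<bar>"])
    fix x y assume xy: "x \<in> {u..v}" "y \<in> {u..v}"
    have "norm (f x * g x - f y * g y) = norm ((f x - f y) * g x + f y * (g x - g y))"
      by (simp add: algebra_simps)
    also have "\<dots> \<le> norm (f x - f y) * norm (g x) + norm (f y) * norm (g x - g y)"
      by (meson norm_add_rule_thm norm_mult_ineq)
    also have "\<dots> \<le> norm (f x - f y) * (\<bar>A\<bar> + \<bar>B\<bar>) + (\<bar>A\<bar> + \<bar>B\<bar>) * norm (g x - g y)"
      using A[OF xy(2)] B[OF xy(1)] by (intro add_mono mult_left_mono mult_right_mono) auto
    finally show "norm (f x * g x - f y * g y) \<le> (\<bar>A\<bar> + \<bar>B\<bar>) * (norm (f x - f y) + norm (g x - g y))"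
      by (simp add: algebra_simps)
  qed
qed

lemma abs_continuous_on_exp:
  fixes f :: "real \<Rightarrow> real"
  assumes "abs_continuous_on u v f"
  shows "abs_continuous_on u v (\<lambda>x. exp (f x))"
proof -
  have "bounded (f ` {u..v})"
    using assms by (auto intro!: compact_imp_bounded compact_continuous_image abs_continuous_on_imp_continuous_on)
  then obtain A where A: "\<And>x. x \<in> {u..v} \<Longrightarrow> \<bar>f x\<bar> \<le> A"
    unfolding bounded_iff by (metis imageI real_norm_def)
  \<comment> \<open>The tangent of \<open>exp\<close> at \<open>t\<close> lies below its graph.\<close>
  have *: "exp t - exp s \<le> exp A * (t - s)" if "s \<le> t" "\<bar>t\<bar> \<le> A" for s t :: real
  proof -
    have "exp t * (1 + (s - t)) \<le> exp t * exp (s - t)"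
      using exp_ge_add_one_self[of "s - t"] by (intro mult_left_mono) auto
    also have "\<dots> = exp s" by (simp add: exp_diff)
    finally have "exp t - exp s \<le> exp t * (t - s)" by (simp add: algebra_simps)
    also have "\<dots> \<le> exp A * (t - s)" using that by (intro mult_right_mono) auto
    finally show ?thesis .
  qed
  show ?thesis
  proof (rule abs_continuous_on_lipschitz[OF assms, where L="exp A"])
    fix x y assume "x \<in> {u..v}" "y \<in> {u..v}"
    then show "norm (exp (f x) - exp (f y)) \<le> exp A * norm (f x - f y)"
      using *[of "f x" "f y"] *[of "f y" "f x"] A[of x] A[of y] by (cases "f x \<le> f y") (auto simp: abs_if)
  qed
qed

text \<open>Cousin's lemma provides a tagged division adapted to a gauge. At tags where the derivative exists and
  is nonnegative the gauge forces increments of slope at least \<open>- \<epsilon>\<close>; the exceptional tags form a null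
  set, which the gauge encloses in an open set of small measure, so absolute continuity makes their
  total contribution small.\<close>

lemma abs_continuous_on_mono_of_deriv_nonneg:
  fixes f :: "real \<Rightarrow> real"
  assumes ac: "abs_continuous_on u v f"
    and deriv: "AE x in lebesgue_on {u<..<v}. \<exists>d\<ge>0. (f has_real_derivative d) (at x)"
    and uv: "u \<le> s" "s \<le> t" "t \<le> v"
  shows "f s \<le> f t"
proof (rule field_le_epsilon)
  fix e :: real assume "e > 0"
  define \<epsilon> where "\<epsilon> = e / (t - s + 1)"
  have "\<epsilon> > 0" using \<open>e > 0\<close> uv by (simp add: \<epsilon>_def)
  obtain \<delta> where \<delta>: "\<delta> > 0" "\<And>D. D division_of \<Union>D \<Longrightarrow> \<Union>D \<subseteq> {u..v} \<Longrightarrow>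
      (\<Sum>K\<in>D. Sup K - Inf K) < \<delta> \<Longrightarrow> (\<Sum>K\<in>D. norm (f (Sup K) - f (Inf K))) < \<epsilon>"
    using ac \<open>\<epsilon> > 0\<close> unfolding abs_continuous_on_def by meson
  define N where "N = {x\<in>{u<..<v}. \<not> (\<exists>d\<ge>0. (f has_real_derivative d) (at x))} \<union> {u, v}"
  have "negligible N"
    using deriv by (auto simp: N_def AE_lebesgue_on_iff_negligible)
  then have N: "N \<in> sets lebesgue" "emeasure lebesgue N = 0"
    by (auto simp: negligible_iff_null_sets)
  obtain U where U: "open U" "N \<subseteq> U" "U - N \<in> lmeasurable" "emeasure lebesgue (U - N) < ennreal \<delta>"
    using sets_lebesgue_outer_open[OF N(1) \<open>\<delta> > 0\<close>] by metis
  have Um: "U \<in> lmeasurable" "measure lebesgue U < \<delta>"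
  proof -
    have "U = (U - N) \<union> N" using U by auto
    moreover have "N \<in> lmeasurable" by (simp add: \<open>negligible N\<close> negligible_imp_measurable)
    ultimately show 1: "U \<in> lmeasurable" using fmeasurable.Un[OF U(3)] by metis
    have "measure lebesgue U \<le> measure lebesgue (U - N) + measure lebesgue N"
      using measure_Un_le[of "U - N" lebesgue N] U(3) N(1) \<open>U = _\<close> by (metis fmeasurableD)
    also have "measure lebesgue N = 0"
      using N by (simp add: measure_def)
    also have "measure lebesgue (U - N) < \<delta>"
      using U(4) emeasure_eq_measure2[OF U(3)] \<open>\<delta> > 0\<close> by (simp add: ennreal_less_iff)
    finally show "measure lebesgue U < \<delta>" by simp
  qed
  \<comment> \<open>Near a point with nonnegative derivative the function cannot drop faster than slope \<open>\<epsilon>\<close>.\<close>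
  have "\<exists>r>0. \<forall>y. \<bar>y - x\<bar> < r \<longrightarrow> (x \<le> y \<longrightarrow> f y - f x \<ge> - \<epsilon> * (y - x)) \<and> (y \<le> x \<longrightarrow> f x - f y \<ge> - \<epsilon> * (x - y))"
    if "x \<in> {u..v}" "x \<notin> N" for x
  proof -
    have "u < x" "x < v" using that by (auto simp: N_def order.order_iff_strict)
    then have "\<exists>d\<ge>0. (f has_real_derivative d) (at x)"
      using \<open>x \<notin> N\<close> by (simp add: N_def)
    then obtain d where d: "d \<ge> 0" "(f has_real_derivative d) (at x)" by blast
    have "(f has_derivative (\<lambda>h. d * h)) (at x)" using d(2) by (simp add: has_field_derivative_def)
    then obtain r where r: "r > 0" "\<And>y. norm (y - x) < r \<Longrightarrow> norm (f y - f x - d * (y - x)) \<le> \<epsilon> * norm (y - x)"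
      using \<open>\<epsilon> > 0\<close> unfolding has_derivative_at_alt by blast
    show ?thesis
    proof (intro exI[of _ r] conjI allI impI)
      fix y assume y: "\<bar>y - x\<bar> < r"
      show "f y - f x \<ge> - \<epsilon> * (y - x)" if "x \<le> y"
      proof -
        have "0 \<le> d * (y - x)" using d that by simp
        then show ?thesis using r(2)[of y] y that by (simp add: abs_le_iff)
      qed
      show "f x - f y \<ge> - \<epsilon> * (x - y)" if "y \<le> x"
      proof -
        have "0 \<le> d * (x - y)" using d that by simp
        then have "d * (y - x) \<le> 0" by (simp add: algebra_simps)
        then show ?thesis using r(2)[of y] y that by (simp add: abs_le_iff algebra_simps)
      qed
    qed (use r in auto)
  qed
  then have "\<forall>x. \<exists>r. x \<in> {u..v} \<and> x \<notin> N \<longrightarrow> r > 0 \<and> (\<forall>y. \<bar>y - x\<bar> < r \<longrightarrow>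
      (x \<le> y \<longrightarrow> f y - f x \<ge> - \<epsilon> * (y - x)) \<and> (y \<le> x \<longrightarrow> f x - f y \<ge> - \<epsilon> * (x - y)))"
    by blast
  then obtain r where "\<forall>x. x \<in> {u..v} \<and> x \<notin> N \<longrightarrow> r x > 0 \<and> (\<forall>y. \<bar>y - x\<bar> < r x \<longrightarrow>
      (x \<le> y \<longrightarrow> f y - f x \<ge> - \<epsilon> * (y - x)) \<and> (y \<le> x \<longrightarrow> f x - f y \<ge> - \<epsilon> * (x - y)))"
    unfolding choice_iff by blast
  then have r: "\<And>x. x \<in> {u..v} \<Longrightarrow> x \<notin> N \<Longrightarrow> r x > 0"
    "\<And>x y. x \<in> {u..v} \<Longrightarrow> x \<notin> N \<Longrightarrow> \<bar>y - x\<bar> < r x \<Longrightarrow> x \<le> y \<Longrightarrow> f y - f x \<ge> - \<epsilon> * (y - x)"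
    "\<And>x y. x \<in> {u..v} \<Longrightarrow> x \<notin> N \<Longrightarrow> \<bar>y - x\<bar> < r x \<Longrightarrow> y \<le> x \<Longrightarrow> f x - f y \<ge> - \<epsilon> * (x - y)"
    by blast+
  define \<gamma> where "\<gamma> x = (if x \<in> N then U else if x \<in> {u..v} then ball x (r x) else UNIV)" for x
  have "gauge \<gamma>"
    using U r by (auto simp: gauge_def \<gamma>_def)
  then obtain p where "p tagged_division_of (cbox s t)" "\<gamma> fine p"
    by (rule fine_division_exists)
  then have p: "p tagged_division_of {s..t}" "\<gamma> fine p"
    by auto
  note pD = tagged_division_ofD[OF p(1)]
  define A where "A = {xK \<in> p. fst xK \<in> N}"
  have "finite p" by (rule pD(1))
  have "A \<subseteq> p" by (auto simp: A_def)
  have part: "A tagged_partial_division_of {s..t}"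
    by (rule tagged_partial_division_subset[OF p(1)[unfolded tagged_division_of_def, THEN conjunct1] \<open>A \<subseteq> p\<close>])
  have divA: "(snd ` A) division_of \<Union>(snd ` A)"
    using partial_division_of_tagged_division[OF part] .
  have intv: "K = {Inf K..Sup K}" "Inf K \<le> Sup K" "K \<subseteq> {u..v}" "x \<in> K" "Inf K \<in> K" "Sup K \<in> K" if "(x, K) \<in> p" for x K
  proof -
    have "K \<in> snd ` p" using that by force
    then show "K = {Inf K..Sup K}" "Inf K \<le> Sup K" "Inf K \<in> K" "Sup K \<in> K"
      using division_of_real_interval[OF division_of_tagged_division[OF p(1)], of K] by simp_all
    show "x \<in> K" "K \<subseteq> {u..v}" using pD(2,3)[OF that] uv by auto
  qed
  \<comment> \<open>The intervals tagged in the exceptional set have small total length.\<close>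
  have subU: "\<Union>(snd ` A) \<subseteq> U"
    using p(2) by (fastforce simp: fine_def A_def \<gamma>_def)
  have "(\<Sum>K\<in>snd ` A. Sup K - Inf K) = measure lebesgue (\<Union>(snd ` A))"
    by (rule division_length_eq_measure[OF divA])
  also have "\<dots> \<le> measure lebesgue U"
    using subU Um(1) division_of_finite[OF divA] lmeasurable_division[OF divA]
    by (intro measure_mono_fmeasurable) auto
  also have "\<dots> < \<delta>" by (rule Um)
  finally have "(\<Sum>K\<in>snd ` A. norm (f (Sup K) - f (Inf K))) < \<epsilon>"
    using intv(3) \<open>A \<subseteq> p\<close> by (intro \<delta>(2)[OF divA]) (force simp del: atLeastAtMost_iff)+
  moreover have "(\<Sum>(x,K)\<in>A. norm (f (Sup K) - f (Inf K))) = (\<Sum>K\<in>snd ` A. norm (f (Sup K) - f (Inf K)))"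
  proof -
    have "finite A" using \<open>finite p\<close> \<open>A \<subseteq> p\<close> finite_subset by blast
    then have "(\<Sum>K\<in>snd ` A. norm (f (Sup K) - f (Inf K)))
        = (\<Sum>xK\<in>A. ((\<lambda>K. norm (f (Sup K) - f (Inf K))) \<circ> snd) xK)"
    proof (rule sum.reindex_nontrivial)
      \<comment> \<open>Two tags can share an interval only if it is a single point.\<close>
      fix xK yL assume "xK \<in> A" "yL \<in> A" "xK \<noteq> yL" "snd xK = snd yL"
      then obtain x y K where xy: "(x, K) \<in> p" "(y, K) \<in> p" "x \<noteq> y" "xK = (x, K)"
        using \<open>A \<subseteq> p\<close> by (metis prod.collapse subsetD)
      then have "interior K = {}" using pD(5)[of x K y K] by simp
      then have "interior {Inf K..Sup K} = {}" using intv(1)[OF xy(1)] by simp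
      then have "Inf K = Sup K" using intv(2)[OF xy(1)] by simp
      then show "norm (f (Sup (snd xK)) - f (Inf (snd xK))) = 0" using xy(4) by simp
    qed
    then show ?thesis by (simp add: case_prod_unfold)
  qed
  ultimately have "(\<Sum>(x,K)\<in>A. norm (f (Sup K) - f (Inf K))) < \<epsilon>" by simp
  moreover have "- (\<Sum>(x,K)\<in>A. norm (f (Sup K) - f (Inf K))) \<le> (\<Sum>(x,K)\<in>A. f (Sup K) - f (Inf K))"
    unfolding sum_negf[symmetric] by (intro sum_mono) (auto simp: abs_if)
  ultimately have sumA: "(\<Sum>(x,K)\<in>A. f (Sup K) - f (Inf K)) \<ge> - \<epsilon>" by simp
  have "(\<Sum>(x,K)\<in>p - A. f (Sup K) - f (Inf K)) \<ge> (\<Sum>(x,K)\<in>p - A. - \<epsilon> * (Sup K - Inf K))"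
  proof (rule sum_mono, clarify)
    fix x K assume xK: "(x, K) \<in> p" "(x, K) \<notin> A"
    then have x: "x \<notin> N" "x \<in> {u..v}" using intv(3,4)[OF xK(1)] by (auto simp: A_def)
    then have "K \<subseteq> ball x (r x)" using fineD[OF p(2) xK(1)] by (simp add: \<gamma>_def)
    then have "\<bar>Sup K - x\<bar> < r x" "\<bar>Inf K - x\<bar> < r x"
      using intv(5,6)[OF xK(1)] by (auto simp: dist_real_def abs_minus_commute)
    moreover have "Inf K \<le> x" "x \<le> Sup K" using intv(1,4)[OF xK(1)] by (metis atLeastAtMost_iff)+
    ultimately show "f (Sup K) - f (Inf K) \<ge> - \<epsilon> * (Sup K - Inf K)"
      using r(2)[OF x(2,1), of "Sup K"] r(3)[OF x(2,1), of "Inf K"] by (auto simp: algebra_simps)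
  qed
  also have "(\<Sum>(x,K)\<in>p - A. - \<epsilon> * (Sup K - Inf K)) = - \<epsilon> * (\<Sum>(x,K)\<in>p - A. Sup K - Inf K)"
    by (simp add: sum_distrib_left case_prod_unfold)
  also have "\<dots> \<ge> - \<epsilon> * (\<Sum>(x,K)\<in>p. Sup K - Inf K)"
    using \<open>\<epsilon> > 0\<close> \<open>finite p\<close> intv(2) by (auto intro!: sum_mono2)
  also have "(\<Sum>(x,K)\<in>p. Sup K - Inf K) = t - s"
    using additive_tagged_division_1[OF uv(2) p(1), of "\<lambda>x. x"] .
  finally have "(\<Sum>(x,K)\<in>p - A. f (Sup K) - f (Inf K)) \<ge> - \<epsilon> * (t - s)" .
  moreover have "f t - f s = (\<Sum>(x,K)\<in>p - A. f (Sup K) - f (Inf K)) + (\<Sum>(x,K)\<in>A. f (Sup K) - f (Inf K))"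
    using additive_tagged_division_1[OF uv(2) p(1), of f] sum.subset_diff[OF \<open>A \<subseteq> p\<close> \<open>finite p\<close>] by metis
  moreover have "\<epsilon> * (t - s + 1) = e"
    using uv by (simp add: \<epsilon>_def)
  then have "\<epsilon> * (t - s) + \<epsilon> = e" by (simp add: algebra_simps)
  ultimately show "f s \<le> f t + e" using sumA by simp
qed

text \<open>Lebesgue's differentiation theorem on the line. At a point where differentiation fails there are
  arbitrarily short intervals on which the increment of the integral is far from \<open>h x\<close> times the length. Vitali's
  lemma selects disjoint ones whose fivefold enlargements cover all such points, and Henstock's lemma
  bounds the total discrepancy over disjoint intervals, hence their total length.\<close>

lemma indefinite_integral_has_derivative_AE:
  fixes h :: "real \<Rightarrow> 'a::euclidean_space"
  assumes h: "h integrable_on {u..v}"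
  shows "AE x in lebesgue_on {u<..<v}. ((\<lambda>x. integral {u..x} h) has_vector_derivative h x) (at x)"
proof -
  define F where "F x = integral {u..x} h" for x
  \<comment> \<open>The points where difference quotients deviate by more than \<open>e\<close> at arbitrarily small scales.\<close>
  define Bad where "Bad e = {x\<in>{u<..<v}. \<forall>r>0. \<exists>y\<in>{u..v}. y \<noteq> x \<and> \<bar>y - x\<bar> < r \<and>
      norm (F y - F x - (y - x) *\<^sub>R h x) > e * \<bar>y - x\<bar>}" for e
  have "negligible (Bad e)" if "e > 0" for e
    unfolding negligible_outer
  proof (intro allI impI)
    fix \<eta> :: real assume "\<eta> > 0"
    define \<epsilon> where "\<epsilon> = e * \<eta> / 10"
    have "\<epsilon> > 0" using \<open>e > 0\<close> \<open>\<eta> > 0\<close> by (simp add: \<epsilon>_def)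
    obtain \<gamma> where \<gamma>: "gauge \<gamma>" "\<And>p. p tagged_partial_division_of (cbox u v) \<Longrightarrow> \<gamma> fine p \<Longrightarrow>
        (\<Sum>(x,K)\<in>p. norm (measure lborel K *\<^sub>R h x - integral K h)) < \<epsilon>"
      using Henstock_lemma[of h u v \<epsilon>] h \<open>\<epsilon> > 0\<close> by auto
    have "\<exists>y\<in>{u..v}. y \<noteq> x \<and> {min x y..max x y} \<subseteq> \<gamma> x \<and> norm (F y - F x - (y - x) *\<^sub>R h x) > e * \<bar>y - x\<bar>"
      if "x \<in> Bad e" for x
    proof -
      have "open (\<gamma> x)" "x \<in> \<gamma> x" using \<gamma>(1) by (auto simp: gauge_def)
      then obtain r where r: "r > 0" "ball x r \<subseteq> \<gamma> x" by (meson open_contains_ball)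
      then obtain y where y: "y \<in> {u..v}" "y \<noteq> x" "\<bar>y - x\<bar> < r" "norm (F y - F x - (y - x) *\<^sub>R h x) > e * \<bar>y - x\<bar>"
        using \<open>x \<in> Bad e\<close> unfolding Bad_def by blast
      moreover have "{min x y..max x y} \<subseteq> ball x r" using y(3) by (auto simp: dist_real_def)
      ultimately show ?thesis using r by blast
    qed
    then obtain y where y: "\<And>x. x \<in> Bad e \<Longrightarrow> y x \<in> {u..v}" "\<And>x. x \<in> Bad e \<Longrightarrow> y x \<noteq> x"
      "\<And>x. x \<in> Bad e \<Longrightarrow> {min x (y x)..max x (y x)} \<subseteq> \<gamma> x"
      "\<And>x. x \<in> Bad e \<Longrightarrow> norm (F (y x) - F x - (y x - x) *\<^sub>R h x) > e * \<bar>y x - x\<bar>"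
      by metis
    define c where "c x = (x + y x) / 2" for x
    define r where "r x = \<bar>y x - x\<bar> / 2" for x
    have ball_eq: "cball (c x) (r x) = {min x (y x)..max x (y x)}" for x
      by (auto simp: cball_eq_atLeastAtMost c_def r_def min_def max_def abs_if field_simps)
    have "Bad e \<subseteq> (\<Union>i\<in>Bad e. cball (c i) (r i))" unfolding ball_eq by auto
    moreover have "0 < r i \<and> r i \<le> v - u" if "i \<in> Bad e" for i
      using y(1,2)[OF that] that by (auto simp: r_def Bad_def abs_if)
    ultimately obtain C where C: "countable C" "C \<subseteq> Bad e"
      "pairwise (\<lambda>i j. disjnt (cball (c i) (r i)) (cball (c j) (r j))) C"
      "Bad e \<subseteq> (\<Union>i\<in>C. cball (c i) (5 * r i))"
      by (rule Vitali_covering_lemma_cballs)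
    have fin: "measure lebesgue (\<Union>i\<in>I. cball (c i) (5 * r i)) \<le> \<eta> / 2" if "I \<subseteq> C" "finite I" for I
    proof -
      define p where "p = (\<lambda>x. (x, cball (c x) (r x))) ` I"
      have IB: "i \<in> Bad e" if "i \<in> I" for i using that \<open>I \<subseteq> C\<close> C(2) by auto
      have sub: "cball (c i) (r i) \<subseteq> {u..v}" if "i \<in> I" for i
        using y(1)[OF IB[OF that]] IB[OF that] unfolding ball_eq by (auto simp: Bad_def)
      have "p tagged_partial_division_of cbox u v"
        unfolding tagged_partial_division_of_def
      proof (intro conjI allI impI)
        show "finite p" using \<open>finite I\<close> by (simp add: p_def)
        fix x K assume "(x, K) \<in> p"
        then have xK: "x \<in> I" "K = cball (c x) (r x)" by (auto simp: p_def)
        show "x \<in> K" unfolding xK ball_eq by auto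
        show "K \<subseteq> cbox u v" using sub xK by auto
        show "\<exists>a b. K = cbox a b" unfolding xK ball_eq box_real by blast
      next
        fix x1 K1 x2 K2 assume "(x1, K1) \<in> p \<and> (x2, K2) \<in> p \<and> (x1, K1) \<noteq> (x2, K2)"
        then have "x1 \<in> I" "x2 \<in> I" "x1 \<noteq> x2" "K1 = cball (c x1) (r x1)" "K2 = cball (c x2) (r x2)"
          by (auto simp: p_def)
        then have "disjnt K1 K2" using C(3) \<open>I \<subseteq> C\<close> unfolding pairwise_def by blast
        then show "interior K1 \<inter> interior K2 = {}"
          unfolding disjnt_def using interior_subset by blast
      qed
      moreover have "\<gamma> fine p"
        using y(3)[OF IB] unfolding fine_def p_def ball_eq by auto
      ultimately have "(\<Sum>(x,K)\<in>p. norm (measure lborel K *\<^sub>R h x - integral K h)) < \<epsilon>"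
        by (rule \<gamma>(2))
      also have "(\<Sum>(x,K)\<in>p. norm (measure lborel K *\<^sub>R h x - integral K h))
          = (\<Sum>x\<in>I. norm (measure lborel (cball (c x) (r x)) *\<^sub>R h x - integral (cball (c x) (r x)) h))"
        unfolding p_def by (subst sum.reindex) (auto simp: inj_on_def)
      finally have less: "(\<Sum>x\<in>I. norm (measure lborel (cball (c x) (r x)) *\<^sub>R h x - integral (cball (c x) (r x)) h)) < \<epsilon>" .
      have "e * (\<Sum>x\<in>I. 2 * r x) \<le> (\<Sum>x\<in>I. norm (measure lborel (cball (c x) (r x)) *\<^sub>R h x - integral (cball (c x) (r x)) h))"
        unfolding sum_distrib_left
      proof (rule sum_mono)
        fix x assume "x \<in> I"
        note x = IB[OF this]
        have "u < x" "x < v" using x by (auto simp: Bad_def)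
        have diff: "F t - F s = integral {s..t} h" if "u \<le> s" "s \<le> t" "t \<le> v" for s t
          using Henstock_Kurzweil_Integration.integral_combine[of u s t h] that h
          unfolding F_def by (metis add_diff_cancel_left' integrable_on_subinterval atLeastatMost_subset_iff order_refl)
        have "norm (F (y x) - F x - (y x - x) *\<^sub>R h x)
            = norm (measure lborel (cball (c x) (r x)) *\<^sub>R h x - integral (cball (c x) (r x)) h)"
        proof (cases "x \<le> y x")
          case True
          then show ?thesis using diff[of x "y x"] y(1)[OF x] \<open>u < x\<close> unfolding ball_eq
            by (simp add: norm_minus_commute min_def max_def)
        next
          case False
          then have "F x - F (y x) = integral {y x..x} h" using diff[of "y x" x] y(1)[OF x] \<open>x < v\<close> by auto
          then have "F (y x) - F x - (y x - x) *\<^sub>R h x = (x - y x) *\<^sub>R h x - integral {y x..x} h"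
            by (simp add: algebra_simps)
          then show ?thesis using False unfolding ball_eq by (simp add: min_def max_def)
        qed
        then show "e * (2 * r x) \<le> norm (measure lborel (cball (c x) (r x)) *\<^sub>R h x - integral (cball (c x) (r x)) h)"
          using y(4)[OF x] by (simp add: r_def)
      qed
      with less have "e * (\<Sum>x\<in>I. 2 * r x) < e * \<eta> / 10" by (simp add: \<epsilon>_def)
      then have small: "(\<Sum>x\<in>I. 2 * r x) < \<eta> / 10" using \<open>e > 0\<close> by (simp add: field_simps)
      have "measure lebesgue (\<Union>i\<in>I. cball (c i) (5 * r i)) \<le> (\<Sum>i\<in>I. measure lebesgue (cball (c i) (5 * r i)))"
        using \<open>finite I\<close> by (intro measure_UNION_le) auto
      also have "\<dots> = 5 * (\<Sum>x\<in>I. 2 * r x)"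
        unfolding sum_distrib_left
        by (intro sum.cong refl) (auto simp: cball_eq_atLeastAtMost r_def)
      finally show ?thesis using small by simp
    qed
    show "\<exists>T. Bad e \<subseteq> T \<and> T \<in> lmeasurable \<and> measure lebesgue T < \<eta>"
    proof (intro exI conjI)
      show "Bad e \<subseteq> (\<Union>i\<in>C. cball (c i) (5 * r i))" by (rule C)
      show "(\<Union>i\<in>C. cball (c i) (5 * r i)) \<in> lmeasurable"
        by (rule fmeasurable_UN_bound[OF C(1) _ fin]) auto
      have "measure lebesgue (\<Union>i\<in>C. cball (c i) (5 * r i)) \<le> \<eta> / 2"
        by (rule measure_UN_bound[OF C(1) _ fin]) auto
      then show "measure lebesgue (\<Union>i\<in>C. cball (c i) (5 * r i)) < \<eta>" using \<open>\<eta> > 0\<close> by simp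
    qed
  qed
  then have "negligible (\<Union>n. Bad (1 / real (Suc n)))"
    by (intro negligible_countable_Union) auto
  moreover have "{x\<in>{u<..<v}. \<not> (F has_vector_derivative h x) (at x)} \<subseteq> (\<Union>n. Bad (1 / real (Suc n)))"
  proof (rule subsetI, rule ccontr)
    fix x assume x: "x \<in> {x\<in>{u<..<v}. \<not> (F has_vector_derivative h x) (at x)}" 
      and notbad: "x \<notin> (\<Union>n. Bad (1 / real (Suc n)))"
    have "(F has_derivative (\<lambda>t. t *\<^sub>R h x)) (at x)"
      unfolding has_derivative_at_alt
    proof (intro conjI allI impI)
      fix e :: real assume "e > 0"
      obtain n where n: "1 / real (Suc n) < e" using \<open>e > 0\<close> nat_approx_posE by blast
      have "x \<notin> Bad (1 / real (Suc n))" using notbad by blast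
      then have "\<exists>r>0. \<forall>y\<in>{u..v}. y \<noteq> x \<and> \<bar>y - x\<bar> < r \<longrightarrow>
          \<not> norm (F y - F x - (y - x) *\<^sub>R h x) > 1 / real (Suc n) * \<bar>y - x\<bar>"
        using x unfolding Bad_def by blast
      then obtain r where r: "r > 0" "\<And>y. y \<in> {u..v} \<Longrightarrow> y \<noteq> x \<Longrightarrow> \<bar>y - x\<bar> < r \<Longrightarrow>
          norm (F y - F x - (y - x) *\<^sub>R h x) \<le> 1 / real (Suc n) * \<bar>y - x\<bar>"
        unfolding not_less by blast
      show "\<exists>d>0. \<forall>y. norm (y - x) < d \<longrightarrow> norm (F y - F x - (y - x) *\<^sub>R h x) \<le> e * norm (y - x)"
      proof (intro exI[of _ "min r (min (x - u) (v - x))"] conjI allI impI)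
        show "0 < min r (min (x - u) (v - x))" using r x by auto
        fix y assume y: "norm (y - x) < min r (min (x - u) (v - x))"
        show "norm (F y - F x - (y - x) *\<^sub>R h x) \<le> e * norm (y - x)"
        proof (cases "y = x")
          case False
          have "norm (F y - F x - (y - x) *\<^sub>R h x) \<le> 1 / real (Suc n) * \<bar>y - x\<bar>"
            using y False by (intro r(2)) auto
          also have "\<dots> \<le> e * \<bar>y - x\<bar>" using n by (intro mult_right_mono) auto
          finally show ?thesis by simp
        qed simp
      qed
    qed (simp add: bounded_linear_scaleR_left)
    then show False using x by (simp add: has_vector_derivative_def)
  qed
  ultimately have "negligible {x\<in>{u<..<v}. \<not> (F has_vector_derivative h x) (at x)}"
    using negligible_subset by blast
  then show ?thesis unfolding F_def by (simp add: AE_lebesgue_on_iff_negligible)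
qed

text \<open>Truncating \<open>|h|\<close> at height \<open>n\<close> leaves a remainder \<open>z\<close> of small integral; the bounded part contributes at most
  \<open>n\<close> times the total length of the intervals.\<close>

lemma abs_continuous_on_indefinite_integral:
  fixes h :: "real \<Rightarrow> 'a::euclidean_space"
  assumes h: "h absolutely_integrable_on {u..v}"
  shows "abs_continuous_on u v (\<lambda>x. integral {u..x} h)"
  unfolding abs_continuous_on_def
proof (intro allI impI)
  fix \<epsilon> :: real assume "\<epsilon> > 0"
  define w where "w n x = min (norm (h x)) (real n)" for n x
  have nh: "(\<lambda>x. norm (h x)) absolutely_integrable_on {u..v}" using absolutely_integrable_norm[OF h] by (simp add: o_def)
  have w: "w n absolutely_integrable_on {u..v}" for n
    unfolding w_def using nh by (intro absolutely_integrable_min_1) auto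
  have "(\<lambda>n. integral {u..v} (w n)) \<longlonglongrightarrow> integral {u..v} (\<lambda>x. norm (h x))"
  proof (rule dominated_convergence)
    show "w n integrable_on {u..v}" for n using w absolutely_integrable_on_def by blast
    show "(\<lambda>x. norm (h x)) integrable_on {u..v}" using h absolutely_integrable_on_def by blast
    show "norm (w n x) \<le> norm (h x)" for n x by (auto simp: w_def)
    show "(\<lambda>n. w n x) \<longlonglongrightarrow> norm (h x)" for x
    proof (rule tendsto_eventually)
      show "\<forall>\<^sub>F n in sequentially. w n x = norm (h x)"
        using eventually_ge_at_top[of "nat \<lceil>norm (h x)\<rceil>"] by eventually_elim (auto simp: w_def min_def nat_ceiling_le_eq)
    qed
  qed
  then have "\<forall>\<^sub>F n in sequentially. dist (integral {u..v} (w n)) (integral {u..v} (\<lambda>x. norm (h x))) < \<epsilon>/2"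
    using \<open>\<epsilon> > 0\<close> half_gt_zero tendstoD by blast
  then obtain n where n: "\<bar>integral {u..v} (w n) - integral {u..v} (\<lambda>x. norm (h x))\<bar> < \<epsilon>/2"
    by (auto simp: eventually_sequentially dist_real_def)
  define z where "z x = norm (h x) - w n x" for x
  have z: "z integrable_on {u..v}" "integral {u..v} z < \<epsilon>/2"
  proof -
    have "(\<lambda>x. norm (h x)) integrable_on {u..v}" "w n integrable_on {u..v}"
      using h w absolutely_integrable_on_def by blast+
    then show "z integrable_on {u..v}" "integral {u..v} z < \<epsilon>/2"
      using n unfolding z_def abs_less_iff by (simp_all add: integral_diff integrable_diff)
  qed
  define d where "d = \<epsilon> / (2 * (real n + 1))"
  have "d > 0" using \<open>\<epsilon> > 0\<close> by (simp add: d_def)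
  show "\<exists>\<delta>>0. \<forall>D. D division_of \<Union>D \<and> \<Union>D \<subseteq> {u..v} \<and> (\<Sum>K\<in>D. Sup K - Inf K) < \<delta>
      \<longrightarrow> (\<Sum>K\<in>D. norm (integral {u..Sup K} h - integral {u..Inf K} h)) < \<epsilon>"
  proof (intro exI[of _ d] conjI allI impI)
    show "d > 0" by fact
    fix D :: "real set set"
    assume D: "D division_of \<Union>D \<and> \<Union>D \<subseteq> {u..v} \<and> (\<Sum>K\<in>D. Sup K - Inf K) < d"
    note I = division_of_real_interval[of D "\<Union>D"]
    have "norm (integral {u..Sup K} h - integral {u..Inf K} h) \<le> integral K z + real n * (Sup K - Inf K)"
      if "K \<in> D" for K
    proof -
      note K = I[OF conjunct1[OF D] that]
      have Ks: "{Inf K..Sup K} \<subseteq> {u..v}" "u \<le> Inf K" "Sup K \<le> v" "Inf K \<le> Sup K"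
        using K(2-5) D by (metis K(1) order_trans, metis atLeastAtMost_iff subset_eq, metis atLeastAtMost_iff subset_eq, metis)
      have hK: "h absolutely_integrable_on {Inf K..Sup K}"
        using absolutely_integrable_on_subinterval[OF h Ks(1)] .
      have "integral {u..Sup K} h - integral {u..Inf K} h = integral {Inf K..Sup K} h"
        using Henstock_Kurzweil_Integration.integral_combine[of u "Inf K" "Sup K" h] Ks h
          absolutely_integrable_on_subinterval[OF h, of u "Sup K"]
        by (simp add: absolutely_integrable_on_def algebra_simps)
      then have "norm (integral {u..Sup K} h - integral {u..Inf K} h) \<le> integral {Inf K..Sup K} (\<lambda>x. norm (h x))"
        using hK by (simp add: absolutely_integrable_on_def integral_norm_bound_integral)
      also have "\<dots> \<le> integral {Inf K..Sup K} (\<lambda>x. z x + real n)"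
      proof (rule integral_le)
        show "(\<lambda>x. norm (h x)) integrable_on {Inf K..Sup K}" using hK absolutely_integrable_on_def by blast
        show "(\<lambda>x. z x + real n) integrable_on {Inf K..Sup K}"
          using integrable_on_subinterval[OF z(1) Ks(1)] by (intro integrable_add) auto
      qed (auto simp: z_def w_def)
      also have "\<dots> = integral {Inf K..Sup K} z + real n * (Sup K - Inf K)"
        using integrable_on_subinterval[OF z(1) Ks(1)] Ks(4) by (subst integral_add) auto
      finally show ?thesis using K(1) by simp
    qed
    then have "(\<Sum>K\<in>D. norm (integral {u..Sup K} h - integral {u..Inf K} h))
        \<le> (\<Sum>K\<in>D. integral K z + real n * (Sup K - Inf K))" by (rule sum_mono)
    also have "\<dots> = (\<Sum>K\<in>D. integral K z) + real n * (\<Sum>K\<in>D. Sup K - Inf K)"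
      by (simp add: sum.distrib sum_distrib_left)
    also have "(\<Sum>K\<in>D. integral K z) = integral (\<Union>D) z"
      using D integrable_on_subdivision[OF _ z(1)] by (intro integral_combine_division_topdown[symmetric]) auto
    also have "\<dots> \<le> integral {u..v} z"
      using D integrable_on_subdivision[OF _ z(1)] z(1)
      by (intro integral_subset_le) (auto simp: z_def w_def)
    also have "real n * (\<Sum>K\<in>D. Sup K - Inf K) \<le> (real n + 1) * d"
      using D \<open>d > 0\<close> by (intro mult_mono) (auto intro!: sum_nonneg I(2))
    also have "(real n + 1) * d = \<epsilon> / 2" by (simp add: d_def field_split_simps)
    finally show "(\<Sum>K\<in>D. norm (integral {u..Sup K} h - integral {u..Inf K} h)) < \<epsilon>"
      using z(2) by simp
  qed
qed

text \<open>In this form differentiation rules and absolute continuity travel together, so that a differential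
  inequality that holds almost everywhere can be integrated.\<close>
definition ac_primitive_on :: "real \<Rightarrow> real \<Rightarrow> (real \<Rightarrow> 'a::real_normed_vector) \<Rightarrow> (real \<Rightarrow> 'a) \<Rightarrow> bool" where
  "ac_primitive_on u v f f' \<longleftrightarrow> abs_continuous_on u v f \<and>
     (AE x in lebesgue_on {u<..<v}. (f has_vector_derivative f' x) (at x))"

lemma ac_primitive_onD:
  assumes "ac_primitive_on u v f f'"
  shows "abs_continuous_on u v f" "AE x in lebesgue_on {u<..<v}. (f has_vector_derivative f' x) (at x)"
    "continuous_on {u..v} f"
  using assms abs_continuous_on_imp_continuous_on by (auto simp: ac_primitive_on_def)

lemma ac_primitive_on_const: "ac_primitive_on u v (\<lambda>x. c) (\<lambda>x. 0)"
  by (simp add: ac_primitive_on_def abs_continuous_on_const)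

lemma ac_primitive_on_add:
  assumes "ac_primitive_on u v f f'" "ac_primitive_on u v g g'"
  shows "ac_primitive_on u v (\<lambda>x. f x + g x) (\<lambda>x. f' x + g' x)"
  unfolding ac_primitive_on_def
proof
  show "abs_continuous_on u v (\<lambda>x. f x + g x)"
    using assms by (intro abs_continuous_on_add ac_primitive_onD(1))
  show "AE x in lebesgue_on {u<..<v}. ((\<lambda>x. f x + g x) has_vector_derivative f' x + g' x) (at x)"
    using ac_primitive_onD(2)[OF assms(1)] ac_primitive_onD(2)[OF assms(2)]
    by eventually_elim (rule has_vector_derivative_add)
qed

lemma ac_primitive_on_mult:
  fixes f g :: "real \<Rightarrow> 'a::real_normed_algebra"
  assumes "ac_primitive_on u v f f'" "ac_primitive_on u v g g'"
  shows "ac_primitive_on u v (\<lambda>x. f x * g x) (\<lambda>x. f x * g' x + f' x * g x)"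
  unfolding ac_primitive_on_def
proof
  show "abs_continuous_on u v (\<lambda>x. f x * g x)"
    using assms by (intro abs_continuous_on_mult ac_primitive_onD(1))
  show "AE x in lebesgue_on {u<..<v}. ((\<lambda>x. f x * g x) has_vector_derivative f x * g' x + f' x * g x) (at x)"
    using ac_primitive_onD(2)[OF assms(1)] ac_primitive_onD(2)[OF assms(2)]
    by eventually_elim (rule has_vector_derivative_mult)
qed

lemma ac_primitive_on_bounded_linear:
  assumes "bounded_linear h" "ac_primitive_on u v f f'"
  shows "ac_primitive_on u v (\<lambda>x. h (f x)) (\<lambda>x. h (f' x))"
  unfolding ac_primitive_on_def
proof
  show "abs_continuous_on u v (\<lambda>x. h (f x))"
    by (rule abs_continuous_on_bounded_linear[OF assms(1) ac_primitive_onD(1)[OF assms(2)]])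
  show "AE x in lebesgue_on {u<..<v}. ((\<lambda>x. h (f x)) has_vector_derivative h (f' x)) (at x)"
    using ac_primitive_onD(2)[OF assms(2)]
    by eventually_elim (rule bounded_linear.has_vector_derivative[OF assms(1)])
qed

lemma ac_primitive_on_cmult:
  fixes f :: "real \<Rightarrow> 'a::real_normed_algebra"
  assumes "ac_primitive_on u v f f'"
  shows "ac_primitive_on u v (\<lambda>x. c * f x) (\<lambda>x. c * f' x)"
  by (rule ac_primitive_on_bounded_linear[OF bounded_linear_mult_right assms])

lemma ac_primitive_on_diff:
  assumes "ac_primitive_on u v f f'" "ac_primitive_on u v g g'"
  shows "ac_primitive_on u v (\<lambda>x. f x - g x) (\<lambda>x. f' x - g' x)"
  using ac_primitive_on_add[OF assms(1) ac_primitive_on_bounded_linear[OF bounded_linear_minus[OF bounded_linear_ident] assms(2)]]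
  by simp

lemma ac_primitive_on_exp:
  fixes f :: "real \<Rightarrow> real"
  assumes "ac_primitive_on u v f f'"
  shows "ac_primitive_on u v (\<lambda>x. exp (f x)) (\<lambda>x. exp (f x) * f' x)"
  unfolding ac_primitive_on_def
proof
  show "abs_continuous_on u v (\<lambda>x. exp (f x))"
    using assms by (intro abs_continuous_on_exp ac_primitive_onD(1))
  show "AE x in lebesgue_on {u<..<v}. ((\<lambda>x. exp (f x)) has_vector_derivative exp (f x) * f' x) (at x)"
    using ac_primitive_onD(2)[OF assms]
  proof eventually_elim
    case (elim x)
    then have "(f has_real_derivative f' x) (at x)" by (simp add: has_real_derivative_iff_has_vector_derivative)
    then have "((\<lambda>x. exp (f x)) has_real_derivative exp (f x) * f' x) (at x)" by (rule DERIV_fun_exp)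
    then show ?case by (simp add: has_real_derivative_iff_has_vector_derivative)
  qed
qed

lemma ac_primitive_on_indefinite_integral:
  fixes h :: "real \<Rightarrow> 'a::euclidean_space"
  assumes "h absolutely_integrable_on {u..v}"
  shows "ac_primitive_on u v (\<lambda>x. integral {u..x} h) h"
  using assms abs_continuous_on_indefinite_integral indefinite_integral_has_derivative_AE
  unfolding ac_primitive_on_def absolutely_integrable_on_def by blast

lemma ac_primitive_on_cong:
  assumes "ac_primitive_on u v f f'" "\<And>x. x \<in> {u..v} \<Longrightarrow> f x = g x"
  shows "ac_primitive_on u v g f'"
  unfolding ac_primitive_on_def
proof
  show "abs_continuous_on u v g"
    by (rule abs_continuous_on_lipschitz[OF ac_primitive_onD(1)[OF assms(1)], where L=1]) (use assms in auto)
  show "AE x in lebesgue_on {u<..<v}. (g has_vector_derivative f' x) (at x)"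
    using ac_primitive_onD(2)[OF assms(1)] AE_lebesgue_on_mem[OF lmeasurable_interval(2)[THEN fmeasurableD]]
  proof eventually_elim
    case (elim x)
    then show ?case
      using assms(2) by (intro has_vector_derivative_transform_within_open[OF elim(1), of "{u<..<v}"]) auto
  qed
qed

lemma ac_primitive_on_unique:
  assumes "ac_primitive_on u v f f'" "ac_primitive_on u v f g'"
  shows "AE x in lebesgue_on {u<..<v}. f' x = g' x"
  using ac_primitive_onD(2)[OF assms(1)] ac_primitive_onD(2)[OF assms(2)]
  by eventually_elim (rule vector_derivative_unique_at)

lemma ac_primitive_on_mono:
  fixes f :: "real \<Rightarrow> real"
  assumes "ac_primitive_on u v f f'" "AE x in lebesgue_on {u<..<v}. 0 \<le> f' x"
    and "u \<le> s" "s \<le> t" "t \<le> v"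
  shows "f s \<le> f t"
proof (rule abs_continuous_on_mono_of_deriv_nonneg[OF ac_primitive_onD(1)[OF assms(1)] _ assms(3-5)])
  show "AE x in lebesgue_on {u<..<v}. \<exists>d\<ge>0. (f has_real_derivative d) (at x)"
    using ac_primitive_onD(2)[OF assms(1)] assms(2)
    by eventually_elim (auto simp: has_real_derivative_iff_has_vector_derivative)
qed

lemma ac_primitive_on_antimono:
  fixes f :: "real \<Rightarrow> real"
  assumes "ac_primitive_on u v f f'" "AE x in lebesgue_on {u<..<v}. f' x \<le> 0"
    and "u \<le> s" "s \<le> t" "t \<le> v"
  shows "f t \<le> f s"
  using ac_primitive_on_mono[OF ac_primitive_on_cmult[OF assms(1), of "-1"] _ assms(3-5)] assms(2) by simp

lemma ac_primitive_on_zero_imp_const: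
  fixes f :: "real \<Rightarrow> 'a::euclidean_space"
  assumes f: "ac_primitive_on u v f f'" and 0: "AE x in lebesgue_on {u<..<v}. f' x = 0"
    and st: "s \<in> {u..v}" "t \<in> {u..v}"
  shows "f s = f t"
proof -
  have le: "f p = f q" if "u \<le> p" "p \<le> q" "q \<le> v" for p q
  proof (rule euclidean_eqI)
    fix b :: 'a assume "b \<in> Basis"
    have *: "ac_primitive_on u v (\<lambda>x. f x \<bullet> b) (\<lambda>x. f' x \<bullet> b)"
      by (rule ac_primitive_on_bounded_linear[OF bounded_linear_inner_left f])
    have "AE x in lebesgue_on {u<..<v}. 0 \<le> f' x \<bullet> b" "AE x in lebesgue_on {u<..<v}. f' x \<bullet> b \<le> 0"
      using 0 by (eventually_elim, simp)+
    then show "f p \<bullet> b = f q \<bullet> b"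
      using ac_primitive_on_mono[OF * _ that] ac_primitive_on_antimono[OF * _ that] by fastforce
  qed
  then show ?thesis using st by (metis atLeastAtMost_iff linear)
qed

lemma ac_primitive_on_integral:
  fixes f :: "real \<Rightarrow> 'a::euclidean_space"
  assumes "ac_primitive_on u v f f'" "f' absolutely_integrable_on {u..v}" "t \<in> {u..v}"
  shows "integral {u..t} f' = f t - f u"
proof -
  have "ac_primitive_on u v (\<lambda>x. f x - integral {u..x} f') (\<lambda>x. f' x - f' x)"
    by (intro ac_primitive_on_diff assms ac_primitive_on_indefinite_integral)
  from ac_primitive_on_zero_imp_const[OF this _ assms(3), of u] show ?thesis
    using assms(3) by (auto simp: algebra_simps)
qed

lemma absolutely_integrable_mult_continuous:
  fixes w h :: "real \<Rightarrow> 'a::{euclidean_space, real_normed_algebra}"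
  assumes "w absolutely_integrable_on {u..v}" "continuous_on {u..v} h"
  shows "(\<lambda>t. w t * h t) absolutely_integrable_on {u..v}"
proof -
  have b: "bilinear (\<lambda>x y. y * x :: 'a)"
    by (auto simp: bilinear_def linear_iff algebra_simps)
  show ?thesis
    using assms
    by (intro absolutely_integrable_bounded_measurable_product[OF b] continuous_imp_measurable_on_sets_lebesgue
         compact_imp_bounded compact_continuous_image) auto
qed

lemma ac_primitive_on_norm_square:
  fixes f :: "real \<Rightarrow> complex"
  assumes "ac_primitive_on u v f f'"
  shows "ac_primitive_on u v (\<lambda>x. (norm (f x))\<^sup>2) (\<lambda>x. 2 * Re (cnj (f x) * f' x))"
proof -
  have "ac_primitive_on u v (\<lambda>x. Re (cnj (f x) * f x)) (\<lambda>x. Re (cnj (f x) * f' x + cnj (f' x) * f x))"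
    by (intro ac_primitive_on_bounded_linear[OF bounded_linear_Re] ac_primitive_on_mult
        ac_primitive_on_bounded_linear[OF bounded_linear_cnj] assms)
  moreover have "Re (cnj a * a) = (norm a)\<^sup>2" "Re (cnj a * b + cnj b * a) = 2 * Re (cnj a * b)" for a b
    unfolding cmod_power2 by (simp_all add: power2_eq_square)
  ultimately show ?thesis by (simp only:)
qed

text \<open>The square modulus is absolutely continuous with derivative vanishing wherever \<open>f\<close> does, hence constant.\<close>

lemma ac_primitive_on_zero_AE_imp_zero:
  fixes f :: "real \<Rightarrow> complex"
  assumes f: "ac_primitive_on u v f f'" "f u = 0"
    and ae: "AE t in lebesgue_on {u<..<v}. f t = 0" and x: "x \<in> {u..v}"
  shows "f x = 0"
proof -
  have "(norm (f x))\<^sup>2 = (norm (f u))\<^sup>2"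
  proof (rule ac_primitive_on_zero_imp_const[OF ac_primitive_on_norm_square[OF f(1)]])
    show "AE t in lebesgue_on {u<..<v}. 2 * Re (cnj (f t) * f' t) = 0"
      using ae by eventually_elim simp
  qed (use x in auto)
  then show ?thesis using f(2) by simp
qed

section \<open>Linear systems with integrable coefficients\<close>

lemma summable_geometric_half: "summable (\<lambda>n. K / 2 ^ n :: real)"
  using summable_mult[OF summable_geometric, of "1/2::real" K] by (simp add: power_divide)

text \<open>The geometric bound makes \<open>2 * H\<close> an integrable majorant of all partial sums.\<close>

lemma integral_sums_geometric:
  fixes F :: "nat \<Rightarrow> real \<Rightarrow> complex"
  assumes F: "\<And>i. F i integrable_on S" and H: "H integrable_on S"
    and le: "\<And>i t. t \<in> S \<Longrightarrow> norm (F i t) \<le> H t / 2 ^ i"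
    and sums: "\<And>t. t \<in> S \<Longrightarrow> (\<lambda>i. F i t) sums G t"
  shows "(\<lambda>i. integral S (F i)) sums integral S G"
proof -
  have "(\<lambda>N. integral S (\<lambda>t. \<Sum>i<N. F i t)) \<longlonglongrightarrow> integral S G"
  proof (rule dominated_convergence)
    show "(\<lambda>t. \<Sum>i<N. F i t) integrable_on S" for N using F by (intro integrable_sum) auto
    show "(\<lambda>t. 2 * H t) integrable_on S" using H by (rule integrable_on_mult_right)
    show "norm (\<Sum>i<N. F i t) \<le> 2 * H t" if "t \<in> S" for N t
    proof -
      have "0 \<le> H t" using order_trans[OF norm_ge_zero le[OF that, of 0]] by simp
      have "norm (\<Sum>i<N. F i t) \<le> (\<Sum>i<N. H t * (1/2) ^ i)"
        using le[OF that] by (intro order_trans[OF norm_sum] sum_mono) (simp add: power_divide)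
      also have "\<dots> = H t * (\<Sum>i<N. (1/2) ^ i)" by (simp add: sum_distrib_left)
      also have "\<dots> \<le> H t * (\<Sum>i. (1/2) ^ i)"
        using \<open>0 \<le> H t\<close> by (intro mult_left_mono sum_le_suminf summable_geometric) auto
      also have "(\<Sum>i. (1/2::real) ^ i) = 2" by (subst suminf_geometric) auto
      finally show ?thesis using \<open>0 \<le> H t\<close> by (simp add: mult.commute)
    qed
    show "(\<lambda>N. \<Sum>i<N. F i t) \<longlonglongrightarrow> G t" if "t \<in> S" for t
      using sums[OF that] by (simp add: sums_def)
  qed
  moreover have "integral S (\<lambda>t. \<Sum>i<N. F i t) = (\<Sum>i<N. integral S (F i))" for N
    using F by (intro integral_sum) auto
  ultimately show ?thesis by (simp add: sums_def)
qed

text \<open>The induction step for the polynomial dependence of the Picard iterates on the spectral parameter \<open>z\<close>: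
  one more integration raises the degree by one and keeps the coefficients continuous.\<close>

lemma integral_polynomial_coefficients:
  fixes c d :: "nat \<Rightarrow> real \<Rightarrow> complex"
  assumes A: "A absolutely_integrable_on {0..L}" and V: "V absolutely_integrable_on {0..L}"
    and c: "\<And>k. continuous_on {0..L} (c k)" "\<And>k t. k > n \<Longrightarrow> c k t = 0"
    and d: "\<And>k. continuous_on {0..L} (d k)" "\<And>k t. k > n \<Longrightarrow> d k t = 0"
  obtains e where "\<And>k. continuous_on {0..L} (e k)" "\<And>k t. k > Suc n \<Longrightarrow> e k t = 0"
    "\<And>z x. x \<in> {0..L} \<Longrightarrow> integral {0..x} (\<lambda>t. z * A t * (\<Sum>k\<le>n. c k t * z ^ k) + V t * (\<Sum>k\<le>n. d k t * z ^ k))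
        = (\<Sum>k\<le>Suc n. e k x * z ^ k)"
proof -
  define w where "w k t = (if k = 0 then 0 else A t * c (k - 1) t) + V t * d k t" for k t
  define e where "e k x = integral {0..x} (w k)" for k x
  have w: "w k absolutely_integrable_on {0..L}" for k
  proof -
    have "(\<lambda>t. V t * d k t) absolutely_integrable_on {0..L}" "(\<lambda>t. A t * c (k - 1) t) absolutely_integrable_on {0..L}"
      using A V c d absolutely_integrable_mult_continuous by blast+
    then show ?thesis unfolding w_def using set_integral_add(1) by (cases "k = 0") force+
  qed
  show ?thesis
  proof
    show "continuous_on {0..L} (e k)" for k
      unfolding e_def using w by (auto intro!: indefinite_integral_continuous_1 simp: absolutely_integrable_on_def)
    show "e k t = 0" if "k > Suc n" for k t
      using that c(2)[of "k - 1"] d(2)[of k] unfolding e_def w_def by auto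
    fix z x assume x: "x \<in> {0..L}"
    have "z * A t * (\<Sum>k\<le>n. c k t * z ^ k) + V t * (\<Sum>k\<le>n. d k t * z ^ k) = (\<Sum>k\<le>Suc n. w k t * z ^ k)" for t
    proof -
      have "(\<Sum>k\<le>Suc n. w k t * z ^ k)
          = (\<Sum>k\<le>Suc n. (if k = 0 then 0 else A t * c (k - 1) t) * z ^ k) + (\<Sum>k\<le>Suc n. V t * d k t * z ^ k)"
        by (simp add: w_def sum.distrib algebra_simps)
      also have "(\<Sum>k\<le>Suc n. (if k = 0 then 0 else A t * c (k - 1) t) * z ^ k) = (\<Sum>k\<le>n. A t * c k t * z ^ Suc k)"
        by (subst sum.atMost_Suc_shift) simp
      also have "(\<Sum>k\<le>Suc n. V t * d k t * z ^ k) = (\<Sum>k\<le>n. V t * d k t * z ^ k)"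
        using d(2)[of "Suc n"] by simp
      finally show ?thesis by (simp add: sum_distrib_left mult_ac)
    qed
    then have "integral {0..x} (\<lambda>t. z * A t * (\<Sum>k\<le>n. c k t * z ^ k) + V t * (\<Sum>k\<le>n. d k t * z ^ k))
        = integral {0..x} (\<lambda>t. \<Sum>k\<le>Suc n. w k t * z ^ k)" by presburger
    also have "\<dots> = (\<Sum>k\<le>Suc n. integral {0..x} (\<lambda>t. w k t * z ^ k))"
    proof (rule integral_sum)
      fix k
      have "w k integrable_on {0..x}"
        using absolutely_integrable_on_subinterval[OF w, of 0 x k] x by (auto simp: absolutely_integrable_on_def)
      then show "(\<lambda>t. w k t * z ^ k) integrable_on {0..x}" by (rule integrable_on_mult_left)
    qed simp
    also have "\<dots> = (\<Sum>k\<le>Suc n. e k x * z ^ k)" by (simp add: e_def)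
    finally show "integral {0..x} (\<lambda>t. z * A t * (\<Sum>k\<le>n. c k t * z ^ k) + V t * (\<Sum>k\<le>n. d k t * z ^ k))
        = (\<Sum>k\<le>Suc n. e k x * z ^ k)" .
  qed
qed

text \<open>The system \<open>f' = z A f + V g\<close>, \<open>g' = z B g + W f\<close> with integrable coefficients is solved by Picard iteration. The
  iterates are polynomials in \<open>z\<close>, and the series converges locally uniformly in \<open>z\<close>, which makes the
  solution entire in \<open>z\<close>.\<close>
locale linear_system =
  fixes L :: real and A B V W :: "real \<Rightarrow> complex"
  assumes L_nonneg: "0 \<le> L"
    and A_int: "A absolutely_integrable_on {0..L}" and B_int: "B absolutely_integrable_on {0..L}"
    and V_int: "V absolutely_integrable_on {0..L}" and W_int: "W absolutely_integrable_on {0..L}"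
begin

text \<open>The series of the iterates, not their limit, is the solution: iterate \<open>n\<close> is the \<open>n\<close>-fold integral term.\<close>
primrec iterate :: "complex \<times> complex \<Rightarrow> complex \<Rightarrow> nat \<Rightarrow> real \<Rightarrow> complex \<times> complex" where
  "iterate w z 0 = (\<lambda>x. w)"
| "iterate w z (Suc n) = (\<lambda>x.
     (integral {0..x} (\<lambda>t. z * A t * fst (iterate w z n t) + V t * snd (iterate w z n t)),
      integral {0..x} (\<lambda>t. z * B t * snd (iterate w z n t) + W t * fst (iterate w z n t))))"

lemma rhs_absolutely_integrable:
  assumes "continuous_on {0..L} f" "continuous_on {0..L} g"
  shows "(\<lambda>t. z * A t * f t + V t * g t) absolutely_integrable_on {0..L}"
    and "(\<lambda>t. z * B t * g t + W t * f t) absolutely_integrable_on {0..L}"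
proof -
  have "(\<lambda>t. A t * (z * f t)) absolutely_integrable_on {0..L}" "(\<lambda>t. V t * g t) absolutely_integrable_on {0..L}"
    "(\<lambda>t. B t * (z * g t)) absolutely_integrable_on {0..L}" "(\<lambda>t. W t * f t) absolutely_integrable_on {0..L}"
    by (rule absolutely_integrable_mult_continuous, rule A_int V_int B_int W_int,
        use assms in \<open>auto intro: continuous_intros\<close>)+
  then show "(\<lambda>t. z * A t * f t + V t * g t) absolutely_integrable_on {0..L}"
    and "(\<lambda>t. z * B t * g t + W t * f t) absolutely_integrable_on {0..L}"
    using set_integral_add(1) by (fastforce simp: mult_ac)+
qed

lemma iterate_continuous:
  "continuous_on {0..L} (\<lambda>x. fst (iterate w z n x)) \<and> continuous_on {0..L} (\<lambda>x. snd (iterate w z n x))"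
proof (induction n)
  case (Suc n)
  then show ?case
    using rhs_absolutely_integrable[of "\<lambda>x. fst (iterate w z n x)" "\<lambda>x. snd (iterate w z n x)" z]
    by (auto intro!: indefinite_integral_continuous_1 simp: absolutely_integrable_on_def)
qed auto

text \<open>A bound for the norm of the coefficient matrix at \<open>t\<close>, uniform in \<open>|z| \<le> R\<close>.\<close>
definition growth :: "real \<Rightarrow> real \<Rightarrow> real" where
  "growth R t = R * norm (A t) + R * norm (B t) + norm (V t) + norm (W t)"

lemma growth_absolutely_integrable: "growth R absolutely_integrable_on {0..L}"
proof -
  have n: "(\<lambda>t. norm (h t)) absolutely_integrable_on {0..L}"
    if "h absolutely_integrable_on {0..L}" for h :: "real \<Rightarrow> complex"
    using absolutely_integrable_norm[OF that] by (simp add: o_def)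
  have r: "(\<lambda>t. R * norm (h t)) absolutely_integrable_on {0..L}"
    if "h absolutely_integrable_on {0..L}" for h :: "real \<Rightarrow> complex"
    by (intro set_integrable_mult_right n that)
  show ?thesis
    unfolding growth_def[abs_def] using A_int B_int V_int W_int
    by (intro set_integral_add(1) r n)
qed

text \<open>The factor \<open>2\<close> makes \<open>\<integral>\<^sub>0\<^sup>x growth \<cdot> majorant \<le> majorant x / 2\<close>, so that measured in units of the majorant
  every Picard step contracts by one half.\<close>
definition majorant :: "real \<Rightarrow> real \<Rightarrow> real" where
  "majorant R x = exp (2 * integral {0..x} (growth R))"

lemma majorant_primitive:
  "ac_primitive_on 0 L (majorant R) (\<lambda>x. majorant R x * (2 * growth R x))"
  unfolding majorant_def
  by (intro ac_primitive_on_exp ac_primitive_on_cmult ac_primitive_on_indefinite_integral growth_absolutely_integrable)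

lemma norm_iterate_le:
  assumes "norm z \<le> R" "x \<in> {0..L}"
  shows "norm (fst (iterate w z n x)) + norm (snd (iterate w z n x))
    \<le> (norm (fst w) + norm (snd w)) / 2 ^ n * majorant R x"
  using assms(2)
proof (induction n arbitrary: x)
  let ?C = "norm (fst w) + norm (snd w)"
  have "0 \<le> R" using assms(1) norm_ge_zero order_trans by blast
  then have g0: "0 \<le> growth R t" for t by (simp add: growth_def)
  {
    case 0
    have "majorant R x \<ge> 1"
      unfolding majorant_def using growth_absolutely_integrable[of R] 0 g0
        absolutely_integrable_on_subinterval[OF growth_absolutely_integrable, of 0 x R]
      by (auto intro!: integral_nonneg simp: absolutely_integrable_on_def)
    then show ?case using mult_left_mono[of 1 "majorant R x" ?C] by simp
  next
    case (Suc n)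
    let ?f = "\<lambda>t. fst (iterate w z n t)" and ?g = "\<lambda>t. snd (iterate w z n t)"
    let ?F = "\<lambda>t. z * A t * ?f t + V t * ?g t" and ?G = "\<lambda>t. z * B t * ?g t + W t * ?f t"
    let ?H = "\<lambda>t. ?C / 2 ^ Suc n * (majorant R t * (2 * growth R t))"
    have sub: "h absolutely_integrable_on {0..x}" if "h absolutely_integrable_on {0..L}" for h :: "real \<Rightarrow> 'a::euclidean_space"
      using absolutely_integrable_on_subinterval[OF that, of 0 x] Suc.prems by auto
    have FG: "?F absolutely_integrable_on {0..x}" "?G absolutely_integrable_on {0..x}"
      using rhs_absolutely_integrable iterate_continuous sub by blast+
    have H: "?H absolutely_integrable_on {0..L}"
    proof -
      have "(\<lambda>t. growth R t * (?C / 2 ^ n * majorant R t)) absolutely_integrable_on {0..L}"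
        using ac_primitive_onD(3)[OF majorant_primitive]
        by (intro absolutely_integrable_mult_continuous growth_absolutely_integrable continuous_intros)
      then show ?thesis by (simp add: mult_ac)
    qed
    have "norm (fst (iterate w z (Suc n) x)) + norm (snd (iterate w z (Suc n) x))
        \<le> integral {0..x} (\<lambda>t. norm (?F t)) + integral {0..x} (\<lambda>t. norm (?G t))"
      using FG by (auto intro!: add_mono integral_norm_bound_integral simp: absolutely_integrable_on_def)
    also have "\<dots> = integral {0..x} (\<lambda>t. norm (?F t) + norm (?G t))"
      using FG by (intro integral_add[symmetric]) (auto simp: absolutely_integrable_on_def)
    also have "\<dots> \<le> integral {0..x} ?H"
    proof (rule integral_le)
      show "(\<lambda>t. norm (?F t) + norm (?G t)) integrable_on {0..x}"
        using FG by (intro integrable_add) (auto simp: absolutely_integrable_on_def)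
      show "?H integrable_on {0..x}" using sub[OF H] by (simp add: absolutely_integrable_on_def)
      fix t assume t: "t \<in> {0..x}"
      have "norm (?F t) + norm (?G t) \<le> (norm z * norm (A t) * norm (?f t) + norm (V t) * norm (?g t))
          + (norm z * norm (B t) * norm (?g t) + norm (W t) * norm (?f t))"
        by (intro add_mono norm_triangle_le) (auto simp: norm_mult)
      also have "\<dots> \<le> (R * norm (A t) * norm (?f t) + norm (V t) * norm (?g t))
          + (R * norm (B t) * norm (?g t) + norm (W t) * norm (?f t))"
        using assms(1) by (intro add_mono mult_right_mono order_refl) auto
      also have "\<dots> \<le> growth R t * (norm (?f t) + norm (?g t))"
        using \<open>0 \<le> R\<close> by (simp add: growth_def algebra_simps)
      also have "\<dots> \<le> growth R t * (?C / 2 ^ n * majorant R t)"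
        using t Suc.prems by (intro mult_left_mono Suc.IH g0) auto
      finally show "norm (?F t) + norm (?G t) \<le> ?H t" by (simp add: mult_ac)
    qed
    also have "integral {0..x} ?H = ?C / 2 ^ Suc n * majorant R x - ?C / 2 ^ Suc n * majorant R 0"
      using Suc.prems
      by (intro ac_primitive_on_integral[OF ac_primitive_on_cmult[OF majorant_primitive] H]) auto
    also have "\<dots> \<le> ?C / 2 ^ Suc n * majorant R x" by (simp add: majorant_def)
    finally show ?case .
  }
qed

definition sol1 :: "complex \<times> complex \<Rightarrow> complex \<Rightarrow> real \<Rightarrow> complex" where
  "sol1 w z x = (\<Sum>n. fst (iterate w z n x))"

definition sol2 :: "complex \<times> complex \<Rightarrow> complex \<Rightarrow> real \<Rightarrow> complex" where
  "sol2 w z x = (\<Sum>n. snd (iterate w z n x))"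

text \<open>The bound is uniform in \<open>z\<close> on discs, as needed for holomorphy of the sum.\<close>

lemma norm_iterate_le_geometric:
  obtains K where "0 \<le> K" "\<And>z x n. norm z \<le> R \<Longrightarrow> x \<in> {0..L} \<Longrightarrow>
    norm (fst (iterate w z n x)) + norm (snd (iterate w z n x)) \<le> K / 2 ^ n"
proof -
  have "bounded (majorant R ` {0..L})"
    using ac_primitive_onD(3)[OF majorant_primitive] by (auto intro!: compact_imp_bounded compact_continuous_image)
  then obtain M where M: "\<And>x. x \<in> {0..L} \<Longrightarrow> norm (majorant R x) \<le> M"
    unfolding bounded_iff by (metis imageI)
  show ?thesis
  proof
    let ?C = "norm (fst w) + norm (snd w)"
    show "0 \<le> ?C * \<bar>M\<bar>" by simp
    fix z :: complex and x n assume zx: "norm z \<le> R" "x \<in> {0..L}"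
    have "norm (fst (iterate w z n x)) + norm (snd (iterate w z n x)) \<le> ?C / 2 ^ n * majorant R x"
      by (rule norm_iterate_le[OF zx])
    also have "\<dots> \<le> ?C / 2 ^ n * \<bar>M\<bar>"
      using M[OF zx(2)] by (intro mult_left_mono) (auto simp: abs_le_iff)
    finally show "norm (fst (iterate w z n x)) + norm (snd (iterate w z n x)) \<le> ?C * \<bar>M\<bar> / 2 ^ n"
      by (simp add: field_simps)
  qed
qed

text \<open>Joint uniformity in \<open>(z, x)\<close> serves both continuity in \<open>x\<close> and holomorphy in \<open>z\<close>.\<close>

lemma iterate_uniform_limit:
  fixes S :: "(complex \<times> real) set"
  assumes S: "\<And>z x. (z, x) \<in> S \<Longrightarrow> norm z \<le> R \<and> x \<in> {0..L}"
  shows "uniform_limit S (\<lambda>N (z, x). \<Sum>n<N. fst (iterate w z n x)) (\<lambda>(z, x). sol1 w z x) sequentially"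
    "uniform_limit S (\<lambda>N (z, x). \<Sum>n<N. snd (iterate w z n x)) (\<lambda>(z, x). sol2 w z x) sequentially"
proof -
  obtain K where K: "\<And>z x n. norm (z::complex) \<le> R \<Longrightarrow> x \<in> {0..L} \<Longrightarrow>
    norm (fst (iterate w z n x)) + norm (snd (iterate w z n x)) \<le> K / 2 ^ n"
    using norm_iterate_le_geometric by metis
  have le: "norm (fst (iterate w z n x)) \<le> K / 2 ^ n" "norm (snd (iterate w z n x)) \<le> K / 2 ^ n"
    if "(z, x) \<in> S" for z :: complex and x n
    using K[of z x n] S[OF that] norm_ge_zero[of "fst (iterate w z n x)"] norm_ge_zero[of "snd (iterate w z n x)"]
    by linarith+
  show "uniform_limit S (\<lambda>N (z, x). \<Sum>n<N. fst (iterate w z n x)) (\<lambda>(z, x). sol1 w z x) sequentially"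
    "uniform_limit S (\<lambda>N (z, x). \<Sum>n<N. snd (iterate w z n x)) (\<lambda>(z, x). sol2 w z x) sequentially"
    using Weierstrass_m_test[of S "\<lambda>n (z, x). fst (iterate w z n x)" "\<lambda>n. K / 2 ^ n", OF _ summable_geometric_half]
      Weierstrass_m_test[of S "\<lambda>n (z, x). snd (iterate w z n x)" "\<lambda>n. K / 2 ^ n", OF _ summable_geometric_half] le
    unfolding sol1_def sol2_def case_prod_unfold by force+
qed

lemma iterate_sums:
  assumes "x \<in> {0..L}"
  shows "(\<lambda>n. fst (iterate w z n x)) sums sol1 w z x" "(\<lambda>n. snd (iterate w z n x)) sums sol2 w z x"
  using tendsto_uniform_limitI[OF iterate_uniform_limit(1)[of "{(z, x)}" "norm z" w], of "(z, x)"]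
    tendsto_uniform_limitI[OF iterate_uniform_limit(2)[of "{(z, x)}" "norm z" w], of "(z, x)"] assms
  by (auto simp: sums_def)

lemma sol_continuous: "continuous_on {0..L} (sol1 w z)" "continuous_on {0..L} (sol2 w z)"
proof -
  have u: "uniform_limit {0..L} (\<lambda>N x. \<Sum>n<N. fst (iterate w z n x)) (sol1 w z) sequentially"
    "uniform_limit {0..L} (\<lambda>N x. \<Sum>n<N. snd (iterate w z n x)) (sol2 w z) sequentially"
    using iterate_uniform_limit[of "{z} \<times> {0..L}" "norm z" w]
    by (auto simp: uniform_limit_iff elim!: eventually_mono)
  show "continuous_on {0..L} (sol1 w z)" "continuous_on {0..L} (sol2 w z)"
    using iterate_continuous[of w z]
    by (auto simp del: split_paired_All intro!: uniform_limit_theorem[OF _ u(1)] uniform_limit_theorem[OF _ u(2)] always_eventually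
        continuous_on_sum)
qed

lemma sol_integral_equation:
  assumes x: "x \<in> {0..L}"
  shows "sol1 w z x = fst w + integral {0..x} (\<lambda>t. z * A t * sol1 w z t + V t * sol2 w z t)"
    and "sol2 w z x = snd w + integral {0..x} (\<lambda>t. z * B t * sol2 w z t + W t * sol1 w z t)"
proof -
  obtain K where K: "0 \<le> K" "\<And>x n. x \<in> {0..L} \<Longrightarrow>
    norm (fst (iterate w z n x)) + norm (snd (iterate w z n x)) \<le> K / 2 ^ n"
    using norm_iterate_le_geometric[of "norm z" w] by (metis order_refl)
  let ?f = "\<lambda>n t. fst (iterate w z n t)" and ?g = "\<lambda>n t. snd (iterate w z n t)"
  have sub: "h integrable_on {0..x}" if "h absolutely_integrable_on {0..L}" for h :: "real \<Rightarrow> 'a::euclidean_space"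
    using absolutely_integrable_on_subinterval[OF that, of 0 x] x by (auto simp: absolutely_integrable_on_def)
  have gr: "(\<lambda>t. growth (norm z) t * K) integrable_on {0..x}"
    by (intro integrable_on_mult_left sub growth_absolutely_integrable)
  have bound: "norm (z * P * ?f i t + Q * ?g i t) \<le> growth (norm z) t * K / 2 ^ i"
    "norm (z * P * ?g i t + Q * ?f i t) \<le> growth (norm z) t * K / 2 ^ i"
    if "t \<in> {0..x}" "norm z * norm P + norm Q \<le> growth (norm z) t" for P Q i t
  proof -
    have le: "norm (z * P * a + Q * b) \<le> growth (norm z) t * (norm a + norm b)" for a b
    proof -
      have "norm (z * P * a + Q * b) \<le> norm z * norm P * norm a + norm Q * norm b"
        by (rule norm_triangle_le) (simp add: norm_mult)
      also have "\<dots> \<le> (norm z * norm P + norm Q) * (norm a + norm b)"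
        by (simp add: algebra_simps)
      also have "\<dots> \<le> growth (norm z) t * (norm a + norm b)"
        using that(2) by (intro mult_right_mono) auto
      finally show ?thesis .
    qed
    have g0: "0 \<le> growth (norm z) t" by (simp add: growth_def)
    have fg: "norm (?f i t) + norm (?g i t) \<le> K / 2 ^ i" using K(2) that(1) x by auto
    show "norm (z * P * ?f i t + Q * ?g i t) \<le> growth (norm z) t * K / 2 ^ i"
      "norm (z * P * ?g i t + Q * ?f i t) \<le> growth (norm z) t * K / 2 ^ i"
      using order_trans[OF le mult_left_mono[OF fg g0]] 
        order_trans[OF le mult_left_mono[OF fg[unfolded add.commute[of "norm (?f i t)"]] g0]] by simp_all
  qed
  have s: "(\<lambda>i. ?f i t) sums sol1 w z t" "(\<lambda>i. ?g i t) sums sol2 w z t" if "t \<in> {0..x}" for t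
    using iterate_sums[of t] that x by auto
  have "(\<lambda>i. integral {0..x} (\<lambda>t. z * A t * ?f i t + V t * ?g i t)) sums
      integral {0..x} (\<lambda>t. z * A t * sol1 w z t + V t * sol2 w z t)"
  proof (rule integral_sums_geometric[OF _ gr])
    show "(\<lambda>t. z * A t * ?f i t + V t * ?g i t) integrable_on {0..x}" for i
      using iterate_continuous by (intro sub rhs_absolutely_integrable) auto
    show "norm (z * A t * ?f i t + V t * ?g i t) \<le> growth (norm z) t * K / 2 ^ i" if "t \<in> {0..x}" for i t
      using that by (intro bound(1)) (auto simp: growth_def)
    show "(\<lambda>i. z * A t * ?f i t + V t * ?g i t) sums (z * A t * sol1 w z t + V t * sol2 w z t)" if "t \<in> {0..x}" for t
      using s[OF that] by (intro sums_add sums_mult)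
  qed
  then have "(\<lambda>n. ?f (Suc n) x) sums integral {0..x} (\<lambda>t. z * A t * sol1 w z t + V t * sol2 w z t)" by simp
  from sums_Suc[OF this] show "sol1 w z x = fst w + integral {0..x} (\<lambda>t. z * A t * sol1 w z t + V t * sol2 w z t)"
    using iterate_sums(1)[OF x, of w z] sums_unique2 by (fastforce simp: add.commute)
  have "(\<lambda>i. integral {0..x} (\<lambda>t. z * B t * ?g i t + W t * ?f i t)) sums
      integral {0..x} (\<lambda>t. z * B t * sol2 w z t + W t * sol1 w z t)"
  proof (rule integral_sums_geometric[OF _ gr])
    show "(\<lambda>t. z * B t * ?g i t + W t * ?f i t) integrable_on {0..x}" for i
      using iterate_continuous by (intro sub rhs_absolutely_integrable) auto
    show "norm (z * B t * ?g i t + W t * ?f i t) \<le> growth (norm z) t * K / 2 ^ i" if "t \<in> {0..x}" for i t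
      using that by (intro bound(2)) (auto simp: growth_def)
    show "(\<lambda>i. z * B t * ?g i t + W t * ?f i t) sums (z * B t * sol2 w z t + W t * sol1 w z t)" if "t \<in> {0..x}" for t
      using s[OF that] by (intro sums_add sums_mult)
  qed
  then have "(\<lambda>n. ?g (Suc n) x) sums integral {0..x} (\<lambda>t. z * B t * sol2 w z t + W t * sol1 w z t)" by simp
  from sums_Suc[OF this] show "sol2 w z x = snd w + integral {0..x} (\<lambda>t. z * B t * sol2 w z t + W t * sol1 w z t)"
    using iterate_sums(2)[OF x, of w z] sums_unique2 by (fastforce simp: add.commute)
qed

lemma sol_initial: "sol1 w z 0 = fst w" "sol2 w z 0 = snd w"
  using sol_integral_equation[of 0 w z] L_nonneg by simp_all

lemma sol_primitive:
  "ac_primitive_on 0 L (sol1 w z) (\<lambda>t. z * A t * sol1 w z t + V t * sol2 w z t)"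
  "ac_primitive_on 0 L (sol2 w z) (\<lambda>t. z * B t * sol2 w z t + W t * sol1 w z t)"
proof -
  have "ac_primitive_on 0 L (\<lambda>x. c + integral {0..x} h) h" if "h absolutely_integrable_on {0..L}"
    for h :: "real \<Rightarrow> complex" and c
    using ac_primitive_on_add[OF ac_primitive_on_const ac_primitive_on_indefinite_integral[OF that]] by simp
  note p = this
  note int = rhs_absolutely_integrable[OF sol_continuous(1)[of w z] sol_continuous(2)[of w z], of z]
  show "ac_primitive_on 0 L (sol1 w z) (\<lambda>t. z * A t * sol1 w z t + V t * sol2 w z t)"
    by (rule ac_primitive_on_cong[OF p[OF int(1)]], rule sol_integral_equation(1)[symmetric])
  show "ac_primitive_on 0 L (sol2 w z) (\<lambda>t. z * B t * sol2 w z t + W t * sol1 w z t)"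
    by (rule ac_primitive_on_cong[OF p[OF int(2)]], rule sol_integral_equation(2)[symmetric])
qed

lemma iterate_polynomial:
  "\<exists>c d. (\<forall>k. continuous_on {0..L} (c k)) \<and> (\<forall>k. continuous_on {0..L} (d k)) \<and>
     (\<forall>k>n. \<forall>t. c k t = 0 \<and> d k t = 0) \<and>
     (\<forall>z. \<forall>x\<in>{0..L}. iterate w z n x = (\<Sum>k\<le>n. c k x * z ^ k, \<Sum>k\<le>n. d k x * z ^ k))"
proof (induction n)
  case 0
  show ?case
    by (rule exI[of _ "\<lambda>k t. if k = 0 then fst w else 0"], rule exI[of _ "\<lambda>k t. if k = 0 then snd w else 0"]) auto
next
  case (Suc n)
  then obtain c d where cd: "\<And>k. continuous_on {0..L} (c k)" "\<And>k. continuous_on {0..L} (d k)"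
    "\<And>k t. k > n \<Longrightarrow> c k t = 0" "\<And>k t. k > n \<Longrightarrow> d k t = 0"
    and it: "\<And>z x. x \<in> {0..L} \<Longrightarrow> iterate w z n x = (\<Sum>k\<le>n. c k x * z ^ k, \<Sum>k\<le>n. d k x * z ^ k)"
    by blast
  obtain e where e: "\<And>k. continuous_on {0..L} (e k)" "\<And>k t. k > Suc n \<Longrightarrow> e k t = 0"
    "\<And>z x. x \<in> {0..L} \<Longrightarrow> integral {0..x} (\<lambda>t. z * A t * (\<Sum>k\<le>n. c k t * z ^ k) + V t * (\<Sum>k\<le>n. d k t * z ^ k))
        = (\<Sum>k\<le>Suc n. e k x * z ^ k)"
    by (rule integral_polynomial_coefficients[where A=A and L=L and V=V and c=c and d=d and n=n]) (use A_int V_int cd in blast)+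
  obtain e' where e': "\<And>k. continuous_on {0..L} (e' k)" "\<And>k t. k > Suc n \<Longrightarrow> e' k t = 0"
    "\<And>z x. x \<in> {0..L} \<Longrightarrow> integral {0..x} (\<lambda>t. z * B t * (\<Sum>k\<le>n. d k t * z ^ k) + W t * (\<Sum>k\<le>n. c k t * z ^ k))
        = (\<Sum>k\<le>Suc n. e' k x * z ^ k)"
    by (rule integral_polynomial_coefficients[where A=B and L=L and V=W and c=d and d=c and n=n]) (use B_int W_int cd in blast)+
  have "iterate w z (Suc n) x = (\<Sum>k\<le>Suc n. e k x * z ^ k, \<Sum>k\<le>Suc n. e' k x * z ^ k)" if "x \<in> {0..L}" for z x
    unfolding e(3)[OF that, symmetric] e'(3)[OF that, symmetric] iterate.simps prod.inject
    using that it by (intro conjI integral_cong) auto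
  then show ?case using e(1,2) e'(1,2)
    by (intro exI[of _ e] exI[of _ e']) auto
qed

lemma sol_holomorphic:
  assumes x: "x \<in> {0..L}"
  shows "(\<lambda>z. sol1 w z x) holomorphic_on UNIV" "(\<lambda>z. sol2 w z x) holomorphic_on UNIV"
proof -
  have it: "(\<lambda>z. fst (iterate w z n x)) holomorphic_on UNIV" "(\<lambda>z. snd (iterate w z n x)) holomorphic_on UNIV" for n
  proof -
    obtain c d where "\<And>z. iterate w z n x = (\<Sum>k\<le>n. c k x * z ^ k, \<Sum>k\<le>n. d k x * z ^ k)"
      using iterate_polynomial[of n w] x by blast
    then show "(\<lambda>z. fst (iterate w z n x)) holomorphic_on UNIV" "(\<lambda>z. snd (iterate w z n x)) holomorphic_on UNIV"
      by (auto intro!: holomorphic_intros)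
  qed
  have u: "uniform_limit (cball z 1) (\<lambda>N z. \<Sum>n<N. fst (iterate w z n x)) (\<lambda>z. sol1 w z x) sequentially"
    "uniform_limit (cball z 1) (\<lambda>N z. \<Sum>n<N. snd (iterate w z n x)) (\<lambda>z. sol2 w z x) sequentially" for z
  proof -
    have "norm z' \<le> norm z + 1" if "z' \<in> cball z 1" for z'
      using that norm_triangle_ineq2[of z' z] by (simp add: dist_norm norm_minus_commute)
    then show "uniform_limit (cball z 1) (\<lambda>N z. \<Sum>n<N. fst (iterate w z n x)) (\<lambda>z. sol1 w z x) sequentially"
    "uniform_limit (cball z 1) (\<lambda>N z. \<Sum>n<N. snd (iterate w z n x)) (\<lambda>z. sol2 w z x) sequentially"
      using iterate_uniform_limit[of "cball z 1 \<times> {x}" "norm z + 1" w] x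
      by (auto simp: uniform_limit_iff elim!: eventually_mono)
  qed
  show "(\<lambda>z. sol1 w z x) holomorphic_on UNIV"
    by (rule holomorphic_uniform_sequence[where f = "\<lambda>N z. \<Sum>n<N. fst (iterate w z n x)"])
      (use u(1) in \<open>auto intro!: holomorphic_intros it exI[of _ 1]\<close>)
  show "(\<lambda>z. sol2 w z x) holomorphic_on UNIV"
    by (rule holomorphic_uniform_sequence[where f = "\<lambda>N z. \<Sum>n<N. snd (iterate w z n x)"])
      (use u(2) in \<open>auto intro!: holomorphic_intros it exI[of _ 1]\<close>)
qed

end

section \<open>The system in conjugate coordinates\<close>

text \<open>Here \<open>\<rho>\<close> is the weight and \<open>v\<close> the potential. The positive lower bound \<open>m\<close> of the weight and the square
  integrability of \<open>v\<close> enter through \<open>phi1_small\<close>.\<close>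
locale canonical_system =
  fixes L m :: real and \<rho> :: "real \<Rightarrow> real" and v :: "real \<Rightarrow> complex"
  assumes L_pos: "0 < L" and m_pos: "0 < m"
    and rho_int: "\<rho> absolutely_integrable_on {0..L}" and rho_ge: "\<And>x. m \<le> \<rho> x"
    and v_int: "v absolutely_integrable_on {0..L}"
    and v_square_int: "(\<lambda>x. (norm (v x))\<^sup>2) absolutely_integrable_on {0..L}"
begin

sublocale linear_system L "\<lambda>x. \<i> * \<rho> x" "\<lambda>x. - \<i> * \<rho> x" v "\<lambda>x. cnj (v x)"
proof
  show "(\<lambda>x. cnj (v x)) absolutely_integrable_on {0..L}"
    using absolutely_integrable_linear[OF v_int bounded_linear_cnj] by (simp add: o_def)
  have "bounded_linear (\<lambda>x. c * complex_of_real x)" for c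
    using bounded_linear_compose[OF bounded_linear_mult_right bounded_linear_of_real] by blast
  from absolutely_integrable_linear[OF rho_int this[of "\<i>"]] absolutely_integrable_linear[OF rho_int this[of "- \<i>"]]
  show "(\<lambda>x. \<i> * complex_of_real (\<rho> x)) absolutely_integrable_on {0..L}"
    "(\<lambda>x. - \<i> * complex_of_real (\<rho> x)) absolutely_integrable_on {0..L}"
    by (simp_all only: o_def)
qed (use L_pos v_int in auto)

definition solution :: "complex \<Rightarrow> (real \<Rightarrow> complex) \<Rightarrow> (real \<Rightarrow> complex) \<Rightarrow> bool" where
  "solution z f g \<longleftrightarrow>
     ac_primitive_on 0 L f (\<lambda>t. z * (\<i> * \<rho> t) * f t + v t * g t) \<and>
     ac_primitive_on 0 L g (\<lambda>t. z * (- \<i> * \<rho> t) * g t + cnj (v t) * f t)"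

definition "\<theta>\<^sub>1 = sol1 (1, 0)"
definition "\<theta>\<^sub>2 = sol2 (1, 0)"
definition "\<phi>\<^sub>1 = sol1 (0, 1)"
definition "\<phi>\<^sub>2 = sol2 (0, 1)"

lemmas fundamental_def = \<theta>\<^sub>1_def \<theta>\<^sub>2_def \<phi>\<^sub>1_def \<phi>\<^sub>2_def

lemma fundamental_initial: "\<theta>\<^sub>1 z 0 = 1" "\<theta>\<^sub>2 z 0 = 0" "\<phi>\<^sub>1 z 0 = 0" "\<phi>\<^sub>2 z 0 = 1"
  unfolding fundamental_def sol_initial by simp_all

lemma fundamental_holomorphic:
  assumes "x \<in> {0..L}"
  shows "(\<lambda>z. \<theta>\<^sub>1 z x) holomorphic_on UNIV" "(\<lambda>z. \<theta>\<^sub>2 z x) holomorphic_on UNIV"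
    "(\<lambda>z. \<phi>\<^sub>1 z x) holomorphic_on UNIV" "(\<lambda>z. \<phi>\<^sub>2 z x) holomorphic_on UNIV"
  unfolding fundamental_def using assms by (simp_all only: sol_holomorphic)

lemma solution_fundamental: "solution z (\<theta>\<^sub>1 z) (\<theta>\<^sub>2 z)" "solution z (\<phi>\<^sub>1 z) (\<phi>\<^sub>2 z)"
  unfolding fundamental_def solution_def by (intro conjI sol_primitive)+

lemma solution_combination:
  assumes "solution z f g" "solution z h k"
  shows "solution z (\<lambda>x. a * f x + b * h x) (\<lambda>x. a * g x + b * k x)"
proof -
  have "ac_primitive_on 0 L (\<lambda>x. a * f x + b * h x)
      (\<lambda>t. a * (z * (\<i> * \<rho> t) * f t + v t * g t) + b * (z * (\<i> * \<rho> t) * h t + v t * k t))"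
    "ac_primitive_on 0 L (\<lambda>x. a * g x + b * k x)
      (\<lambda>t. a * (z * (- \<i> * \<rho> t) * g t + cnj (v t) * f t) + b * (z * (- \<i> * \<rho> t) * k t + cnj (v t) * h t))"
    using assms unfolding solution_def by (auto intro!: ac_primitive_on_add ac_primitive_on_cmult)
  then show ?thesis unfolding solution_def by (simp add: algebra_simps)
qed

text \<open>Conjugation exchanges the two components and reflects the spectral parameter.\<close>

lemma solution_cnj:
  assumes "solution z f g"
  shows "solution (cnj z) (\<lambda>x. cnj (g x)) (\<lambda>x. cnj (f x))"
  using ac_primitive_on_bounded_linear[OF bounded_linear_cnj conjunct1[OF assms[unfolded solution_def]]]
    ac_primitive_on_bounded_linear[OF bounded_linear_cnj conjunct2[OF assms[unfolded solution_def]]]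
  unfolding solution_def by (simp add: add.commute)

text \<open>The coefficient matrix has trace zero.\<close>

lemma wronskian_const:
  assumes "solution z f g" "solution z h k" "x \<in> {0..L}"
  shows "f x * k x - h x * g x = f 0 * k 0 - h 0 * g 0"
proof (rule ac_primitive_on_zero_imp_const)
  show "ac_primitive_on 0 L (\<lambda>x. f x * k x - h x * g x) (\<lambda>t.
      (f t * (z * (- \<i> * \<rho> t) * k t + cnj (v t) * h t) + (z * (\<i> * \<rho> t) * f t + v t * g t) * k t) -
      (h t * (z * (- \<i> * \<rho> t) * g t + cnj (v t) * f t) + (z * (\<i> * \<rho> t) * h t + v t * k t) * g t))"
    using assms by (intro ac_primitive_on_diff ac_primitive_on_mult) (auto simp: solution_def)
qed (use assms in \<open>auto simp: algebra_simps\<close>)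

lemma fundamental_det:
  assumes "x \<in> {0..L}"
  shows "\<theta>\<^sub>1 z x * \<phi>\<^sub>2 z x - \<phi>\<^sub>1 z x * \<theta>\<^sub>2 z x = 1"
  using wronskian_const[OF solution_fundamental assms, of z] by (simp add: fundamental_initial)

text \<open>Cramer's rule, with the Wronskians evaluated at \<open>0\<close>. In particular every solution is determined by its initial value.\<close>

lemma solution_eq_combination:
  assumes "solution z f g" "x \<in> {0..L}"
  shows "f x = f 0 * \<theta>\<^sub>1 z x + g 0 * \<phi>\<^sub>1 z x" "g x = f 0 * \<theta>\<^sub>2 z x + g 0 * \<phi>\<^sub>2 z x"
proof -
  have 1: "f x * \<phi>\<^sub>2 z x - \<phi>\<^sub>1 z x * g x = f 0"
    using wronskian_const[OF assms(1) solution_fundamental(2) assms(2)] by (simp add: fundamental_initial)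
  have 2: "f x * \<theta>\<^sub>2 z x - \<theta>\<^sub>1 z x * g x = - g 0"
    using wronskian_const[OF assms(1) solution_fundamental(1) assms(2)] by (simp add: fundamental_initial)
  note 3 = fundamental_det[OF assms(2), of z]
  have "f 0 * \<theta>\<^sub>1 z x + g 0 * \<phi>\<^sub>1 z x
      = (f x * \<phi>\<^sub>2 z x - \<phi>\<^sub>1 z x * g x) * \<theta>\<^sub>1 z x - (f x * \<theta>\<^sub>2 z x - \<theta>\<^sub>1 z x * g x) * \<phi>\<^sub>1 z x"
    unfolding 1 2 by simp
  also have "\<dots> = f x * (\<theta>\<^sub>1 z x * \<phi>\<^sub>2 z x - \<phi>\<^sub>1 z x * \<theta>\<^sub>2 z x)" by (simp add: algebra_simps)
  finally show "f x = f 0 * \<theta>\<^sub>1 z x + g 0 * \<phi>\<^sub>1 z x" unfolding 3 by simp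
  have "f 0 * \<theta>\<^sub>2 z x + g 0 * \<phi>\<^sub>2 z x
      = (f x * \<phi>\<^sub>2 z x - \<phi>\<^sub>1 z x * g x) * \<theta>\<^sub>2 z x - (f x * \<theta>\<^sub>2 z x - \<theta>\<^sub>1 z x * g x) * \<phi>\<^sub>2 z x"
    unfolding 1 2 by simp
  also have "\<dots> = g x * (\<theta>\<^sub>1 z x * \<phi>\<^sub>2 z x - \<phi>\<^sub>1 z x * \<theta>\<^sub>2 z x)" by (simp add: algebra_simps)
  finally show "g x = f 0 * \<theta>\<^sub>2 z x + g 0 * \<phi>\<^sub>2 z x" unfolding 3 by simp
qed

lemma solution_zero:
  assumes "solution z f g" "s \<in> {0..L}" "f s = 0" "g s = 0" "x \<in> {0..L}"
  shows "f x = 0" "g x = 0"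
proof -
  have "f 0 * \<theta>\<^sub>1 z s + g 0 * \<phi>\<^sub>1 z s = 0" "f 0 * \<theta>\<^sub>2 z s + g 0 * \<phi>\<^sub>2 z s = 0"
    using solution_eq_combination[OF assms(1,2)] assms(3,4) by simp_all
  moreover note fundamental_det[OF assms(2), of z]
  ultimately have "f 0 = 0" "g 0 = 0" by algebra+
  then show "f x = 0" "g x = 0" using solution_eq_combination[OF assms(1,5)] by simp_all
qed

lemma fundamental_cnj:
  assumes "x \<in> {0..L}"
  shows "\<theta>\<^sub>1 (cnj z) x = cnj (\<phi>\<^sub>2 z x)" "\<theta>\<^sub>2 (cnj z) x = cnj (\<phi>\<^sub>1 z x)"
    "\<phi>\<^sub>1 (cnj z) x = cnj (\<theta>\<^sub>2 z x)" "\<phi>\<^sub>2 (cnj z) x = cnj (\<theta>\<^sub>1 z x)"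
  using solution_eq_combination[OF solution_cnj[OF solution_fundamental(2)] assms, of z]
    solution_eq_combination[OF solution_cnj[OF solution_fundamental(1)] assms, of z]
  by (simp_all add: fundamental_initial)

section \<open>Energy estimates\<close>

definition \<sigma> :: "real \<Rightarrow> real" where "\<sigma> x = integral {0..x} \<rho>"
definition v_mass :: "real \<Rightarrow> real" where "v_mass x = integral {0..x} (\<lambda>t. norm (v t))"
definition v_energy :: "real \<Rightarrow> real" where "v_energy x = integral {0..x} (\<lambda>t. (norm (v t))\<^sup>2)"

lemma sigma_primitive: "ac_primitive_on 0 L \<sigma> \<rho>"
  unfolding \<sigma>_def by (intro ac_primitive_on_indefinite_integral rho_int)

lemma v_mass_primitive: "ac_primitive_on 0 L v_mass (\<lambda>t. norm (v t))"
  unfolding v_mass_def using absolutely_integrable_norm[OF v_int]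
  by (intro ac_primitive_on_indefinite_integral) (simp add: o_def)

lemma v_energy_primitive: "ac_primitive_on 0 L v_energy (\<lambda>t. (norm (v t))\<^sup>2)"
  unfolding v_energy_def by (intro ac_primitive_on_indefinite_integral v_square_int)

lemma at_zero: "\<sigma> 0 = 0" "v_mass 0 = 0" "v_energy 0 = 0"
  by (simp_all add: \<sigma>_def v_mass_def v_energy_def)

lemma rho_pos: "0 < \<rho> x" using m_pos rho_ge[of x] by linarith

lemma bounds_at_end:
  assumes "x \<in> {0..L}"
  shows "0 \<le> \<sigma> x" "\<sigma> x \<le> \<sigma> L" "0 \<le> v_mass x" "v_mass x \<le> v_mass L" "0 \<le> v_energy x" "v_energy x \<le> v_energy L"
  using ac_primitive_on_mono[OF sigma_primitive, of 0 x] ac_primitive_on_mono[OF sigma_primitive, of x L]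
    ac_primitive_on_mono[OF v_mass_primitive, of 0 x] ac_primitive_on_mono[OF v_mass_primitive, of x L]
    ac_primitive_on_mono[OF v_energy_primitive, of 0 x] ac_primitive_on_mono[OF v_energy_primitive, of x L]
    assms less_imp_le[OF rho_pos] by (auto simp: at_zero)

definition coupling :: "complex \<Rightarrow> complex \<Rightarrow> complex \<Rightarrow> real" where
  "coupling w a b = Re (w * cnj a * b)"

lemma abs_coupling_le: "\<bar>coupling w a b\<bar> \<le> norm w * norm a * norm b"
  using abs_Re_le_cmod[of "w * cnj a * b"] by (simp add: norm_mult coupling_def)

text \<open>The interaction with the potential enters both squares in the same way, so it cancels in the difference and only the weight remains there.\<close>

lemma norm_squares_primitive:
  assumes "solution z f g"
  shows "ac_primitive_on 0 L (\<lambda>x. (norm (f x))\<^sup>2)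
      (\<lambda>t. - 2 * Im z * \<rho> t * (norm (f t))\<^sup>2 + 2 * coupling (v t) (f t) (g t))"
    and "ac_primitive_on 0 L (\<lambda>x. (norm (g x))\<^sup>2)
      (\<lambda>t. 2 * Im z * \<rho> t * (norm (g t))\<^sup>2 + 2 * coupling (v t) (f t) (g t))"
proof -
  have "2 * Re (cnj a * (z * (\<i> * complex_of_real r) * a + w * b)) = - 2 * Im z * r * (norm a)\<^sup>2 + 2 * coupling w a b"
    "2 * Re (cnj b * (z * (- \<i> * complex_of_real r) * b + cnj w * a)) = 2 * Im z * r * (norm b)\<^sup>2 + 2 * coupling w a b"
    for a b w r
    unfolding cmod_power2 coupling_def by (simp_all add: algebra_simps power2_eq_square)
  note eq = this
  show "ac_primitive_on 0 L (\<lambda>x. (norm (f x))\<^sup>2)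
      (\<lambda>t. - 2 * Im z * \<rho> t * (norm (f t))\<^sup>2 + 2 * coupling (v t) (f t) (g t))"
    and "ac_primitive_on 0 L (\<lambda>x. (norm (g x))\<^sup>2)
      (\<lambda>t. 2 * Im z * \<rho> t * (norm (g t))\<^sup>2 + 2 * coupling (v t) (f t) (g t))"
    using ac_primitive_on_norm_square[OF conjunct1[OF assms[unfolded solution_def]]]
      ac_primitive_on_norm_square[OF conjunct2[OF assms[unfolded solution_def]]]
    by (simp_all only: eq)
qed

lemma energy_primitive:
  assumes "solution z f g"
  shows "ac_primitive_on 0 L (\<lambda>x. (norm (g x))\<^sup>2 - (norm (f x))\<^sup>2)
    (\<lambda>t. 2 * Im z * \<rho> t * ((norm (f t))\<^sup>2 + (norm (g t))\<^sup>2))"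
  using ac_primitive_on_diff[OF norm_squares_primitive(2,1)[OF assms]] by (simp add: algebra_simps)

lemma energy_mono:
  assumes "solution z f g" "0 \<le> Im z" "0 \<le> s" "s \<le> t" "t \<le> L"
  shows "(norm (g s))\<^sup>2 - (norm (f s))\<^sup>2 \<le> (norm (g t))\<^sup>2 - (norm (f t))\<^sup>2"
  by (rule ac_primitive_on_mono[OF energy_primitive[OF assms(1)] _ assms(3-5)])
    (use assms(2) less_imp_le[OF rho_pos] in simp)

text \<open>The energy \<open>|g|\<^sup>2 - |f|\<^sup>2\<close> is nondecreasing, so the two boundary inequalities squeeze it to \<open>0\<close>. Its derivative,
  a positive multiple of \<open>|f|\<^sup>2 + |g|\<^sup>2\<close>, then vanishes almost everywhere, so the solution vanishes at some
  point. This rules out eigenvalues in the upper half plane.\<close>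

lemma solution_zero_of_energy:
  assumes sol: "solution z f g" and z: "0 < Im z"
    and start: "norm (f 0) \<le> norm (g 0)" and final: "norm (g L) \<le> norm (f L)" and x: "x \<in> {0..L}"
  shows "f x = 0" "g x = 0"
proof -
  have E: "(norm (g x))\<^sup>2 - (norm (f x))\<^sup>2 = 0" if "x \<in> {0..L}" for x
  proof (rule antisym)
    have "(norm (g x))\<^sup>2 - (norm (f x))\<^sup>2 \<le> (norm (g L))\<^sup>2 - (norm (f L))\<^sup>2"
      using energy_mono[OF sol, of x L] z that by simp
    then show "(norm (g x))\<^sup>2 - (norm (f x))\<^sup>2 \<le> 0" using power_mono[OF final norm_ge_zero, of 2] by linarith
    have "(norm (g 0))\<^sup>2 - (norm (f 0))\<^sup>2 \<le> (norm (g x))\<^sup>2 - (norm (f x))\<^sup>2"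
      using energy_mono[OF sol, of 0 x] z that by simp
    then show "0 \<le> (norm (g x))\<^sup>2 - (norm (f x))\<^sup>2" using power_mono[OF start norm_ge_zero, of 2] by linarith
  qed
  have "ac_primitive_on 0 L (\<lambda>x. (norm (g x))\<^sup>2 - (norm (f x))\<^sup>2) (\<lambda>t. 0)"
    by (rule ac_primitive_on_cong[OF ac_primitive_on_const]) (simp add: E)
  note ae = ac_primitive_on_unique[OF energy_primitive[OF sol] this]
  obtain s where s: "s \<in> {0<..<L}" "2 * Im z * \<rho> s * ((norm (f s))\<^sup>2 + (norm (g s))\<^sup>2) = 0"
    by (rule AE_lebesgue_on_nontrivial[OF L_pos ae])
  then have "(norm (f s))\<^sup>2 + (norm (g s))\<^sup>2 = 0" using z rho_pos[of s] by simp
  then have "f s = 0" "g s = 0"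
    by (simp_all add: sum_power2_eq_zero_iff)
  then show "f x = 0" "g x = 0"
    using solution_zero[OF sol _ _ _ x, of s] s(1) by auto
qed

text \<open>Gronwall's inequality: \<open>|f|\<^sup>2 + |g|\<^sup>2\<close> has logarithmic derivative at most \<open>2 |Im z| \<rho> + 2 |v|\<close>.\<close>

lemma solution_growth:
  assumes sol: "solution z f g" and x: "x \<in> {0..L}"
  shows "(norm (f x))\<^sup>2 + (norm (g x))\<^sup>2
    \<le> ((norm (f 0))\<^sup>2 + (norm (g 0))\<^sup>2) * exp (2 * \<bar>Im z\<bar> * \<sigma> L + 2 * v_mass L)"
proof -
  define S where "S x = (norm (f x))\<^sup>2 + (norm (g x))\<^sup>2" for x
  define S' where "S' t = - 2 * Im z * \<rho> t * (norm (f t))\<^sup>2 + 2 * coupling (v t) (f t) (g t)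
      + (2 * Im z * \<rho> t * (norm (g t))\<^sup>2 + 2 * coupling (v t) (f t) (g t))" for t
  \<comment> \<open>The logarithm of the integrating factor.\<close>
  define e where "e x = - 2 * \<bar>Im z\<bar> * \<sigma> x + - 2 * v_mass x" for x
  have S: "ac_primitive_on 0 L S S'"
    unfolding S_def S'_def by (intro ac_primitive_on_add norm_squares_primitive[OF sol])
  have "ac_primitive_on 0 L e (\<lambda>t. - 2 * \<bar>Im z\<bar> * \<rho> t + - 2 * norm (v t))"
    unfolding e_def by (intro ac_primitive_on_add ac_primitive_on_cmult sigma_primitive v_mass_primitive)
  note P = ac_primitive_on_mult[OF S ac_primitive_on_exp[OF this]]
  have "S t * (exp (e t) * (- 2 * \<bar>Im z\<bar> * \<rho> t + - 2 * norm (v t))) + S' t * exp (e t) \<le> 0" for t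
  proof -
    have "2 * (norm (f t) * norm (g t)) \<le> S t"
      using sum_squares_bound[of "norm (f t)" "norm (g t)"] by (simp add: S_def)
    from mult_left_mono[OF this, of "norm (v t)"]
    have "4 * coupling (v t) (f t) (g t) \<le> 2 * norm (v t) * S t"
      using abs_coupling_le[of "v t" "f t" "g t"] by (simp add: algebra_simps)
    moreover have "2 * Im z * \<rho> t * ((norm (g t))\<^sup>2 - (norm (f t))\<^sup>2) \<le> 2 * \<bar>Im z\<bar> * \<rho> t * S t"
    proof -
      have "Im z * ((norm (g t))\<^sup>2 - (norm (f t))\<^sup>2) \<le> \<bar>Im z\<bar> * \<bar>(norm (g t))\<^sup>2 - (norm (f t))\<^sup>2\<bar>"
        by (metis abs_ge_self abs_mult)
      also have "\<dots> \<le> \<bar>Im z\<bar> * S t" by (intro mult_left_mono) (auto simp: S_def abs_if)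
      finally have "2 * \<rho> t * (Im z * ((norm (g t))\<^sup>2 - (norm (f t))\<^sup>2)) \<le> 2 * \<rho> t * (\<bar>Im z\<bar> * S t)"
        using rho_pos[of t] by (intro mult_left_mono) auto
      then show ?thesis by (simp add: mult_ac)
    qed
    ultimately have "S' t \<le> S t * (2 * \<bar>Im z\<bar> * \<rho> t + 2 * norm (v t))"
      unfolding S'_def by (simp add: algebra_simps)
    then have "(S' t - S t * (2 * \<bar>Im z\<bar> * \<rho> t + 2 * norm (v t))) * exp (e t) \<le> 0"
      by (intro mult_nonpos_nonneg) auto
    then show ?thesis by (simp add: algebra_simps)
  qed
  then have "S x * exp (e x) \<le> S 0 * exp (e 0)"
    using x by (intro ac_primitive_on_antimono[OF P]) auto
  then have "S x * exp (e x) * exp (- e x) \<le> S 0 * exp (e 0) * exp (- e x)"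
    by (rule mult_right_mono) simp
  moreover have "e 0 = 0" by (simp add: e_def at_zero)
  ultimately have "S x \<le> S 0 * exp (- e x)"
    by (simp add: mult.assoc flip: exp_add)
  also have "\<dots> \<le> S 0 * exp (2 * \<bar>Im z\<bar> * \<sigma> L + 2 * v_mass L)"
  proof -
    have "\<bar>Im z\<bar> * \<sigma> x \<le> \<bar>Im z\<bar> * \<sigma> L" using bounds_at_end(2)[OF x] by (intro mult_left_mono) auto
    then show ?thesis
      using bounds_at_end(4)[OF x] unfolding e_def by (intro mult_left_mono) (auto simp: S_def)
  qed
  finally show ?thesis by (simp add: S_def)
qed

lemma phi_dominated:
  assumes "0 \<le> Im z" "x \<in> {0..L}"
  shows "norm (\<phi>\<^sub>1 z x) \<le> norm (\<phi>\<^sub>2 z x)" "\<phi>\<^sub>2 z x \<noteq> 0"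
proof -
  have 1: "1 \<le> (norm (\<phi>\<^sub>2 z x))\<^sup>2 - (norm (\<phi>\<^sub>1 z x))\<^sup>2"
    using energy_mono[OF solution_fundamental(2) assms(1), of 0 x] assms(2) by (simp add: fundamental_initial)
  then have "(norm (\<phi>\<^sub>1 z x))\<^sup>2 \<le> (norm (\<phi>\<^sub>2 z x))\<^sup>2" by linarith
  then show "norm (\<phi>\<^sub>1 z x) \<le> norm (\<phi>\<^sub>2 z x)" by (rule power2_le_imp_le) simp
  show "\<phi>\<^sub>2 z x \<noteq> 0"
  proof
    assume "\<phi>\<^sub>2 z x = 0"
    then show False using 1 zero_le_power2[of "norm (\<phi>\<^sub>1 z x)"] by simp
  qed
qed

text \<open>As the first component is dominated by the second, the logarithmic derivative of the square modulus of the second differs from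
  \<open>2 Im z \<rho>\<close> by at most \<open>2 |v|\<close>. The two bounds differ by a factor that does not depend on \<open>z\<close>.\<close>

lemma phi2_bounds:
  assumes "0 \<le> Im z" and x: "x \<in> {0..L}"
  shows "(norm (\<phi>\<^sub>2 z x))\<^sup>2 \<le> exp (2 * Im z * \<sigma> x + 2 * v_mass x)"
    and "exp (2 * Im z * \<sigma> x - 2 * v_mass x) \<le> (norm (\<phi>\<^sub>2 z x))\<^sup>2"
proof -
  let ?f = "\<phi>\<^sub>1 z" and ?g = "\<phi>\<^sub>2 z"
  define G' where "G' t = 2 * Im z * \<rho> t * (norm (?g t))\<^sup>2 + 2 * coupling (v t) (?f t) (?g t)" for t
  have G: "ac_primitive_on 0 L (\<lambda>x. (norm (?g x))\<^sup>2) G'"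
    unfolding G'_def by (rule norm_squares_primitive(2)[OF solution_fundamental(2)])
  have e: "ac_primitive_on 0 L (\<lambda>x. - 2 * Im z * \<sigma> x + c * v_mass x) (\<lambda>t. - 2 * Im z * \<rho> t + c * norm (v t))" for c
    by (intro ac_primitive_on_add ac_primitive_on_cmult sigma_primitive v_mass_primitive)
  note P = ac_primitive_on_mult[OF G ac_primitive_on_exp[OF e]]
  have coup: "\<bar>2 * coupling (v t) (?f t) (?g t)\<bar> \<le> 2 * norm (v t) * (norm (?g t))\<^sup>2" if "t \<in> {0<..<L}" for t
  proof -
    have "norm (?f t) * norm (?g t) \<le> (norm (?g t))\<^sup>2"
      using phi_dominated(1)[of z t] assms(1) that by (simp add: power2_eq_square mult_right_mono)
    from mult_left_mono[OF this, of "norm (v t)"]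
    show ?thesis using abs_coupling_le[of "v t" "?f t" "?g t"] by (simp add: mult_ac)
  qed
  have dP: "(norm (?g t))\<^sup>2 * (exp E * (- 2 * Im z * \<rho> t + c * norm (v t))) + G' t * exp E
      = exp E * (2 * coupling (v t) (?f t) (?g t) + c * norm (v t) * (norm (?g t))\<^sup>2)" for E c t
    by (simp add: G'_def algebra_simps)
  have mem: "AE t in lebesgue_on {0<..<L}. t \<in> {0<..<L}" by (rule AE_lebesgue_on_mem) simp
  have "(norm (?g x))\<^sup>2 * exp (- 2 * Im z * \<sigma> x + - 2 * v_mass x) \<le> (norm (?g 0))\<^sup>2 * exp (- 2 * Im z * \<sigma> 0 + - 2 * v_mass 0)"
  proof (rule ac_primitive_on_antimono[OF P])
    show "AE t in lebesgue_on {0<..<L}. (norm (?g t))\<^sup>2 * (exp (- 2 * Im z * \<sigma> t + - 2 * v_mass t) * (- 2 * Im z * \<rho> t + - 2 * norm (v t)))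
        + G' t * exp (- 2 * Im z * \<sigma> t + - 2 * v_mass t) \<le> 0"
      using mem
    proof eventually_elim
      case (elim t)
      then show ?case unfolding dP using coup[of t] by (intro mult_nonneg_nonpos) auto
    qed
  qed (use x in auto)
  then show "(norm (?g x))\<^sup>2 \<le> exp (2 * Im z * \<sigma> x + 2 * v_mass x)"
    by (simp add: at_zero fundamental_initial exp_minus exp_add exp_diff field_simps)
  have "(norm (?g 0))\<^sup>2 * exp (- 2 * Im z * \<sigma> 0 + 2 * v_mass 0) \<le> (norm (?g x))\<^sup>2 * exp (- 2 * Im z * \<sigma> x + 2 * v_mass x)"
  proof (rule ac_primitive_on_mono[OF P])
    show "AE t in lebesgue_on {0<..<L}. 0 \<le> (norm (?g t))\<^sup>2 * (exp (- 2 * Im z * \<sigma> t + 2 * v_mass t) * (- 2 * Im z * \<rho> t + 2 * norm (v t)))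
        + G' t * exp (- 2 * Im z * \<sigma> t + 2 * v_mass t)"
      using mem
    proof eventually_elim
      case (elim t)
      then show ?case unfolding dP using coup[of t] by (intro mult_nonneg_nonneg) auto
    qed
  qed (use x in auto)
  then show "exp (2 * Im z * \<sigma> x - 2 * v_mass x) \<le> (norm (?g x))\<^sup>2"
    by (simp add: at_zero fundamental_initial exp_minus exp_add exp_diff field_simps)
qed

text \<open>For \<open>|f|\<^sup>2\<close> the weight acts as damping of strength \<open>2 Im z \<rho>\<close>. By the inequality between arithmetic and
  geometric mean the damping absorbs the coupling up to \<open>|v|\<^sup>2 |g|\<^sup>2 / (2 Im z \<rho>)\<close>, whose integral is small
  compared with \<open>|g x|\<^sup>2\<close> because \<open>|v|\<^sup>2\<close> is integrable and \<open>|g|\<close> increases up to a factor independent of \<open>z\<close>.\<close>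

lemma phi1_small:
  assumes z: "0 < Im z" and x: "x \<in> {0..L}"
  shows "(norm (\<phi>\<^sub>1 z x))\<^sup>2 \<le> exp (4 * v_mass L) * v_energy L / (2 * Im z * m) * (norm (\<phi>\<^sub>2 z x))\<^sup>2"
proof -
  let ?f = "\<phi>\<^sub>1 z" and ?g = "\<phi>\<^sub>2 z"
  define C where "C = exp (2 * v_mass L) / (2 * Im z * m)"
  have "C > 0" using z m_pos by (simp add: C_def)
  have "ac_primitive_on 0 L (\<lambda>s. exp (2 * Im z * \<sigma> s)) (\<lambda>t. exp (2 * Im z * \<sigma> t) * (2 * Im z * \<rho> t))"
    by (intro ac_primitive_on_exp ac_primitive_on_cmult sigma_primitive)
  note Q = ac_primitive_on_diff[OF norm_squares_primitive(1)[OF solution_fundamental(2)]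
      ac_primitive_on_cmult[OF ac_primitive_on_mult[OF this v_energy_primitive], of C]]
  have "(norm (?f x))\<^sup>2 - C * (exp (2 * Im z * \<sigma> x) * v_energy x)
      \<le> (norm (?f 0))\<^sup>2 - C * (exp (2 * Im z * \<sigma> 0) * v_energy 0)"
  proof (rule ac_primitive_on_antimono[OF Q])
    have "AE t in lebesgue_on {0<..<L}. t \<in> {0<..<L}" by (rule AE_lebesgue_on_mem) simp
    then show "AE t in lebesgue_on {0<..<L}. - 2 * Im z * \<rho> t * (norm (?f t))\<^sup>2 + 2 * coupling (v t) (?f t) (?g t) -
        C * (exp (2 * Im z * \<sigma> t) * (norm (v t))\<^sup>2 + exp (2 * Im z * \<sigma> t) * (2 * Im z * \<rho> t) * v_energy t) \<le> 0"
    proof eventually_elim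
      case (elim t)
      then have t: "t \<in> {0..L}" by auto
      define b where "b = 2 * Im z * \<rho> t"
      have b: "b > 0" "2 * Im z * m \<le> b" using z rho_pos[of t] rho_ge[of t] by (auto simp: b_def)
      have "2 * (norm (v t) * norm (?g t)) * norm (?f t) \<le> b * (norm (?f t))\<^sup>2 + (norm (v t) * norm (?g t))\<^sup>2 / b"
      proof -
        have "0 \<le> (b * norm (?f t) - norm (v t) * norm (?g t))\<^sup>2 / b" using b by simp
        also have "\<dots> = b * (norm (?f t))\<^sup>2 + (norm (v t) * norm (?g t))\<^sup>2 / b - 2 * (norm (v t) * norm (?g t)) * norm (?f t)"
          using b(1) by (simp add: power2_eq_square field_simps)
        finally show ?thesis by simp
      qed
      moreover have "2 * coupling (v t) (?f t) (?g t) \<le> 2 * (norm (v t) * norm (?g t)) * norm (?f t)"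
        using abs_coupling_le[of "v t" "?f t" "?g t"] by (simp add: mult_ac)
      moreover have "(norm (v t) * norm (?g t))\<^sup>2 / b \<le> C * (exp (2 * Im z * \<sigma> t) * (norm (v t))\<^sup>2)"
      proof -
        have "(norm (?g t))\<^sup>2 \<le> exp (2 * Im z * \<sigma> t + 2 * v_mass t)"
          using phi2_bounds(1)[OF _ t, of z] z by simp
        also have "\<dots> \<le> exp (2 * Im z * \<sigma> t + 2 * v_mass L)"
          using bounds_at_end(4)[OF t] by simp
        finally have "(norm (v t))\<^sup>2 * (norm (?g t))\<^sup>2 / b
            \<le> (norm (v t))\<^sup>2 * exp (2 * Im z * \<sigma> t + 2 * v_mass L) / (2 * Im z * m)"
          using b z m_pos by (intro frac_le mult_left_mono) auto
        then show ?thesis by (simp add: C_def exp_add power_mult_distrib mult_ac)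
      qed
      moreover have "0 \<le> C * (exp (2 * Im z * \<sigma> t) * b * v_energy t)"
        using bounds_at_end(5)[OF t] b \<open>C > 0\<close> by simp
      ultimately show ?case by (simp add: b_def algebra_simps)
    qed
  qed (use x in auto)
  then have "(norm (?f x))\<^sup>2 \<le> C * (exp (2 * Im z * \<sigma> x) * v_energy x)"
    by (simp add: fundamental_initial at_zero)
  also have "\<dots> \<le> C * (exp (2 * v_mass L) * (norm (?g x))\<^sup>2 * v_energy L)"
  proof -
    have "exp (2 * Im z * \<sigma> x) = exp (2 * v_mass x) * exp (2 * Im z * \<sigma> x - 2 * v_mass x)"
      by (simp flip: exp_add)
    also have "\<dots> \<le> exp (2 * v_mass L) * (norm (?g x))\<^sup>2"
      using phi2_bounds(2)[OF _ x, of z] z bounds_at_end(4)[OF x] by (intro mult_mono) auto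
    finally show ?thesis
      using \<open>C > 0\<close> bounds_at_end(5,6)[OF x] by (intro mult_left_mono mult_mono) auto
  qed
  also have "\<dots> = exp (4 * v_mass L) * v_energy L / (2 * Im z * m) * (norm (?g x))\<^sup>2"
    by (simp add: C_def flip: exp_add)
  finally show ?thesis .
qed

lemma phi_contraction:
  obtains T where "0 < T" "\<And>z x. T \<le> Im z \<Longrightarrow> x \<in> {0..L} \<Longrightarrow> 2 * norm (\<phi>\<^sub>1 z x) \<le> norm (\<phi>\<^sub>2 z x)"
proof
  \<comment> \<open>Chosen so that the factor in \<open>phi1_small\<close> is at most \<open>1/4\<close>.\<close>
  define T where "T = 1 + 2 * exp (4 * v_mass L) * v_energy L / m"
  have E: "0 \<le> v_energy L" using bounds_at_end(5)[of L] L_pos by simp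
  then show "0 < T" using m_pos by (simp add: T_def add_pos_nonneg)
  fix z x assume z: "T \<le> Im z" and x: "x \<in> {0..L}"
  then have "0 < Im z" using \<open>0 < T\<close> by simp
  have zm: "2 * exp (4 * v_mass L) * v_energy L / m \<le> Im z" using z by (simp add: T_def)
  define c where "c = exp (4 * v_mass L) * v_energy L / (2 * Im z * m)"
  have "4 * c \<le> 1"
    using zm \<open>0 < Im z\<close> m_pos by (simp add: c_def field_simps)
  then have "4 * c * (norm (\<phi>\<^sub>2 z x))\<^sup>2 \<le> 1 * (norm (\<phi>\<^sub>2 z x))\<^sup>2"
    by (intro mult_right_mono) auto
  moreover have "(norm (\<phi>\<^sub>1 z x))\<^sup>2 \<le> c * (norm (\<phi>\<^sub>2 z x))\<^sup>2"
    unfolding c_def by (rule phi1_small[OF \<open>0 < Im z\<close> x])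
  ultimately have "(2 * norm (\<phi>\<^sub>1 z x))\<^sup>2 \<le> (norm (\<phi>\<^sub>2 z x))\<^sup>2"
    by (simp add: power_mult_distrib)
  then show "2 * norm (\<phi>\<^sub>1 z x) \<le> norm (\<phi>\<^sub>2 z x)" by (rule power2_le_imp_le) simp
qed

text \<open>Take a solution \<open>\<theta> + w \<phi>\<close> that satisfies \<open>|g| \<le> |f|\<close> at the right end. Monotonicity of the energy
  propagates this to the left, and in the Wronskian \<open>f \<phi>\<^sub>2 - \<phi>\<^sub>1 g = 1\<close> the second product has at most half the modulus
  of the first.\<close>

lemma subordinate_bounds:
  assumes z: "0 \<le> Im z" and small: "2 * norm (\<phi>\<^sub>1 z x) \<le> norm (\<phi>\<^sub>2 z x)" and x: "x \<in> {0..L}"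
    and end_le: "norm (\<theta>\<^sub>2 z L + w * \<phi>\<^sub>2 z L) \<le> norm (\<theta>\<^sub>1 z L + w * \<phi>\<^sub>1 z L)"
  shows "norm (\<phi>\<^sub>2 z x) * norm (\<theta>\<^sub>1 z x + w * \<phi>\<^sub>1 z x) \<le> 2"
    and "norm (\<theta>\<^sub>2 z x + w * \<phi>\<^sub>2 z x) \<le> norm (\<theta>\<^sub>1 z x + w * \<phi>\<^sub>1 z x)"
proof -
  define f where "f x = \<theta>\<^sub>1 z x + w * \<phi>\<^sub>1 z x" for x
  define g where "g x = \<theta>\<^sub>2 z x + w * \<phi>\<^sub>2 z x" for x
  have sol: "solution z f g"
    using solution_combination[OF solution_fundamental, of z 1 w] by (simp add: f_def[abs_def] g_def[abs_def])
  have "(norm (g x))\<^sup>2 - (norm (f x))\<^sup>2 \<le> (norm (g L))\<^sup>2 - (norm (f L))\<^sup>2"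
    using energy_mono[OF sol z, of x L] x by simp
  also have "\<dots> \<le> 0" using end_le by (simp add: f_def g_def)
  finally have "(norm (g x))\<^sup>2 \<le> (norm (f x))\<^sup>2" by linarith
  then show le: "norm (\<theta>\<^sub>2 z x + w * \<phi>\<^sub>2 z x) \<le> norm (\<theta>\<^sub>1 z x + w * \<phi>\<^sub>1 z x)"
    unfolding f_def g_def by (rule power2_le_imp_le) simp
  have "(\<theta>\<^sub>1 z x + w * \<phi>\<^sub>1 z x) * \<phi>\<^sub>2 z x - \<phi>\<^sub>1 z x * (\<theta>\<^sub>2 z x + w * \<phi>\<^sub>2 z x) = 1"
    using fundamental_det[OF x, of z] by (simp add: algebra_simps)
  then have "f x * \<phi>\<^sub>2 z x = 1 + \<phi>\<^sub>1 z x * g x" by (simp add: f_def g_def algebra_simps)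
  then have "norm (f x * \<phi>\<^sub>2 z x) \<le> 1 + norm (\<phi>\<^sub>1 z x * g x)"
    by (metis norm_one norm_triangle_ineq)
  then have "norm (f x) * norm (\<phi>\<^sub>2 z x) \<le> 1 + norm (\<phi>\<^sub>1 z x) * norm (g x)"
    by (simp add: norm_mult)
  moreover have "norm (\<phi>\<^sub>1 z x) * norm (g x) \<le> norm (\<phi>\<^sub>2 z x) / 2 * norm (f x)"
    using small le by (intro mult_mono) (auto simp: f_def g_def)
  ultimately show "norm (\<phi>\<^sub>2 z x) * norm (\<theta>\<^sub>1 z x + w * \<phi>\<^sub>1 z x) \<le> 2"
    by (simp add: f_def algebra_simps)
qed

end

section \<open>Two potentials with a common weight\<close>

locale canonical_system_pair =
  S: canonical_system L m \<rho> v + T: canonical_system L m \<rho> u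
  for L m :: real and \<rho> :: "real \<Rightarrow> real" and v u :: "real \<Rightarrow> complex"
begin

text \<open>The entries of \<open>Y Y~\<^sup>-\<^sup>1\<close>, where \<open>Y\<close>, \<open>Y~\<close> are the fundamental matrices with columns \<open>\<theta>\<close>, \<open>\<phi>\<close> for the potentials
  \<open>v\<close>, \<open>u\<close>; the determinant of \<open>Y~\<close> is \<open>1\<close>.\<close>
definition "P\<^sub>1\<^sub>1 z x = S.\<theta>\<^sub>1 z x * T.\<phi>\<^sub>2 z x - S.\<phi>\<^sub>1 z x * T.\<theta>\<^sub>2 z x"
definition "P\<^sub>1\<^sub>2 z x = S.\<phi>\<^sub>1 z x * T.\<theta>\<^sub>1 z x - S.\<theta>\<^sub>1 z x * T.\<phi>\<^sub>1 z x"
definition "P\<^sub>2\<^sub>1 z x = S.\<theta>\<^sub>2 z x * T.\<phi>\<^sub>2 z x - S.\<phi>\<^sub>2 z x * T.\<theta>\<^sub>2 z x"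
definition "P\<^sub>2\<^sub>2 z x = S.\<phi>\<^sub>2 z x * T.\<theta>\<^sub>1 z x - S.\<theta>\<^sub>2 z x * T.\<phi>\<^sub>1 z x"

lemmas P_defs = P\<^sub>1\<^sub>1_def P\<^sub>1\<^sub>2_def P\<^sub>2\<^sub>1_def P\<^sub>2\<^sub>2_def

lemma P_initial: "P\<^sub>1\<^sub>1 z 0 = 1" "P\<^sub>1\<^sub>2 z 0 = 0" "P\<^sub>2\<^sub>1 z 0 = 0" "P\<^sub>2\<^sub>2 z 0 = 1"
  by (simp_all add: P_defs S.fundamental_initial T.fundamental_initial)

lemma P_holomorphic:
  assumes "x \<in> {0..L}"
  shows "(\<lambda>z. P\<^sub>1\<^sub>1 z x) holomorphic_on UNIV" "(\<lambda>z. P\<^sub>1\<^sub>2 z x) holomorphic_on UNIV"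
    "(\<lambda>z. P\<^sub>2\<^sub>1 z x) holomorphic_on UNIV" "(\<lambda>z. P\<^sub>2\<^sub>2 z x) holomorphic_on UNIV"
  unfolding P_defs
  by (intro holomorphic_intros S.fundamental_holomorphic[OF assms] T.fundamental_holomorphic[OF assms])+

lemma P_cnj:
  assumes "x \<in> {0..L}"
  shows "P\<^sub>1\<^sub>1 (cnj z) x = cnj (P\<^sub>2\<^sub>2 z x)" "P\<^sub>1\<^sub>2 (cnj z) x = cnj (P\<^sub>2\<^sub>1 z x)"
    "P\<^sub>2\<^sub>1 (cnj z) x = cnj (P\<^sub>1\<^sub>2 z x)" "P\<^sub>2\<^sub>2 (cnj z) x = cnj (P\<^sub>1\<^sub>1 z x)"
  unfolding P_defs S.fundamental_cnj[OF assms] T.fundamental_cnj[OF assms]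
  by (simp_all add: algebra_simps)

text \<open>Since both systems have the same weight, the spectral parameter drops out of the equations for the diagonal entries.\<close>

lemma P_primitive:
  shows "ac_primitive_on 0 L (P\<^sub>1\<^sub>1 z) (\<lambda>t. v t * P\<^sub>2\<^sub>1 z t - cnj (u t) * P\<^sub>1\<^sub>2 z t)"
    and "ac_primitive_on 0 L (P\<^sub>2\<^sub>2 z) (\<lambda>t. cnj (v t) * P\<^sub>1\<^sub>2 z t - u t * P\<^sub>2\<^sub>1 z t)"
    and "ac_primitive_on 0 L (P\<^sub>1\<^sub>2 z) (\<lambda>t. 2 * \<i> * z * \<rho> t * P\<^sub>1\<^sub>2 z t + (v t * P\<^sub>2\<^sub>2 z t - u t * P\<^sub>1\<^sub>1 z t))"
    and "ac_primitive_on 0 L (P\<^sub>2\<^sub>1 z) (\<lambda>t. - 2 * \<i> * z * \<rho> t * P\<^sub>2\<^sub>1 z t + (cnj (v t) * P\<^sub>1\<^sub>1 z t - cnj (u t) * P\<^sub>2\<^sub>2 z t))"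
proof -
  note s = S.solution_fundamental[of z, unfolded S.solution_def]
  note t = T.solution_fundamental[of z, unfolded T.solution_def]
  note r = ac_primitive_on_diff[OF ac_primitive_on_mult ac_primitive_on_mult]
  note s1 = conjunct1[OF s(1)] and s2 = conjunct2[OF s(1)] and s3 = conjunct1[OF s(2)] and s4 = conjunct2[OF s(2)]
  note t1 = conjunct1[OF t(1)] and t2 = conjunct2[OF t(1)] and t3 = conjunct1[OF t(2)] and t4 = conjunct2[OF t(2)]
  have eq: "ac_primitive_on 0 L f f' \<Longrightarrow> (\<And>t. f' t = g' t) \<Longrightarrow> ac_primitive_on 0 L f g'" for f :: "real \<Rightarrow> complex" and f' g'
    by (metis ext)
  show "ac_primitive_on 0 L (P\<^sub>1\<^sub>1 z) (\<lambda>t. v t * P\<^sub>2\<^sub>1 z t - cnj (u t) * P\<^sub>1\<^sub>2 z t)"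
    unfolding P_defs by (rule eq[OF r[OF s1 t4 s3 t2]]) (simp add: algebra_simps)
  show "ac_primitive_on 0 L (P\<^sub>2\<^sub>2 z) (\<lambda>t. cnj (v t) * P\<^sub>1\<^sub>2 z t - u t * P\<^sub>2\<^sub>1 z t)"
    unfolding P_defs by (rule eq[OF r[OF s4 t1 s2 t3]]) (simp add: algebra_simps)
  show "ac_primitive_on 0 L (P\<^sub>1\<^sub>2 z) (\<lambda>t. 2 * \<i> * z * \<rho> t * P\<^sub>1\<^sub>2 z t + (v t * P\<^sub>2\<^sub>2 z t - u t * P\<^sub>1\<^sub>1 z t))"
    unfolding P_defs by (rule eq[OF r[OF s3 t1 s1 t3]]) (simp add: algebra_simps)
  show "ac_primitive_on 0 L (P\<^sub>2\<^sub>1 z) (\<lambda>t. - 2 * \<i> * z * \<rho> t * P\<^sub>2\<^sub>1 z t + (cnj (v t) * P\<^sub>1\<^sub>1 z t - cnj (u t) * P\<^sub>2\<^sub>2 z t))"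
    unfolding P_defs by (rule eq[OF r[OF s2 t4 s4 t2]]) (simp add: algebra_simps)
qed

lemma phi2_comparable:
  assumes "0 \<le> Im z" "x \<in> {0..L}"
  shows "norm (S.\<phi>\<^sub>2 z x) \<le> exp (S.v_mass L + T.v_mass L) * norm (T.\<phi>\<^sub>2 z x)"
proof (rule power2_le_imp_le)
  have "(norm (S.\<phi>\<^sub>2 z x))\<^sup>2 \<le> exp (2 * Im z * S.\<sigma> x + 2 * S.v_mass x)"
    by (rule S.phi2_bounds(1)[OF assms])
  also have "\<dots> = exp (2 * (S.v_mass x + T.v_mass x)) * exp (2 * Im z * T.\<sigma> x - 2 * T.v_mass x)"
    by (simp add: S.\<sigma>_def T.\<sigma>_def algebra_simps flip: exp_add)
  also have "\<dots> \<le> exp (2 * (S.v_mass L + T.v_mass L)) * (norm (T.\<phi>\<^sub>2 z x))\<^sup>2"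
    using T.phi2_bounds(2)[OF assms] S.bounds_at_end(4)[OF assms(2)] T.bounds_at_end(4)[OF assms(2)]
    by (intro mult_mono) auto
  finally show "(norm (S.\<phi>\<^sub>2 z x))\<^sup>2 \<le> (exp (S.v_mass L + T.v_mass L) * norm (T.\<phi>\<^sub>2 z x))\<^sup>2"
    by (simp only: power_mult_distrib exp_double)
qed simp

lemma pair_swap: "canonical_system_pair L m \<rho> u v"
  by (intro canonical_system_pair.intro S.canonical_system_axioms T.canonical_system_axioms)

text \<open>The hypothesis says that some \<open>w\<close> gives for both potentials a solution \<open>\<theta> + w \<phi>\<close> that is
  subordinate at the right end; for equal Weyl functions these are multiples of the Weyl solutions. Replacing \<open>\<theta>\<close>
  by \<open>\<theta> + w \<phi>\<close> in both fundamental matrices, with the same \<open>w\<close>, does not change \<open>P\<close>.\<close>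

lemma P_bounded_upper:
  assumes weyl: "\<And>z. 0 < Im z \<Longrightarrow> \<exists>w.
      norm (S.\<theta>\<^sub>2 z L + w * S.\<phi>\<^sub>2 z L) \<le> norm (S.\<theta>\<^sub>1 z L + w * S.\<phi>\<^sub>1 z L) \<and>
      norm (T.\<theta>\<^sub>2 z L + w * T.\<phi>\<^sub>2 z L) \<le> norm (T.\<theta>\<^sub>1 z L + w * T.\<phi>\<^sub>1 z L)"
  obtains T B where "0 < T" "\<And>z x. T \<le> Im z \<Longrightarrow> x \<in> {0..L} \<Longrightarrow>
    norm (P\<^sub>1\<^sub>1 z x) \<le> B \<and> norm (P\<^sub>1\<^sub>2 z x) \<le> B \<and> norm (P\<^sub>2\<^sub>1 z x) \<le> B \<and> norm (P\<^sub>2\<^sub>2 z x) \<le> B"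
proof -
  obtain T1 where T1: "0 < T1" "\<And>z x. T1 \<le> Im z \<Longrightarrow> x \<in> {0..L} \<Longrightarrow> 2 * norm (S.\<phi>\<^sub>1 z x) \<le> norm (S.\<phi>\<^sub>2 z x)"
    using S.phi_contraction by blast
  obtain T2 where T2: "0 < T2" "\<And>z x. T2 \<le> Im z \<Longrightarrow> x \<in> {0..L} \<Longrightarrow> 2 * norm (T.\<phi>\<^sub>1 z x) \<le> norm (T.\<phi>\<^sub>2 z x)"
    using T.phi_contraction by blast
  define k where "k = exp (S.v_mass L + T.v_mass L)"
  have "k > 0" by (simp add: k_def)
  have "norm (P\<^sub>1\<^sub>1 z x) \<le> 4 * k \<and> norm (P\<^sub>1\<^sub>2 z x) \<le> 4 * k \<and> norm (P\<^sub>2\<^sub>1 z x) \<le> 4 * k \<and> norm (P\<^sub>2\<^sub>2 z x) \<le> 4 * k"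
    if z: "max T1 T2 \<le> Im z" and x: "x \<in> {0..L}" for z x
  proof -
    have z0: "0 < Im z" "0 \<le> Im z" using z T1(1) by auto
    obtain w where w: "norm (S.\<theta>\<^sub>2 z L + w * S.\<phi>\<^sub>2 z L) \<le> norm (S.\<theta>\<^sub>1 z L + w * S.\<phi>\<^sub>1 z L)"
      "norm (T.\<theta>\<^sub>2 z L + w * T.\<phi>\<^sub>2 z L) \<le> norm (T.\<theta>\<^sub>1 z L + w * T.\<phi>\<^sub>1 z L)"
      using weyl[OF z0(1)] by blast
    have small: "2 * norm (S.\<phi>\<^sub>1 z x) \<le> norm (S.\<phi>\<^sub>2 z x)" "2 * norm (T.\<phi>\<^sub>1 z x) \<le> norm (T.\<phi>\<^sub>2 z x)"
      using T1(2)[OF _ x] T2(2)[OF _ x] z by auto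
    \<comment> \<open>The subordinate solutions for \<open>v\<close> and for \<open>u\<close> at \<open>x\<close>.\<close>
    define X1 where "X1 = S.\<theta>\<^sub>1 z x + w * S.\<phi>\<^sub>1 z x"
    define X2 where "X2 = S.\<theta>\<^sub>2 z x + w * S.\<phi>\<^sub>2 z x"
    define Y1 where "Y1 = T.\<theta>\<^sub>1 z x + w * T.\<phi>\<^sub>1 z x"
    define Y2 where "Y2 = T.\<theta>\<^sub>2 z x + w * T.\<phi>\<^sub>2 z x"
    define F where "F = norm (S.\<phi>\<^sub>2 z x)"
    define G where "G = norm (T.\<phi>\<^sub>2 z x)"
    have XY: "F * norm X1 \<le> 2" "norm X2 \<le> norm X1" "G * norm Y1 \<le> 2" "norm Y2 \<le> norm Y1"
      using S.subordinate_bounds[OF z0(2) small(1) x w(1)] T.subordinate_bounds[OF z0(2) small(2) x w(2)]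
      by (simp_all add: X1_def X2_def Y1_def Y2_def F_def G_def)
    have FG: "F \<le> k * G" "G \<le> k * F"
      using phi2_comparable[OF z0(2) x] canonical_system_pair.phi2_comparable[OF pair_swap z0(2) x]
      by (simp_all add: F_def G_def k_def add.commute)
    have le: "norm (a * b - c * d) \<le> 4 * k"
      if "norm a \<le> norm X1" "norm b \<le> G" "norm c \<le> F" "norm d \<le> norm Y1" for a b c d :: complex
    proof -
      have "norm (a * b - c * d) \<le> norm a * norm b + norm c * norm d"
        using norm_triangle_ineq4[of "a * b" "c * d"] by (simp add: norm_mult)
      also have "\<dots> \<le> norm X1 * G + F * norm Y1"
        using that by (intro add_mono mult_mono) (auto simp: F_def G_def)
      also have "\<dots> \<le> norm X1 * (k * F) + (k * G) * norm Y1"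
        using FG by (intro add_mono mult_left_mono mult_right_mono) auto
      also have "\<dots> = k * (F * norm X1 + G * norm Y1)" by (simp add: algebra_simps)
      also have "\<dots> \<le> k * (2 + 2)" using XY(1,3) \<open>k > 0\<close> by (intro mult_left_mono add_mono) auto
      finally show ?thesis by simp
    qed
    have ph: "norm (S.\<phi>\<^sub>1 z x) \<le> F" "norm (S.\<phi>\<^sub>2 z x) \<le> F" "norm (T.\<phi>\<^sub>1 z x) \<le> G" "norm (T.\<phi>\<^sub>2 z x) \<le> G"
      using S.phi_dominated(1)[OF z0(2) x] T.phi_dominated(1)[OF z0(2) x] by (simp_all add: F_def G_def)
    have "P\<^sub>1\<^sub>1 z x = X1 * T.\<phi>\<^sub>2 z x - S.\<phi>\<^sub>1 z x * Y2" "P\<^sub>1\<^sub>2 z x = - (X1 * T.\<phi>\<^sub>1 z x - S.\<phi>\<^sub>1 z x * Y1)"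
      "P\<^sub>2\<^sub>1 z x = X2 * T.\<phi>\<^sub>2 z x - S.\<phi>\<^sub>2 z x * Y2" "P\<^sub>2\<^sub>2 z x = - (X2 * T.\<phi>\<^sub>1 z x - S.\<phi>\<^sub>2 z x * Y1)"
      by (simp_all add: P_defs X1_def X2_def Y1_def Y2_def algebra_simps)
    then show ?thesis
      by (simp only: norm_minus_cancel) (intro conjI le; use XY(2,4) ph in simp)
  qed
  then show ?thesis using that[of "max T1 T2" "4 * k"] T1(1) by auto
qed

lemma P_bounded_strip:
  assumes "\<bar>Im z\<bar> \<le> T" "x \<in> {0..L}"
  defines "B \<equiv> 2 * exp (2 * T * S.\<sigma> L + S.v_mass L + T.v_mass L)"
  shows "norm (P\<^sub>1\<^sub>1 z x) \<le> B \<and> norm (P\<^sub>1\<^sub>2 z x) \<le> B \<and> norm (P\<^sub>2\<^sub>1 z x) \<le> B \<and> norm (P\<^sub>2\<^sub>2 z x) \<le> B"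
proof -
  define e where "e = exp (T * S.\<sigma> L + S.v_mass L)"
  define e' where "e' = exp (T * S.\<sigma> L + T.v_mass L)"
  have "0 \<le> S.\<sigma> L" using S.bounds_at_end(1)[of L] S.L_pos by simp
  then have E: "exp (2 * \<bar>Im z\<bar> * S.\<sigma> L + 2 * S.v_mass L) \<le> e\<^sup>2" "exp (2 * \<bar>Im z\<bar> * S.\<sigma> L + 2 * T.v_mass L) \<le> e'\<^sup>2"
    using assms(1) by (simp_all add: e_def e'_def mult_right_mono flip: exp_double)
  have comp: "norm f \<le> r" "norm g \<le> r" if "(norm f)\<^sup>2 + (norm g)\<^sup>2 \<le> r\<^sup>2" "0 \<le> r" for f g :: complex and r
  proof -
    have "(norm f)\<^sup>2 \<le> r\<^sup>2" "(norm g)\<^sup>2 \<le> r\<^sup>2"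
      using that(1) zero_le_power2[of "norm f"] zero_le_power2[of "norm g"] by linarith+
    then show "norm f \<le> r" "norm g \<le> r" using that(2) power2_le_imp_le by blast+
  qed
  have ee: "0 \<le> e" "0 \<le> e'" by (simp_all add: e_def e'_def)
  note g = order_trans[OF S.solution_growth[OF S.solution_fundamental(1) assms(2), of z]]
    order_trans[OF S.solution_growth[OF S.solution_fundamental(2) assms(2), of z]]
    order_trans[OF T.solution_growth[OF T.solution_fundamental(1) assms(2), of z]]
    order_trans[OF T.solution_growth[OF T.solution_fundamental(2) assms(2), of z]]
  have b1: "(norm (S.\<theta>\<^sub>1 z x))\<^sup>2 + (norm (S.\<theta>\<^sub>2 z x))\<^sup>2 \<le> e\<^sup>2"
    by (rule g(1)) (use E in \<open>simp add: S.fundamental_initial\<close>)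
  have b2: "(norm (S.\<phi>\<^sub>1 z x))\<^sup>2 + (norm (S.\<phi>\<^sub>2 z x))\<^sup>2 \<le> e\<^sup>2"
    by (rule g(2)) (use E in \<open>simp add: S.fundamental_initial\<close>)
  have b3: "(norm (T.\<theta>\<^sub>1 z x))\<^sup>2 + (norm (T.\<theta>\<^sub>2 z x))\<^sup>2 \<le> e'\<^sup>2"
    by (rule g(3)) (use E in \<open>simp add: T.fundamental_initial\<close>)
  have b4: "(norm (T.\<phi>\<^sub>1 z x))\<^sup>2 + (norm (T.\<phi>\<^sub>2 z x))\<^sup>2 \<le> e'\<^sup>2"
    by (rule g(4)) (use E in \<open>simp add: T.fundamental_initial\<close>)
  note bd = comp[OF b1 ee(1)] comp[OF b2 ee(1)] comp[OF b3 ee(2)] comp[OF b4 ee(2)]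
  have le: "norm (a * b - c * d) \<le> B"
    if "norm a \<le> e" "norm b \<le> e'" "norm c \<le> e" "norm d \<le> e'" for a b c d :: complex
  proof -
    have "norm (a * b - c * d) \<le> norm a * norm b + norm c * norm d"
      using norm_triangle_ineq4[of "a * b" "c * d"] by (simp add: norm_mult)
    also have "\<dots> \<le> e * e' + e * e'"
      using that ee by (intro add_mono mult_mono) auto
    also have "\<dots> = B" by (simp add: B_def e_def e'_def algebra_simps flip: exp_add)
    finally show ?thesis .
  qed
  show ?thesis unfolding P_defs using bd by (intro conjI le)
qed

lemma P_independent_of_parameter:
  assumes weyl: "\<And>z. 0 < Im z \<Longrightarrow> \<exists>w.
      norm (S.\<theta>\<^sub>2 z L + w * S.\<phi>\<^sub>2 z L) \<le> norm (S.\<theta>\<^sub>1 z L + w * S.\<phi>\<^sub>1 z L) \<and>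
      norm (T.\<theta>\<^sub>2 z L + w * T.\<phi>\<^sub>2 z L) \<le> norm (T.\<theta>\<^sub>1 z L + w * T.\<phi>\<^sub>1 z L)"
    and x: "x \<in> {0..L}"
  shows "P\<^sub>1\<^sub>1 z x = P\<^sub>1\<^sub>1 0 x" "P\<^sub>1\<^sub>2 z x = P\<^sub>1\<^sub>2 0 x" "P\<^sub>2\<^sub>1 z x = P\<^sub>2\<^sub>1 0 x" "P\<^sub>2\<^sub>2 z x = P\<^sub>2\<^sub>2 0 x"
proof -
  obtain T B where T: "0 < T" "\<And>z. T \<le> Im z \<Longrightarrow>
    norm (P\<^sub>1\<^sub>1 z x) \<le> B \<and> norm (P\<^sub>1\<^sub>2 z x) \<le> B \<and> norm (P\<^sub>2\<^sub>1 z x) \<le> B \<and> norm (P\<^sub>2\<^sub>2 z x) \<le> B"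
    using P_bounded_upper[OF weyl] x by metis
  obtain B' where B': "\<And>z. \<bar>Im z\<bar> \<le> T \<Longrightarrow>
    norm (P\<^sub>1\<^sub>1 z x) \<le> B' \<and> norm (P\<^sub>1\<^sub>2 z x) \<le> B' \<and> norm (P\<^sub>2\<^sub>1 z x) \<le> B' \<and> norm (P\<^sub>2\<^sub>2 z x) \<le> B'"
    using P_bounded_strip[OF _ x] by metis
  have lower: "norm (P\<^sub>1\<^sub>1 z x) \<le> B \<and> norm (P\<^sub>1\<^sub>2 z x) \<le> B \<and> norm (P\<^sub>2\<^sub>1 z x) \<le> B \<and> norm (P\<^sub>2\<^sub>2 z x) \<le> B"
    if "Im z \<le> - T" for z
    using T(2)[of "cnj z"] that unfolding P_cnj[OF x] by simp
  have all: "norm (P\<^sub>1\<^sub>1 z x) \<le> max B B' \<and> norm (P\<^sub>1\<^sub>2 z x) \<le> max B B' \<and> norm (P\<^sub>2\<^sub>1 z x) \<le> max B B' \<and> norm (P\<^sub>2\<^sub>2 z x) \<le> max B B'" for z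
  proof -
    consider "T \<le> Im z" | "Im z \<le> - T" | "\<bar>Im z\<bar> \<le> T" by linarith
    then show ?thesis using T(2)[of z] lower[of z] B'[of z] by cases (auto simp: le_max_iff_disj)
  qed
  have const: "f z = f 0" if "f holomorphic_on UNIV" "\<And>z. norm (f z) \<le> max B B'" for f :: "complex \<Rightarrow> complex"
  proof -
    have "bounded (range f)" using that(2) by (auto simp: bounded_iff)
    then show ?thesis using Liouville_theorem[OF that(1)] unfolding constant_on_def by auto
  qed
  show "P\<^sub>1\<^sub>1 z x = P\<^sub>1\<^sub>1 0 x" by (rule const[OF P_holomorphic(1)[OF x]]) (use all in blast)
  show "P\<^sub>1\<^sub>2 z x = P\<^sub>1\<^sub>2 0 x" by (rule const[OF P_holomorphic(2)[OF x]]) (use all in blast)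
  show "P\<^sub>2\<^sub>1 z x = P\<^sub>2\<^sub>1 0 x" by (rule const[OF P_holomorphic(3)[OF x]]) (use all in blast)
  show "P\<^sub>2\<^sub>2 z x = P\<^sub>2\<^sub>2 0 x" by (rule const[OF P_holomorphic(4)[OF x]]) (use all in blast)
qed

text \<open>Comparing the derivatives of \<open>P\<^sub>1\<^sub>2\<close> and \<open>P\<^sub>2\<^sub>1\<close> at the parameters \<open>0\<close> and \<open>1\<close>, where these entries agree, shows that they
  vanish. Then the diagonal entries are constant, and the remaining equation for \<open>P\<^sub>1\<^sub>2 = 0\<close> reads \<open>0 = v - u\<close>.\<close>

lemma potentials_equal:
  assumes weyl: "\<And>z. 0 < Im z \<Longrightarrow> \<exists>w.
      norm (S.\<theta>\<^sub>2 z L + w * S.\<phi>\<^sub>2 z L) \<le> norm (S.\<theta>\<^sub>1 z L + w * S.\<phi>\<^sub>1 z L) \<and>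
      norm (T.\<theta>\<^sub>2 z L + w * T.\<phi>\<^sub>2 z L) \<le> norm (T.\<theta>\<^sub>1 z L + w * T.\<phi>\<^sub>1 z L)"
  shows "AE x in lebesgue_on {0<..<L}. v x = u x"
proof -
  note ind = P_independent_of_parameter[OF weyl]
  have mem: "AE t in lebesgue_on {0<..<L}. t \<in> {0<..<L}" by (rule AE_lebesgue_on_mem) simp
  have "AE t in lebesgue_on {0<..<L}. 2 * \<i> * 1 * \<rho> t * P\<^sub>1\<^sub>2 1 t + (v t * P\<^sub>2\<^sub>2 1 t - u t * P\<^sub>1\<^sub>1 1 t)
      = 2 * \<i> * 0 * \<rho> t * P\<^sub>1\<^sub>2 0 t + (v t * P\<^sub>2\<^sub>2 0 t - u t * P\<^sub>1\<^sub>1 0 t)"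
    by (rule ac_primitive_on_unique[OF P_primitive(3) ac_primitive_on_cong[OF P_primitive(3)]]) (simp add: ind(2)[of _ 1])
  with mem have z12: "AE t in lebesgue_on {0<..<L}. P\<^sub>1\<^sub>2 0 t = 0"
  proof eventually_elim
    case (elim t)
    then show ?case using ind[of t 1] S.rho_pos[of t] by auto
  qed
  have "AE t in lebesgue_on {0<..<L}. - 2 * \<i> * 1 * \<rho> t * P\<^sub>2\<^sub>1 1 t + (cnj (v t) * P\<^sub>1\<^sub>1 1 t - cnj (u t) * P\<^sub>2\<^sub>2 1 t)
      = - 2 * \<i> * 0 * \<rho> t * P\<^sub>2\<^sub>1 0 t + (cnj (v t) * P\<^sub>1\<^sub>1 0 t - cnj (u t) * P\<^sub>2\<^sub>2 0 t)"
    by (rule ac_primitive_on_unique[OF P_primitive(4) ac_primitive_on_cong[OF P_primitive(4)]]) (simp add: ind(3)[of _ 1])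
  with mem have z21: "AE t in lebesgue_on {0<..<L}. P\<^sub>2\<^sub>1 0 t = 0"
  proof eventually_elim
    case (elim t)
    then show ?case using ind[of t 1] S.rho_pos[of t] by auto
  qed
  have "P\<^sub>1\<^sub>1 0 x = P\<^sub>1\<^sub>1 0 0" if "x \<in> {0..L}" for x
  proof (rule ac_primitive_on_zero_imp_const[OF P_primitive(1)])
    show "AE t in lebesgue_on {0<..<L}. v t * P\<^sub>2\<^sub>1 0 t - cnj (u t) * P\<^sub>1\<^sub>2 0 t = 0"
      using z12 z21 by eventually_elim simp
  qed (use that in auto)
  then have one11: "P\<^sub>1\<^sub>1 0 x = 1" if "x \<in> {0..L}" for x using that by (simp add: P_initial)
  have "P\<^sub>2\<^sub>2 0 x = P\<^sub>2\<^sub>2 0 0" if "x \<in> {0..L}" for x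
  proof (rule ac_primitive_on_zero_imp_const[OF P_primitive(2)])
    show "AE t in lebesgue_on {0<..<L}. cnj (v t) * P\<^sub>1\<^sub>2 0 t - u t * P\<^sub>2\<^sub>1 0 t = 0"
      using z12 z21 by eventually_elim simp
  qed (use that in auto)
  then have one22: "P\<^sub>2\<^sub>2 0 x = 1" if "x \<in> {0..L}" for x using that by (simp add: P_initial)
  have "P\<^sub>1\<^sub>2 0 x = 0" if "x \<in> {0..L}" for x
    by (rule ac_primitive_on_zero_AE_imp_zero[OF P_primitive(3) _ z12 that]) (simp add: P_initial)
  then have "ac_primitive_on 0 L (P\<^sub>1\<^sub>2 0) (\<lambda>t. 0)"
    by (intro ac_primitive_on_cong[OF ac_primitive_on_const]) simp
  from ac_primitive_on_unique[OF P_primitive(3) this] mem show ?thesis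
  proof eventually_elim
    case (elim t)
    then show ?case by (simp add: one11 one22)
  qed
qed

end

section \<open>The Dirac problem\<close>

text \<open>A boundary condition that is linear in the spectral parameter \<open>z\<close> fixes the sign of the energy at that
  end, according to the sign of the determinant of its coefficients.\<close>

lemma boundary_form:
  fixes y1 y2 z :: complex and k1 k2 k3 k4 :: real
  assumes "of_real k1 * y2 + of_real k2 * y1 = z * (of_real k3 * y2 + of_real k4 * y1)"
  shows "(k1 * k4 - k2 * k3) * Im (y2 * cnj y1) = Im z * (norm (of_real k3 * y2 + of_real k4 * y1))\<^sup>2"
proof -
  let ?V = "of_real k3 * y2 + of_real k4 * y1"
  have "(k1 * k4 - k2 * k3) * Im (y2 * cnj y1) = Im ((of_real k1 * y2 + of_real k2 * y1) * cnj ?V)"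
    by (simp add: algebra_simps)
  also have "\<dots> = Im (z * (?V * cnj ?V))" unfolding assms by (simp add: mult.assoc)
  also have "\<dots> = Im z * (norm ?V)\<^sup>2"
    unfolding complex_norm_square[symmetric] by simp
  finally show ?thesis .
qed

lemma norm_square_conjugate_coordinates:
  fixes y1 y2 :: complex
  shows "(norm (y1 - \<i> * y2))\<^sup>2 - (norm (y1 + \<i> * y2))\<^sup>2 = 4 * Im (y2 * cnj y1)"
  unfolding cmod_power2 by (simp add: power2_eq_square algebra_simps)

lemma dirac_equation_iff:
  fixes y y' :: "complex^2"
  shows "Bmat *v y' + Omega p q x *v y = c *s y \<longleftrightarrow>
    y' $ 1 + \<i> * y' $ 2 = \<i> * c * (y $ 1 + \<i> * y $ 2) + (q x - \<i> * p x) * (y $ 1 - \<i> * y $ 2) \<and>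
    y' $ 1 - \<i> * y' $ 2 = - \<i> * c * (y $ 1 - \<i> * y $ 2) + (q x + \<i> * p x) * (y $ 1 + \<i> * y $ 2)"
  (is "?L \<longleftrightarrow> ?P \<and> ?Q")
proof -
  \<comment> \<open>The conjugate combinations of the residuals \<open>l1\<close>, \<open>l2\<close> of the two scalar equations.\<close>
  define l1 where "l1 = y' $ 2 + p x * y $ 1 + q x * y $ 2 - c * y $ 1"
  define l2 where "l2 = - y' $ 1 + q x * y $ 1 - p x * y $ 2 - c * y $ 2"
  have "?L \<longleftrightarrow> l1 = 0 \<and> l2 = 0"
    by (simp add: l1_def l2_def vec_eq_iff forall_2 Bmat_def Omega_def matrix_vector_mult_def sum_2 algebra_simps)
  also have "\<dots> \<longleftrightarrow> - l2 + \<i> * l1 = 0 \<and> - l2 - \<i> * l1 = 0"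
  proof
    assume eq: "- l2 + \<i> * l1 = 0 \<and> - l2 - \<i> * l1 = 0"
    have "2 * l2 = - (- l2 + \<i> * l1) - (- l2 - \<i> * l1)" "2 * \<i> * l1 = (- l2 + \<i> * l1) - (- l2 - \<i> * l1)"
      by simp_all
    then show "l1 = 0 \<and> l2 = 0" unfolding conjunct1[OF eq] conjunct2[OF eq] by simp
  qed simp
  also have "- l2 + \<i> * l1 = (y' $ 1 + \<i> * y' $ 2) - (\<i> * c * (y $ 1 + \<i> * y $ 2) + (q x - \<i> * p x) * (y $ 1 - \<i> * y $ 2))"
    by (simp add: l1_def l2_def algebra_simps)
  also have "- l2 - \<i> * l1 = (y' $ 1 - \<i> * y' $ 2) - (- \<i> * c * (y $ 1 - \<i> * y $ 2) + (q x + \<i> * p x) * (y $ 1 + \<i> * y $ 2))"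
    by (simp add: l1_def l2_def algebra_simps)
  finally show ?thesis unfolding right_minus_eq .
qed

definition from_conjugate_coordinates :: "complex \<Rightarrow> complex \<Rightarrow> complex^2" where
  "from_conjugate_coordinates f g = vector [(f + g) / 2, (f - g) / (2 * \<i>)]"

lemma from_conjugate_coordinates_nth [simp]:
  "from_conjugate_coordinates f g $ 1 = (f + g) / 2"
  "from_conjugate_coordinates f g $ 2 = (f - g) / (2 * \<i>)"
  by (simp_all add: from_conjugate_coordinates_def)

lemma L2_on_imp_absolutely_integrable:
  assumes "L2_on {u<..<v} f"
  shows "f absolutely_integrable_on {u..v}" "(\<lambda>x. (f x)\<^sup>2) absolutely_integrable_on {u..v}"
proof -
  have f: "f \<in> borel_measurable (lebesgue_on {u<..<v})" "integrable (lebesgue_on {u<..<v}) (\<lambda>x. (f x)\<^sup>2)"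
    using assms by (auto simp: L2_on_def)
  have 2: "(\<lambda>x. (f x)\<^sup>2) integrable_on {u<..<v}"
    by (rule integrable_on_lebesgue_on[OF f(2)]) simp
  have 1: "f absolutely_integrable_on {u<..<v}"
  proof (rule measurable_bounded_by_integrable_imp_absolutely_integrable[OF f(1)])
    show "(\<lambda>x. 1 + (f x)\<^sup>2) integrable_on {u<..<v}"
      using 2 by (intro integrable_add) (auto simp: integrable_on_open_interval[of _ u v, unfolded box_real])
    show "norm (f x) \<le> 1 + (f x)\<^sup>2" for x
    proof -
      have "2 * \<bar>f x\<bar> \<le> 1 + (f x)\<^sup>2" using sum_squares_bound[of "\<bar>f x\<bar>" 1] by simp
      then show ?thesis by simp
    qed
  qed simp
  have spike: "h absolutely_integrable_on {u..v}" if "h absolutely_integrable_on {u<..<v}" for h :: "real \<Rightarrow> real"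
  proof (rule absolutely_integrable_spike_set[OF that])
    show "negligible {x \<in> {u<..<v} - {u..v}. h x \<noteq> 0}" by (rule negligible_subset[of "{}"]) auto
    show "negligible {x \<in> {u..v} - {u<..<v}. h x \<noteq> 0}" by (rule negligible_subset[of "{u, v}"]) auto
  qed
  show "f absolutely_integrable_on {u..v}" by (rule spike[OF 1])
  show "(\<lambda>x. (f x)\<^sup>2) absolutely_integrable_on {u..v}"
    using 2 by (intro spike) (simp add: absolutely_integrable_on_iff_nonneg)
qed

lemma rho_absolutely_integrable: "rho a \<alpha> absolutely_integrable_on {0..pi}"
proof (rule measurable_bounded_by_integrable_imp_absolutely_integrable)
  show "rho a \<alpha> \<in> borel_measurable (lebesgue_on {0..pi})"
    unfolding rho_def[abs_def] by (intro measurable_restrict_space1 borel_measurable_if measurable_completion) auto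
  show "norm (rho a \<alpha> x) \<le> max 1 \<bar>\<alpha>\<bar>" for x by (auto simp: rho_def)
qed auto

text \<open>The normalisation and the Weyl function prescribe two linear forms of the initial value whose determinant is, up to sign, \<open>bc_det b\<close>.\<close>

lemma initial_value_from_weyl_function:
  fixes y w :: "real \<Rightarrow> complex^2"
  assumes det: "bc_det b \<noteq> 0" and "U1 b z y = U1 b z w"
    and "complex_of_real (b$4) * y 0 $ 1 + complex_of_real (b$3) * y 0 $ 2
      = complex_of_real (b$4) * w 0 $ 1 + complex_of_real (b$3) * w 0 $ 2"
  shows "y 0 = w 0"
proof -
  define d1 where "d1 = y 0 $ 1 - w 0 $ 1"
  define d2 where "d2 = y 0 $ 2 - w 0 $ 2"
  have 1: "complex_of_real (b$4) * d1 + complex_of_real (b$3) * d2 = 0"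
    using assms(3) by (simp add: d1_def d2_def algebra_simps)
  have "complex_of_real (b$1) * d2 + complex_of_real (b$2) * d1
      - z * (complex_of_real (b$4) * d1 + complex_of_real (b$3) * d2) = 0"
    using assms(2) by (simp add: U1_def d1_def d2_def algebra_simps)
  then have 2: "complex_of_real (b$1) * d2 + complex_of_real (b$2) * d1 = 0" by (simp add: 1)
  have "complex_of_real (bc_det b) * d1 = complex_of_real (b$1) * (complex_of_real (b$4) * d1 + complex_of_real (b$3) * d2)
      - complex_of_real (b$3) * (complex_of_real (b$1) * d2 + complex_of_real (b$2) * d1)"
    "complex_of_real (bc_det b) * d2 = complex_of_real (b$4) * (complex_of_real (b$1) * d2 + complex_of_real (b$2) * d1)
      - complex_of_real (b$2) * (complex_of_real (b$4) * d1 + complex_of_real (b$3) * d2)"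
    by (simp_all add: bc_det_def algebra_simps)
  then have "complex_of_real (bc_det b) * d1 = 0" "complex_of_real (bc_det b) * d2 = 0"
    unfolding 1 2 by simp_all
  then have "d1 = 0" "d2 = 0" using det by simp_all
  then show ?thesis by (simp add: d1_def d2_def vec_eq_iff forall_2)
qed

locale dirac_problem =
  fixes a \<alpha> :: real and b c :: "real^4" and p q :: "real \<Rightarrow> real"
  assumes alpha: "0 < \<alpha>" and b: "bc_det b > 0" and c: "bc_det c > 0"
    and p: "L2_on {0<..<pi} p" and q: "L2_on {0<..<pi} q"

sublocale dirac_problem \<subseteq> canonical_system pi "min 1 \<alpha>" "rho a \<alpha>" "\<lambda>x. q x - \<i> * p x"
proof
  have "bounded_linear (\<lambda>x. c * complex_of_real x)" for c
    using bounded_linear_compose[OF bounded_linear_mult_right bounded_linear_of_real] by blast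
  note bl = absolutely_integrable_linear[OF L2_on_imp_absolutely_integrable(1) this, unfolded o_def]
  show "(\<lambda>x. complex_of_real (q x) - \<i> * complex_of_real (p x)) absolutely_integrable_on {0..pi}"
    using set_integral_diff(1)[OF bl[OF q, of 1] bl[OF p, of \<i>]] by simp
  have "(\<lambda>x. (q x)\<^sup>2 + (p x)\<^sup>2) absolutely_integrable_on {0..pi}"
    by (intro set_integral_add(1) L2_on_imp_absolutely_integrable(2) p q)
  moreover have "(norm (complex_of_real (q x) - \<i> * complex_of_real (p x)))\<^sup>2 = (q x)\<^sup>2 + (p x)\<^sup>2" for x
    by (simp add: cmod_power2)
  ultimately show "(\<lambda>x. (norm (complex_of_real (q x) - \<i> * complex_of_real (p x)))\<^sup>2) absolutely_integrable_on {0..pi}"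
    by simp
qed (use alpha rho_absolutely_integrable in \<open>auto simp: rho_def\<close>)

context dirac_problem
begin

lemma dirac_solution_imp_solution:
  assumes "dirac_solution a \<alpha> p q z y"
  shows "solution z (\<lambda>x. y x $ 1 + \<i> * y x $ 2) (\<lambda>x. y x $ 1 - \<i> * y x $ 2)"
proof -
  have bl: "bounded_linear (\<lambda>w::complex^2. w $ 1 + k * w $ 2)" for k
    by (intro bounded_linear_add bounded_linear_vec_nth bounded_linear_compose[OF bounded_linear_mult_right])
  have ac: "abs_continuous_on 0 pi y" using assms by (simp add: dirac_solution_def)
  have ae: "AE x in lebesgue_on {0<..<pi}. \<exists>y'. (y has_vector_derivative y') (at x) \<and>
        Bmat *v y' + Omega p q x *v y x = (z * complex_of_real (rho a \<alpha> x)) *s y x"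
    using assms by (simp add: dirac_solution_def)
  have "AE x in lebesgue_on {0<..<pi}.
      ((\<lambda>x. y x $ 1 + \<i> * y x $ 2) has_vector_derivative
        z * (\<i> * rho a \<alpha> x) * (y x $ 1 + \<i> * y x $ 2) + (q x - \<i> * p x) * (y x $ 1 - \<i> * y x $ 2)) (at x) \<and>
      ((\<lambda>x. y x $ 1 - \<i> * y x $ 2) has_vector_derivative
        z * (- \<i> * rho a \<alpha> x) * (y x $ 1 - \<i> * y x $ 2) + cnj (q x - \<i> * p x) * (y x $ 1 + \<i> * y x $ 2)) (at x)"
    using ae
  proof eventually_elim
    case (elim x)
    then obtain y' where y': "(y has_vector_derivative y') (at x)"
      "Bmat *v y' + Omega p q x *v y x = (z * complex_of_real (rho a \<alpha> x)) *s y x" by blast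
    show ?case
      using bounded_linear.has_vector_derivative[OF bl[of "\<i>"] y'(1)]
        bounded_linear.has_vector_derivative[OF bl[of "- \<i>"] y'(1)] y'(2)
      unfolding dirac_equation_iff by (simp add: mult_ac)
  qed
  then show ?thesis
    using abs_continuous_on_bounded_linear[OF bl[of "\<i>"] ac] abs_continuous_on_bounded_linear[OF bl[of "- \<i>"] ac]
    unfolding solution_def ac_primitive_on_def by simp
qed

lemma solution_imp_dirac_solution:
  assumes "solution z f g"
  shows "dirac_solution a \<alpha> p q z (\<lambda>x. from_conjugate_coordinates (f x) (g x))"
proof -
  define F where "F = (\<lambda>x. from_conjugate_coordinates (f x) (g x))"
  define e1 e2 :: "complex^2" where "e1 = from_conjugate_coordinates 1 0" and "e2 = from_conjugate_coordinates 0 1"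
  have F: "F x = f x *s e1 + g x *s e2" for x
    by (simp add: F_def e1_def e2_def vec_eq_iff forall_2 field_simps)
  have bl: "bounded_linear (\<lambda>k. k *s e)" for e :: "complex^2"
    by (rule bounded_linear_intro[where K = "norm e"])
      (auto simp: vec_eq_iff algebra_simps norm_vec_def L2_set_def norm_mult power_mult_distrib
        real_sqrt_mult simp flip: sum_distrib_left)
  note s = assms[unfolded solution_def]
  have "ac_primitive_on 0 pi F (\<lambda>t. (z * (\<i> * rho a \<alpha> t) * f t + (q t - \<i> * p t) * g t) *s e1 +
      (z * (- \<i> * rho a \<alpha> t) * g t + cnj (q t - \<i> * p t) * f t) *s e2)"
    unfolding F by (intro ac_primitive_on_add ac_primitive_on_bounded_linear[OF bl conjunct1[OF s]]
        ac_primitive_on_bounded_linear[OF bl conjunct2[OF s]])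
  note D = ac_primitive_onD[OF this]
  show ?thesis
    unfolding dirac_solution_def F_def[symmetric]
  proof
    show "abs_continuous_on 0 pi F" by (rule D)
    show "AE x in lebesgue_on {0<..<pi}. \<exists>y'. (F has_vector_derivative y') (at x) \<and>
        Bmat *v y' + Omega p q x *v F x = (z * complex_of_real (rho a \<alpha> x)) *s F x"
      using D(2)
    proof eventually_elim
      case (elim x)
      show ?case
        by (intro exI conjI, rule elim, unfold dirac_equation_iff)
          (simp add: F e1_def e2_def field_simps)
    qed
  qed
qed

lemma U1_zero_imp:
  assumes "U1 b z y = 0" "0 < Im z"
  shows "norm (y 0 $ 1 + \<i> * y 0 $ 2) \<le> norm (y 0 $ 1 - \<i> * y 0 $ 2)"
proof (rule power2_le_imp_le)
  have "(b$1 * b$4 - b$2 * b$3) * Im (y 0 $ 2 * cnj (y 0 $ 1))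
      = Im z * (norm (of_real (b$3) * y 0 $ 2 + of_real (b$4) * y 0 $ 1))\<^sup>2"
    by (rule boundary_form) (use assms in \<open>simp add: U1_def\<close>)
  then have "0 \<le> bc_det b * Im (y 0 $ 2 * cnj (y 0 $ 1))"
    using assms(2) by (simp add: bc_det_def)
  then have "0 \<le> Im (y 0 $ 2 * cnj (y 0 $ 1))" using b mult_pos_neg[OF b] by (meson not_le)
  then show "(norm (y 0 $ 1 + \<i> * y 0 $ 2))\<^sup>2 \<le> (norm (y 0 $ 1 - \<i> * y 0 $ 2))\<^sup>2"
    using norm_square_conjugate_coordinates[of "y 0 $ 1" "y 0 $ 2"] by linarith
qed simp

lemma U2_zero_imp:
  assumes "U2 c z y = 0" "0 < Im z"
  shows "norm (y pi $ 1 - \<i> * y pi $ 2) \<le> norm (y pi $ 1 + \<i> * y pi $ 2)"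
proof (rule power2_le_imp_le)
  have "(c$1 * c$4 - c$2 * c$3) * Im (y pi $ 2 * cnj (y pi $ 1))
      = Im (- z) * (norm (of_real (c$3) * y pi $ 2 + of_real (c$4) * y pi $ 1))\<^sup>2"
    by (rule boundary_form) (use assms in \<open>simp add: U2_def add_eq_0_iff\<close>)
  then have "bc_det c * Im (y pi $ 2 * cnj (y pi $ 1)) \<le> 0"
    using assms(2) by (simp add: bc_det_def)
  then have "Im (y pi $ 2 * cnj (y pi $ 1)) \<le> 0" using mult_pos_pos[OF c] by (meson not_le)
  then show "(norm (y pi $ 1 - \<i> * y pi $ 2))\<^sup>2 \<le> (norm (y pi $ 1 + \<i> * y pi $ 2))\<^sup>2"
    using norm_square_conjugate_coordinates[of "y pi $ 1" "y pi $ 2"] by linarith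
qed simp

lemma not_eigenvalue:
  assumes z: "0 < Im z"
  shows "\<not> is_eigenvalue a \<alpha> b c p q z"
proof
  assume "is_eigenvalue a \<alpha> b c p q z"
  then obtain y x where y: "dirac_solution a \<alpha> p q z y" "x \<in> {0..pi}" "y x \<noteq> 0" "U1 b z y = 0" "U2 c z y = 0"
    unfolding is_eigenvalue_def by blast
  have "y x $ 1 + \<i> * y x $ 2 = 0" "y x $ 1 - \<i> * y x $ 2 = 0"
    using solution_zero_of_energy[OF dirac_solution_imp_solution[OF y(1)] z U1_zero_imp[OF y(4) z] U2_zero_imp[OF y(5) z] y(2)]
    by auto
  then have "y x $ 1 = 0" "y x $ 2 = 0" by (simp_all add: complex_eq_iff)
  then show False using y(3) by (simp add: vec_eq_iff forall_2)
qed

lemma boundary_forms_linear: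
  obtains A1 B1 A2 B2 where
    "\<And>f g. U1 b z (\<lambda>x. from_conjugate_coordinates (f x) (g x)) = A1 * f 0 + B1 * g 0"
    "\<And>f g. U2 c z (\<lambda>x. from_conjugate_coordinates (f x) (g x)) = A2 * f pi + B2 * g pi"
proof
  show "U1 b z (\<lambda>x. from_conjugate_coordinates (f x) (g x))
      = ((b$2 - z * b$4) / 2 + (b$1 - z * b$3) / (2 * \<i>)) * f 0
        + ((b$2 - z * b$4) / 2 - (b$1 - z * b$3) / (2 * \<i>)) * g 0" for f g
    by (simp add: U1_def add_divide_distrib diff_divide_distrib algebra_simps)
  show "U2 c z (\<lambda>x. from_conjugate_coordinates (f x) (g x))
      = ((c$2 + z * c$4) / 2 + (c$1 + z * c$3) / (2 * \<i>)) * f pi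
        + ((c$2 + z * c$4) / 2 - (c$1 + z * c$3) / (2 * \<i>)) * g pi" for f g
    by (simp add: U2_def add_divide_distrib diff_divide_distrib algebra_simps)
qed

text \<open>The solutions form a two-dimensional space, on which \<open>U2\<close> is a linear form, so some nonzero solution
  satisfies \<open>U2 = 0\<close>. As \<open>z\<close> is not an eigenvalue, \<open>U1\<close> does not vanish on it, and it can be normalised.\<close>

lemma weyl_solution_exists:
  assumes z: "0 < Im z"
  shows "\<exists>\<Phi>. is_weyl_solution a \<alpha> b c p q z \<Phi>"
proof -
  define Y where "Y r s = (\<lambda>x. from_conjugate_coordinates
      (r * \<theta>\<^sub>1 z x + s * \<phi>\<^sub>1 z x) (r * \<theta>\<^sub>2 z x + s * \<phi>\<^sub>2 z x))" for r s
  have Y_sol: "dirac_solution a \<alpha> p q z (Y r s)" for r s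
    unfolding Y_def by (intro solution_imp_dirac_solution solution_combination solution_fundamental)
  obtain A1 B1 A2 B2 where
    U1: "\<And>f g. U1 b z (\<lambda>x. from_conjugate_coordinates (f x) (g x)) = A1 * f 0 + B1 * g 0" and
    U2: "\<And>f g. U2 c z (\<lambda>x. from_conjugate_coordinates (f x) (g x)) = A2 * f pi + B2 * g pi"
    using boundary_forms_linear by blast
  have U2_lin: "U2 c z (Y r s) = r * U2 c z (Y 1 0) + s * U2 c z (Y 0 1)" for r s
    unfolding Y_def U2 by (simp add: algebra_simps)
  have U1_lin: "U1 b z (Y (k * r) (k * s)) = k * U1 b z (Y r s)" for k r s
    unfolding Y_def U1 by (simp add: algebra_simps)
  obtain r s where rs: "r \<noteq> 0 \<or> s \<noteq> 0" "U2 c z (Y r s) = 0"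
  proof (cases "U2 c z (Y 1 0) = 0")
    case True
    then show ?thesis using that[of 1 0] by simp
  next
    case False
    then show ?thesis using that[of "U2 c z (Y 0 1)" "- U2 c z (Y 1 0)"]
        U2_lin[of "U2 c z (Y 0 1)" "- U2 c z (Y 1 0)"] by (simp add: mult.commute)
  qed
  have "Y r s 0 \<noteq> 0"
    using rs(1) by (auto simp: Y_def fundamental_initial vec_eq_iff forall_2)
  then have "U1 b z (Y r s) \<noteq> 0"
    using not_eigenvalue[OF z] Y_sol[of r s] rs(2) unfolding is_eigenvalue_def by auto
  define k where "k = 1 / U1 b z (Y r s)"
  have "U1 b z (Y (k * r) (k * s)) = 1" using \<open>U1 b z (Y r s) \<noteq> 0\<close> unfolding U1_lin by (simp add: k_def)
  moreover have "U2 c z (Y (k * r) (k * s)) = 0"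
    using rs(2) unfolding U2_lin[of r s] U2_lin[of "k * r" "k * s"] by (simp add: mult.assoc flip: distrib_left)
  ultimately show ?thesis using Y_sol unfolding is_weyl_solution_def by blast
qed

text \<open>Divided by its first component at \<open>0\<close>, the Weyl solution has the form \<open>\<theta> + w \<phi>\<close>, where \<open>w\<close> depends only
  on its initial value. The first component cannot vanish at \<open>0\<close>: otherwise the energy would be nonnegative at
  \<open>0\<close> and nonpositive at \<open>\<pi>\<close>.\<close>

lemma weyl_ratio_bound:
  assumes z: "0 < Im z" and \<Phi>: "is_weyl_solution a \<alpha> b c p q z \<Phi>"
  defines "f \<equiv> \<Phi> 0 $ 1 + \<i> * \<Phi> 0 $ 2" and "g \<equiv> \<Phi> 0 $ 1 - \<i> * \<Phi> 0 $ 2"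
  shows "norm (\<theta>\<^sub>2 z pi + g / f * \<phi>\<^sub>2 z pi) \<le> norm (\<theta>\<^sub>1 z pi + g / f * \<phi>\<^sub>1 z pi)"
proof -
  define F where "F x = \<Phi> x $ 1 + \<i> * \<Phi> x $ 2" for x
  define G where "G x = \<Phi> x $ 1 - \<i> * \<Phi> x $ 2" for x
  have \<Phi>': "dirac_solution a \<alpha> p q z \<Phi>" "U1 b z \<Phi> = 1" "U2 c z \<Phi> = 0"
    using \<Phi> by (auto simp: is_weyl_solution_def)
  have sol: "solution z F G"
    using dirac_solution_imp_solution[OF \<Phi>'(1)] by (simp add: F_def[abs_def] G_def[abs_def])
  have end_le: "norm (G pi) \<le> norm (F pi)"
    using U2_zero_imp[OF \<Phi>'(3) z] by (simp add: F_def G_def)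
  have "F 0 \<noteq> 0"
  proof
    assume "F 0 = 0"
    have "0 \<in> {0..pi}" by simp
    from solution_zero_of_energy[OF sol z _ end_le this] \<open>F 0 = 0\<close> have "G 0 = 0" by simp
    then have "\<Phi> 0 $ 1 = 0" "\<Phi> 0 $ 2 = 0"
      using \<open>F 0 = 0\<close> by (simp_all add: F_def G_def complex_eq_iff)
    then show False using \<Phi>'(2) by (simp add: U1_def)
  qed
  have "pi \<in> {0..pi}" by simp
  note eq = solution_eq_combination[OF sol this]
  have "norm (F 0) * norm (\<theta>\<^sub>2 z pi + G 0 / F 0 * \<phi>\<^sub>2 z pi) = norm (G pi)"
    unfolding eq(2) norm_mult[symmetric] using \<open>F 0 \<noteq> 0\<close> by (simp add: distrib_left)
  moreover have "norm (F 0) * norm (\<theta>\<^sub>1 z pi + G 0 / F 0 * \<phi>\<^sub>1 z pi) = norm (F pi)"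
    unfolding eq(1) norm_mult[symmetric] using \<open>F 0 \<noteq> 0\<close> by (simp add: distrib_left)
  ultimately have "norm (F 0) * norm (\<theta>\<^sub>2 z pi + G 0 / F 0 * \<phi>\<^sub>2 z pi)
      \<le> norm (F 0) * norm (\<theta>\<^sub>1 z pi + G 0 / F 0 * \<phi>\<^sub>1 z pi)" using end_le by simp
  then show ?thesis using \<open>F 0 \<noteq> 0\<close> by (simp add: f_def g_def F_def G_def)
qed

end

theorem theorem10:
  fixes a \<alpha> :: real and b c :: "real^4" and p q pt qt :: "real \<Rightarrow> real"
  assumes "0 < a" "a < pi" "0 < \<alpha>" "\<alpha> \<noteq> 1"
    and "bc_det b > 0" "bc_det c > 0"
    and "L2_on {0<..<pi} p" "L2_on {0<..<pi} q"
    and "L2_on {0<..<pi} pt" "L2_on {0<..<pi} qt"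
    and "same_weyl_function a \<alpha> b c p q pt qt"
  shows "AE x in lebesgue_on {0<..<pi}. Omega p q x = Omega pt qt x"
proof -
  interpret S: dirac_problem a \<alpha> b c p q using assms by unfold_locales
  interpret T: dirac_problem a \<alpha> b c pt qt using assms by unfold_locales
  interpret pair: canonical_system_pair pi "min 1 \<alpha>" "rho a \<alpha>" "\<lambda>x. q x - \<i> * p x" "\<lambda>x. qt x - \<i> * pt x"
    by (intro canonical_system_pair.intro S.canonical_system_axioms T.canonical_system_axioms)
  have "\<exists>w. norm (S.\<theta>\<^sub>2 z pi + w * S.\<phi>\<^sub>2 z pi) \<le> norm (S.\<theta>\<^sub>1 z pi + w * S.\<phi>\<^sub>1 z pi) \<and>
      norm (T.\<theta>\<^sub>2 z pi + w * T.\<phi>\<^sub>2 z pi) \<le> norm (T.\<theta>\<^sub>1 z pi + w * T.\<phi>\<^sub>1 z pi)" if z: "0 < Im z" for z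
  proof -
    define y where "y = weyl_solution a \<alpha> b c p q z"
    define w where "w = weyl_solution a \<alpha> b c pt qt z"
    have y: "is_weyl_solution a \<alpha> b c p q z y"
      unfolding y_def weyl_solution_def using S.weyl_solution_exists[OF z] by (rule someI_ex)
    have w: "is_weyl_solution a \<alpha> b c pt qt z w"
      unfolding w_def weyl_solution_def using T.weyl_solution_exists[OF z] by (rule someI_ex)
    have "weyl_function a \<alpha> b c p q z = weyl_function a \<alpha> b c pt qt z"
      using assms(11) S.not_eigenvalue[OF z] T.not_eigenvalue[OF z] by (simp add: same_weyl_function_def)
    then have "complex_of_real (b$4) * y 0 $ 1 + complex_of_real (b$3) * y 0 $ 2
      = complex_of_real (b$4) * w 0 $ 1 + complex_of_real (b$3) * w 0 $ 2"
      using assms(5) unfolding weyl_function_def y_def[symmetric] w_def[symmetric]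
      by (simp only: divide_cancel_right neg_equal_iff_equal) simp
    moreover have "U1 b z y = U1 b z w" using y w by (simp add: is_weyl_solution_def)
    ultimately have "y 0 = w 0"
      using assms(5) by (intro initial_value_from_weyl_function[of b z]) auto
    then show ?thesis
      using S.weyl_ratio_bound[OF z y, unfolded \<open>y 0 = w 0\<close>] T.weyl_ratio_bound[OF z w] by blast
  qed
  then have "AE x in lebesgue_on {0<..<pi}.
      complex_of_real (q x) - \<i> * p x = complex_of_real (qt x) - \<i> * pt x"
    by (rule pair.potentials_equal)
  then show ?thesis
  proof eventually_elim
    case (elim x)
    then have "p x = pt x" "q x = qt x" by (simp_all add: complex_eq_iff)
    then show ?case by (simp add: Omega_def)
  qed
qed



end
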